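(* Let $n\ge 1$ and $l\ge 2$ be integers, let $H$ be a transitive subgroup of $\mathrm{Sym}_n$, let $S=S_{n,l}(H)$ and let $K$ be a field. Then $K[S]$ is a noetherian PI-algebra and $\mathrm{GKdim}(K[S])=1=\mathrm{clKdim}(K[S])$. Furthermore, if $H$ also is abelian and has no elements of order $\mathrm{char}(K)$, and $G$ is the group of fractions of $S$, then $K[G]$ is a PI-algebra and it is a principal right (and left) ideal ring.
   Context: $\mathrm{Sym}_n$ is the symmetric group on $\{1,\dots,n\}$; a subgroup $H$ is transitive if it acts transitively on $\{1,\dots,n\}$. For a subgroup $H$ of $\mathrm{Sym}_n$ and an integer $l\ge 2$, $S_{n,l}(H)$ is the monoid given by the presentation $$S_{n,l}(H)=\langle x_1,\dots ,x_n\mid x_{i_1}x_{i_2}\cdots x_{i_l} =x_{\sigma (i_1)} x_{\sigma (i_2)} \cdots x_{\sigma (i_l)},\ \sigma \in H,\ i_1,\ldots ,i_l \in \{1,\ldots ,n\}\rangle.$$ When $H$ is transitive and abelian, $S=S_{n,l}(H)$ is cancellative, $x_1^l$ is central in $S$, and the central localization $G=S\langle x_1^l\rangle^{-1}$ is a group containing $S$, called the group of fractions of $S$. $K[S]$ and $K[G]$ denote the monoid and group algebras over $K$. Noetherian means left and right noetherian; a PI-algebra is an algebra satisfying a nonzero polynomial identity; $\mathrm{GKdim}$ is the Gelfand-Kirillov dimension and $\mathrm{clKdim}$ is the classical Krull dimension (defined by chains of prime ideals). A principal right (left) ideal ring is a ring all of whose right (left) ideals are principal. If $\mathrm{char}(K)=0$,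 the condition that $H$ has no elements of order $\mathrm{char}(K)$ is vacuous. *)

theory Defs
  imports "HOL-Algebra.Sym_Groups" "HOL-Algebra.Embedded_Algebras" "HOL-Algebra.Ideal_Product"
    "HOL-Algebra.Multiplicative_Group" "HOL-Algebra.Module" "HOL-Library.Extended_Real"
begin

section \<open>Monoids given by a presentation\<close>

text \<open>The congruence on the free monoid of words over \<open>Y\<close> generated by the pairs in \<open>R\<close>.\<close>

inductive_set word_cong :: "'x set \<Rightarrow> ('x list \<times> 'x list) set \<Rightarrow> ('x list \<times> 'x list) set"
  for Y :: "'x set" and R :: "('x list \<times> 'x list) set" where
  refl: "w \<in> lists Y \<Longrightarrow> (w, w) \<in> word_cong Y R"
| step: "\<lbrakk>(a, b) \<in> R; u \<in> lists Y; v \<in> lists Y\<rbrakk> \<Longrightarrow> (u @ a @ v, u @ b @ v) \<in> word_cong Y R"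
| sym: "(a, b) \<in> word_cong Y R \<Longrightarrow> (b, a) \<in> word_cong Y R"
| trans: "\<lbrakk>(a, b) \<in> word_cong Y R; (b, c) \<in> word_cong Y R\<rbrakk> \<Longrightarrow> (a, c) \<in> word_cong Y R"

definition presented_monoid ::
    "'x set \<Rightarrow> ('x list \<times> 'x list) set \<Rightarrow> 'x list set monoid" where
  "presented_monoid Y R =
     \<lparr>carrier = lists Y // word_cong Y R,
      monoid.mult = (\<lambda>A B. \<Union>a\<in>A. \<Union>b\<in>B. word_cong Y R `` {a @ b}),
      one = word_cong Y R `` {[]}\<rparr>"

definition presented_gen :: "'x set \<Rightarrow> ('x list \<times> 'x list) set \<Rightarrow> 'x \<Rightarrow> 'x list set" where
  "presented_gen Y R x = word_cong Y R `` {[x]}"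

definition free_monoid :: "'x set \<Rightarrow> 'x list monoid" where
  "free_monoid Y = \<lparr>carrier = lists Y, monoid.mult = (@), one = []\<rparr>"


section \<open>Localization of a monoid at a central submonoid\<close>

text \<open>A pair \<open>(s, z)\<close> stands for the fraction \<open>s z\<^sup>-\<^sup>1\<close>. The definition is meaningful
  when \<open>Z\<close> is a submonoid of \<open>M\<close> consisting of central elements.\<close>

definition frac_rel :: "('m, 'e) monoid_scheme \<Rightarrow> 'm set \<Rightarrow> (('m \<times> 'm) \<times> ('m \<times> 'm)) set" where
  "frac_rel M Z = {((s, z), (t, w)). s \<in> carrier M \<and> t \<in> carrier M \<and> z \<in> Z \<and> w \<in> Z \<and>
     (\<exists>u\<in>Z. u \<otimes>\<^bsub>M\<^esub> (s \<otimes>\<^bsub>M\<^esub> w) = u \<otimes>\<^bsub>M\<^esub> (t \<otimes>\<^bsub>M\<^esub> z))}"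

definition central_localization ::
    "('m, 'e) monoid_scheme \<Rightarrow> 'm set \<Rightarrow> ('m \<times> 'm) set monoid" where
  "central_localization M Z =
     \<lparr>carrier = (carrier M \<times> Z) // frac_rel M Z,
      monoid.mult = (\<lambda>A B. \<Union>(s, z)\<in>A. \<Union>(t, w)\<in>B. frac_rel M Z `` {(s \<otimes>\<^bsub>M\<^esub> t, z \<otimes>\<^bsub>M\<^esub> w)}),
      one = frac_rel M Z `` {(\<one>\<^bsub>M\<^esub>, \<one>\<^bsub>M\<^esub>)}\<rparr>"


section \<open>The monoids \<open>S\<^sub>n\<^sub>,\<^sub>l(H)\<close> and their groups of fractions\<close>

definition perm_relations :: "nat \<Rightarrow> nat \<Rightarrow> (nat \<Rightarrow> nat) set \<Rightarrow> (nat list \<times> nat list) set" where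
  "perm_relations n l H = {(w, map \<sigma> w) | w \<sigma>. w \<in> lists {1..n} \<and> length w = l \<and> \<sigma> \<in> H}"

definition perm_monoid :: "nat \<Rightarrow> nat \<Rightarrow> (nat \<Rightarrow> nat) set \<Rightarrow> nat list set monoid" where
  "perm_monoid n l H = presented_monoid {1..n} (perm_relations n l H)"

definition perm_gen :: "nat \<Rightarrow> nat \<Rightarrow> (nat \<Rightarrow> nat) set \<Rightarrow> nat \<Rightarrow> nat list set" where
  "perm_gen n l H i = presented_gen {1..n} (perm_relations n l H) i"

definition perm_fractions ::
    "nat \<Rightarrow> nat \<Rightarrow> (nat \<Rightarrow> nat) set \<Rightarrow> (nat list set \<times> nat list set) set monoid" where
  "perm_fractions n l H =
     (let S = perm_monoid n l H;
          z = perm_gen n l H 1 [^]\<^bsub>S\<^esub> l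
      in central_localization S (range (\<lambda>k::nat. z [^]\<^bsub>S\<^esub> k)))"

definition transitive_perms :: "nat \<Rightarrow> (nat \<Rightarrow> nat) set \<Rightarrow> bool" where
  "transitive_perms n H \<longleftrightarrow> (\<forall>i\<in>{1..n}. \<forall>j\<in>{1..n}. \<exists>\<sigma>\<in>H. \<sigma> i = j)"


section \<open>Monoid algebras and polynomial identities\<close>

text \<open>Elements are the finitely supported functions \<open>M \<Rightarrow> K\<close>, extended by zero outside
  the carrier of \<open>M\<close>.\<close>

definition monoid_algebra ::
    "('k, 'c) ring_scheme \<Rightarrow> ('m, 'e) monoid_scheme \<Rightarrow> ('k, 'm \<Rightarrow> 'k) module" where
  "monoid_algebra K M =
     \<lparr>carrier = {f. range f \<subseteq> carrier K \<and> {x. f x \<noteq> \<zero>\<^bsub>K\<^esub>} \<subseteq> carrier M \<and> finite {x. f x \<noteq> \<zero>\<^bsub>K\<^esub>}},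
      monoid.mult = (\<lambda>f g x. \<Oplus>\<^bsub>K\<^esub>p\<in>{(y, z). f y \<noteq> \<zero>\<^bsub>K\<^esub> \<and> g z \<noteq> \<zero>\<^bsub>K\<^esub> \<and> y \<otimes>\<^bsub>M\<^esub> z = x}.
                 f (fst p) \<otimes>\<^bsub>K\<^esub> g (snd p)),
      one = (\<lambda>x. if x = \<one>\<^bsub>M\<^esub> then \<one>\<^bsub>K\<^esub> else \<zero>\<^bsub>K\<^esub>),
      zero = (\<lambda>x. \<zero>\<^bsub>K\<^esub>),
      add = (\<lambda>f g x. f x \<oplus>\<^bsub>K\<^esub> g x),
      smult = (\<lambda>c f x. c \<otimes>\<^bsub>K\<^esub> f x)\<rparr>"

text \<open>The library locale \<open>algebra\<close> requires a commutative multiplication.\<close>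

locale assoc_algebra = module K A + A?: ring A
  for K :: "('k, 'c) ring_scheme" and A :: "('k, 'a, 'e) module_scheme" +
  assumes smult_mult_left: "\<lbrakk>c \<in> carrier K; x \<in> carrier A; y \<in> carrier A\<rbrakk> \<Longrightarrow>
      (c \<odot>\<^bsub>A\<^esub> x) \<otimes>\<^bsub>A\<^esub> y = c \<odot>\<^bsub>A\<^esub> (x \<otimes>\<^bsub>A\<^esub> y)"
    and smult_mult_right: "\<lbrakk>c \<in> carrier K; x \<in> carrier A; y \<in> carrier A\<rbrakk> \<Longrightarrow>
      x \<otimes>\<^bsub>A\<^esub> (c \<odot>\<^bsub>A\<^esub> y) = c \<odot>\<^bsub>A\<^esub> (x \<otimes>\<^bsub>A\<^esub> y)"

text \<open>Noncommutative polynomials over \<open>K\<close> in variables indexed by the natural numbers: the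
  free algebra, as the monoid algebra of the free monoid.\<close>

definition free_algebra :: "('k, 'c) ring_scheme \<Rightarrow> ('k, nat list \<Rightarrow> 'k) module" where
  "free_algebra K = monoid_algebra K (free_monoid UNIV)"

definition nc_eval :: "('k, 'c) ring_scheme \<Rightarrow> ('k, 'a, 'e) module_scheme \<Rightarrow>
    (nat \<Rightarrow> 'a) \<Rightarrow> (nat list \<Rightarrow> 'k) \<Rightarrow> 'a" where
  "nc_eval K A a f =
     (\<Oplus>\<^bsub>A\<^esub>w\<in>{w. f w \<noteq> \<zero>\<^bsub>K\<^esub>}. f w \<odot>\<^bsub>A\<^esub> foldr (\<lambda>i y. a i \<otimes>\<^bsub>A\<^esub> y) w \<one>\<^bsub>A\<^esub>)"

definition PI_algebra :: "('k, 'c) ring_scheme \<Rightarrow> ('k, 'a, 'e) module_scheme \<Rightarrow> bool" where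
  "PI_algebra K A \<longleftrightarrow> assoc_algebra K A \<and>
     (\<exists>f\<in>carrier (free_algebra K). f \<noteq> \<zero>\<^bsub>free_algebra K\<^esub> \<and>
        (\<forall>a. range a \<subseteq> carrier A \<longrightarrow> nc_eval K A a f = \<zero>\<^bsub>A\<^esub>))"


section \<open>One-sided ideals\<close>

definition left_ideal :: "'a set \<Rightarrow> ('a, 'b) ring_scheme \<Rightarrow> bool" where
  "left_ideal I R \<longleftrightarrow> additive_subgroup I R \<and> (\<forall>a\<in>I. \<forall>x\<in>carrier R. x \<otimes>\<^bsub>R\<^esub> a \<in> I)"

definition right_ideal :: "'a set \<Rightarrow> ('a, 'b) ring_scheme \<Rightarrow> bool" where
  "right_ideal I R \<longleftrightarrow> additive_subgroup I R \<and> (\<forall>a\<in>I. \<forall>x\<in>carrier R. a \<otimes>\<^bsub>R\<^esub> x \<in> I)"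

text \<open>The library locale \<open>noetherian_ring\<close> concerns two-sided ideals only, hence the one-sided
  ascending chain conditions.\<close>

definition left_noetherian :: "('a, 'b) ring_scheme \<Rightarrow> bool" where
  "left_noetherian R \<longleftrightarrow> ring R \<and>
     (\<forall>I :: nat \<Rightarrow> 'a set. (\<forall>k. left_ideal (I k) R \<and> I k \<subseteq> I (Suc k)) \<longrightarrow>
        (\<exists>N. \<forall>k\<ge>N. I k = I N))"

definition right_noetherian :: "('a, 'b) ring_scheme \<Rightarrow> bool" where
  "right_noetherian R \<longleftrightarrow> ring R \<and>
     (\<forall>I :: nat \<Rightarrow> 'a set. (\<forall>k. right_ideal (I k) R \<and> I k \<subseteq> I (Suc k)) \<longrightarrow>
        (\<exists>N. \<forall>k\<ge>N. I k = I N))"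

definition principal_left_ideal_ring :: "('a, 'b) ring_scheme \<Rightarrow> bool" where
  "principal_left_ideal_ring R \<longleftrightarrow> ring R \<and>
     (\<forall>I. left_ideal I R \<longrightarrow> (\<exists>a\<in>carrier R. I = {x \<otimes>\<^bsub>R\<^esub> a | x. x \<in> carrier R}))"

definition principal_right_ideal_ring :: "('a, 'b) ring_scheme \<Rightarrow> bool" where
  "principal_right_ideal_ring R \<longleftrightarrow> ring R \<and>
     (\<forall>I. right_ideal I R \<longrightarrow> (\<exists>a\<in>carrier R. I = {a \<otimes>\<^bsub>R\<^esub> x | x. x \<in> carrier R}))"


section \<open>Classical Krull dimension\<close>

text \<open>The library locale \<open>primeideal\<close> is restricted to commutative rings.\<close>

definition nc_prime_ideal :: "'a set \<Rightarrow> ('a, 'b) ring_scheme \<Rightarrow> bool" where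
  "nc_prime_ideal P R \<longleftrightarrow> ideal P R \<and> P \<noteq> carrier R \<and>
     (\<forall>I J. ideal I R \<and> ideal J R \<and> I \<cdot>\<^bsub>R\<^esub> J \<subseteq> P \<longrightarrow> I \<subseteq> P \<or> J \<subseteq> P)"

definition clKdim :: "('a, 'b) ring_scheme \<Rightarrow> ereal" where
  "clKdim R = Sup {ereal (real m) | m. \<exists>P :: nat \<Rightarrow> 'a set.
     (\<forall>i\<le>m. nc_prime_ideal (P i) R) \<and> (\<forall>i<m. P i \<subset> P (Suc i))}"


section \<open>Gelfand-Kirillov dimension\<close>

text \<open>The copy \<open>K 1\<close> of the base field inside a unital algebra; the library theory of vector
  space dimension is phrased for subfields of a ring.\<close>

definition scalars :: "('k, 'c) ring_scheme \<Rightarrow> ('k, 'a, 'e) module_scheme \<Rightarrow> 'a set" where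
  "scalars K A = (\<lambda>c. c \<odot>\<^bsub>A\<^esub> \<one>\<^bsub>A\<^esub>) ` carrier K"

text \<open>On additive subgroups, \<open>ideal_prod\<close> is the additive subgroup generated by all products;
  for linear subspaces this is the span of the products. Thus \<open>subspace_power K A V m\<close> is
  \<open>V\<^sup>m\<close>, and \<open>subspace_filtration K A V m\<close> is \<open>K + V + \<dots> + V\<^sup>m\<close>.\<close>

primrec subspace_power ::
    "('k, 'c) ring_scheme \<Rightarrow> ('k, 'a, 'e) module_scheme \<Rightarrow> 'a set \<Rightarrow> nat \<Rightarrow> 'a set" where
  "subspace_power K A V 0 = scalars K A"
| "subspace_power K A V (Suc m) = subspace_power K A V m \<cdot>\<^bsub>A\<^esub> V"

primrec subspace_filtration ::
    "('k, 'c) ring_scheme \<Rightarrow> ('k, 'a, 'e) module_scheme \<Rightarrow> 'a set \<Rightarrow> nat \<Rightarrow> 'a set" where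
  "subspace_filtration K A V 0 = scalars K A"
| "subspace_filtration K A V (Suc m) =
     subspace_filtration K A V m <+>\<^bsub>A\<^esub> subspace_power K A V (Suc m)"

definition GKdim :: "('k, 'c) ring_scheme \<Rightarrow> ('k, 'a, 'e) module_scheme \<Rightarrow> ereal" where
  "GKdim K A = (SUP V\<in>{V. ring.finite_dimension A (scalars K A) V}.
     limsup (\<lambda>m. ereal (log (real m) (real (ring.dim A (scalars K A) (subspace_filtration K A V m))))))"


section \<open>Characteristic\<close>

text \<open>The additive order of \<open>1\<close>, which by the convention of \<open>group.ord\<close> is \<open>0\<close> if there is no
  positive multiple of \<open>1\<close> that vanishes.\<close>

definition ring_char :: "('k, 'c) ring_scheme \<Rightarrow> nat" where
  "ring_char K = group.ord (add_monoid K) \<one>\<^bsub>K\<^esub>"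

end

theory Submission
  imports Defs "HOL-Algebra.Sylow"
begin

text \<open>
  Write \<open>x\<^sub>i\<close> for the generators of \<open>S = S\<^sub>n\<^sub>,\<^sub>l(H)\<close> and \<open>z = x\<^sub>1\<^sup>l\<close>. Since \<open>H\<close> is transitive, \<open>z = x\<^sub>i\<^sup>l\<close> for every
  \<open>i\<close>, so \<open>z\<close> commutes with every generator and is central. Transitivity also allows all letters of a
  word except the last \<open>l - 1\<close> to be turned into \<open>x\<^sub>1\<close>. Hence every word of length at least \<open>2 l - 1\<close> is
  divisible by \<open>z\<close>, and \<open>S\<close> is the union of the sets \<open>{b, z b, z\<^sup>2 b, \<dots>}\<close> for finitely many \<open>b\<close>: the algebra
  \<open>K[S]\<close> is a finitely generated module over the central subalgebra \<open>K[z]\<close>. The statements about \<open>K[S]\<close>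
  follow from this and the grading by length.

  \<^item> It is noetherian by the argument of Hilbert's basis theorem, applied to the leading terms of
    one-sided ideals with respect to the enumeration of \<open>S\<close> by the elements \<open>z\<^sup>k b\<close>
    (\<open>shift_stable_chain_stabilises\<close>).
  \<^item> It satisfies a standard identity: the standard polynomial is alternating and linear over
    \<open>K[z]\<close>, so it vanishes as soon as it has more variables than there are generators
    (\<open>alternating_sum_vanishes\<close>). The group algebra \<open>K[G]\<close> below satisfies one for the same reason, with the
    inverse of \<open>z\<close> adjoined to \<open>K[z]\<close>.
  \<^item> The number of elements of length at most \<open>d\<close> grows linearly, which gives the Gelfand-Kirillov
    dimension (\<open>GKdim_A\<close>).
  \<^item> The homomorphism to \<open>K[t]\<close> that maps each \<open>x\<^sub>i\<close> to \<open>t\<close> and the homomorphism to \<open>K\<close> that maps each \<open>x\<^sub>i\<close> to \<open>0\<close>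
    have prime kernels, the first properly contained in the second. There is no longer chain of
    primes, by incomparability over a central subring (\<open>larger_ideal_meets_centre\<close>), used twice: over
    \<open>K[z]\<close> it shows that the second prime in a chain has finite codimension, and then over \<open>K\<close> that
    there is no third one (\<open>no_long_prime_chain\<close>).

  In the group of fractions \<open>G\<close> the length extends to a homomorphism onto the integers. Its kernel \<open>N\<close>
  consists of the fractions \<open>w / z\<close> with \<open>w\<close> a word of length \<open>l\<close>, so it is finite. Two overlapping relations
  give \<open>x\<^sub>i u x\<^sub>j = x\<^bsub>\<tau>(i)\<^esub> u x\<^bsub>\<tau>'(j)\<^esub>\<close> for words \<open>u\<close> of length \<open>l - 1\<close>, where \<open>\<tau>'\<close> is the inverse of \<open>\<tau>\<close> in \<open>H\<close>
  (\<open>distant_letters\<close>). By this relation words of length \<open>l\<close> commute, so \<open>N\<close> is abelian, and the exponent of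
  \<open>N\<close> divides the order of \<open>H\<close> (\<open>kernel_exponent\<close>). If \<open>H\<close> has no element whose order is the
  characteristic of \<open>K\<close>, then by Cauchy's theorem the order of \<open>N\<close> is invertible in \<open>K\<close>, and by
  Maschke's theorem every ideal of \<open>K[N]\<close> is generated by an idempotent. The algebra
  \<open>K[G]\<close> consists of skew Laurent polynomials in \<open>x\<^sub>1\<close> over \<open>K[N]\<close>. The ideals of leading coefficients of a
  left ideal, taken by increasing width of the support, form an ascending chain generated by
  idempotents; elements realizing the successive differences of these idempotents can be added up to
  a single generator (\<open>principal_left_ideal_ring_A\<close>). Right ideals are treated in the opposite group.
\<close>

section \<open>Monoid algebras\<close>

lemma (in abelian_monoid) finsum_superset:
  assumes "finite B" "A \<subseteq> B" "f \<in> A \<rightarrow> carrier G" "\<And>x. x \<in> B - A \<Longrightarrow> f x = \<zero>"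
  shows "finsum G f A = finsum G f B"
  using assms by (intro add.finprod_mono_neutral_cong_left) auto

definition single :: "('k, 'c) ring_scheme \<Rightarrow> 'k \<Rightarrow> 'm \<Rightarrow> 'm \<Rightarrow> 'k" where
  "single K c s = (\<lambda>x. if x = s then c else \<zero>\<^bsub>K\<^esub>)"

definition supp :: "('k, 'c) ring_scheme \<Rightarrow> ('m \<Rightarrow> 'k) \<Rightarrow> 'm set" where
  "supp K f = {x. f x \<noteq> \<zero>\<^bsub>K\<^esub>}"

locale monoid_alg = K: cring K + M: monoid M
  for K :: "('k, 'c) ring_scheme" and M :: "('m, 'e) monoid_scheme"
begin

abbreviation A where "A \<equiv> monoid_algebra K M"

lemma carrier_iff:
  "f \<in> carrier A \<longleftrightarrow> (\<forall>x. f x \<in> carrier K) \<and> supp K f \<subseteq> carrier M \<and> finite (supp K f)"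
  by (auto simp: monoid_algebra_def supp_def)

lemma carrierI:
  assumes "\<And>x. f x \<in> carrier K" "\<And>x. x \<notin> F \<Longrightarrow> f x = \<zero>\<^bsub>K\<^esub>" "F \<subseteq> carrier M" "finite F"
  shows "f \<in> carrier A"
  using assms finite_subset[of "supp K f" F] by (auto simp: carrier_iff supp_def)

lemma value_in [simp]: "f \<in> carrier A \<Longrightarrow> f x \<in> carrier K"
  using carrier_iff by blast

lemma supp_finite [simp, intro]: "f \<in> carrier A \<Longrightarrow> finite (supp K f)"
  using carrier_iff by blast

lemma supp_in [intro]: "f \<in> carrier A \<Longrightarrow> supp K f \<subseteq> carrier M"
  using carrier_iff by blast

lemma outside_supp: "x \<notin> supp K f \<Longrightarrow> f x = \<zero>\<^bsub>K\<^esub>"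
  by (simp add: supp_def)

lemma add_eq: "f \<oplus>\<^bsub>A\<^esub> g = (\<lambda>x. f x \<oplus>\<^bsub>K\<^esub> g x)"
  by (simp add: monoid_algebra_def)

lemma zero_eq: "\<zero>\<^bsub>A\<^esub> = (\<lambda>x. \<zero>\<^bsub>K\<^esub>)"
  by (simp add: monoid_algebra_def)

lemma one_eq: "\<one>\<^bsub>A\<^esub> = single K \<one>\<^bsub>K\<^esub> \<one>\<^bsub>M\<^esub>"
  by (simp add: monoid_algebra_def single_def)

lemma smult_eq: "c \<odot>\<^bsub>A\<^esub> f = (\<lambda>x. c \<otimes>\<^bsub>K\<^esub> f x)"
  by (simp add: monoid_algebra_def)

lemma add_apply: "(f \<oplus>\<^bsub>A\<^esub> g) x = f x \<oplus>\<^bsub>K\<^esub> g x"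
  and smult_apply: "(c \<odot>\<^bsub>A\<^esub> f) x = c \<otimes>\<^bsub>K\<^esub> f x"
  and zero_apply: "\<zero>\<^bsub>A\<^esub> x = \<zero>\<^bsub>K\<^esub>"
  by (simp_all add: monoid_algebra_def)

lemma mult_eq:
  "(f \<otimes>\<^bsub>A\<^esub> g) x = (\<Oplus>\<^bsub>K\<^esub>p\<in>{(y, z). f y \<noteq> \<zero>\<^bsub>K\<^esub> \<and> g z \<noteq> \<zero>\<^bsub>K\<^esub> \<and> y \<otimes>\<^bsub>M\<^esub> z = x}.
                 f (fst p) \<otimes>\<^bsub>K\<^esub> g (snd p))"
  by (simp add: monoid_algebra_def)

text \<open>The defining sum of a product depends on the supports of the factors. Enlarging both supports to
  arbitrary finite sets makes products with different supports comparable, which is what the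
  distributive laws need.\<close>

lemma mult_on:
  assumes f: "f \<in> carrier A" and g: "g \<in> carrier A"
    and F: "finite F" "supp K f \<subseteq> F" and G: "finite G" "supp K g \<subseteq> G"
  shows "(f \<otimes>\<^bsub>A\<^esub> g) x =
    (\<Oplus>\<^bsub>K\<^esub>p\<in>{p \<in> F \<times> G. fst p \<otimes>\<^bsub>M\<^esub> snd p = x}. f (fst p) \<otimes>\<^bsub>K\<^esub> g (snd p))"
  unfolding mult_eq using assms
  by (intro K.finsum_superset) (auto simp: supp_def)

lemma zero_carrier [simp, intro]: "\<zero>\<^bsub>A\<^esub> \<in> carrier A"
  by (rule carrierI[of _ "{}"]) (auto simp: zero_eq)

lemma single_carrier [simp, intro]:
  "c \<in> carrier K \<Longrightarrow> s \<in> carrier M \<Longrightarrow> single K c s \<in> carrier A"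
  by (rule carrierI[of _ "{s}"]) (auto simp: single_def)

lemma add_carrier [simp, intro]:
  assumes "f \<in> carrier A" "g \<in> carrier A" shows "f \<oplus>\<^bsub>A\<^esub> g \<in> carrier A"
  using assms
  by (intro carrierI[of _ "supp K f \<union> supp K g"]) (auto simp: add_eq outside_supp dest: supp_in)

lemma smult_carrier [simp, intro]:
  assumes "c \<in> carrier K" "f \<in> carrier A" shows "c \<odot>\<^bsub>A\<^esub> f \<in> carrier A"
  using assms by (intro carrierI[of _ "supp K f"]) (auto simp: smult_eq outside_supp dest: supp_in)

lemma supp_mult:
  assumes f: "f \<in> carrier A" and g: "g \<in> carrier A"
  shows "supp K (f \<otimes>\<^bsub>A\<^esub> g) \<subseteq> (\<lambda>(y, z). y \<otimes>\<^bsub>M\<^esub> z) ` (supp K f \<times> supp K g)"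
proof
  fix x assume x: "x \<in> supp K (f \<otimes>\<^bsub>A\<^esub> g)"
  show "x \<in> (\<lambda>(y, z). y \<otimes>\<^bsub>M\<^esub> z) ` (supp K f \<times> supp K g)"
  proof (rule ccontr)
    assume "\<not> ?thesis"
    then have e: "{(y, z). f y \<noteq> \<zero>\<^bsub>K\<^esub> \<and> g z \<noteq> \<zero>\<^bsub>K\<^esub> \<and> y \<otimes>\<^bsub>M\<^esub> z = x} = {}"
      by (auto simp: supp_def)
    have "(f \<otimes>\<^bsub>A\<^esub> g) x = \<zero>\<^bsub>K\<^esub>" unfolding mult_eq e by simp
    with x show False by (simp add: supp_def)
  qed
qed

lemma mult_carrier [simp, intro]:
  assumes f: "f \<in> carrier A" and g: "g \<in> carrier A" shows "f \<otimes>\<^bsub>A\<^esub> g \<in> carrier A"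
proof (rule carrierI)
  show "(f \<otimes>\<^bsub>A\<^esub> g) x \<in> carrier K" for x
    unfolding mult_eq using f g by (intro K.finsum_closed) auto
  show "(f \<otimes>\<^bsub>A\<^esub> g) x = \<zero>\<^bsub>K\<^esub>"
    if "x \<notin> (\<lambda>(y, z). y \<otimes>\<^bsub>M\<^esub> z) ` (supp K f \<times> supp K g)" for x
    using supp_mult[OF f g] that by (auto simp: supp_def)
  show "(\<lambda>(y, z). y \<otimes>\<^bsub>M\<^esub> z) ` (supp K f \<times> supp K g) \<subseteq> carrier M"
    using supp_in[OF f] supp_in[OF g] by auto
qed (use f g in auto)

lemma abelian_group_A: "abelian_group A"
proof (rule abelian_groupI)
  show "\<exists>y\<in>carrier A. y \<oplus>\<^bsub>A\<^esub> f = \<zero>\<^bsub>A\<^esub>" if f: "f \<in> carrier A" for f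
  proof
    show "(\<lambda>x. \<ominus>\<^bsub>K\<^esub> f x) \<in> carrier A"
      using f by (intro carrierI[of _ "supp K f"]) (auto simp: outside_supp dest: supp_in)
    show "(\<lambda>x. \<ominus>\<^bsub>K\<^esub> f x) \<oplus>\<^bsub>A\<^esub> f = \<zero>\<^bsub>A\<^esub>"
      using f by (auto simp: add_eq zero_eq K.l_neg)
  qed
next
  fix f g h assume "f \<in> carrier A" "g \<in> carrier A" "h \<in> carrier A"
  then show "f \<oplus>\<^bsub>A\<^esub> g \<oplus>\<^bsub>A\<^esub> h = f \<oplus>\<^bsub>A\<^esub> (g \<oplus>\<^bsub>A\<^esub> h)" "f \<oplus>\<^bsub>A\<^esub> g = g \<oplus>\<^bsub>A\<^esub> f" "\<zero>\<^bsub>A\<^esub> \<oplus>\<^bsub>A\<^esub> f = f"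
    by (auto simp: fun_eq_iff add_apply zero_apply K.a_assoc intro: K.a_comm)
qed auto

sublocale A: abelian_group A by (rule abelian_group_A)

lemma module_A: "module K A"
  by (rule moduleI)
     (auto simp: fun_eq_iff K.is_cring A.abelian_group_axioms smult_apply add_apply K.l_distr K.r_distr K.m_assoc)

text \<open>Additive properties need only be checked on terms \<open>c s\<close>. Applied in each argument, this
  reduces associativity and the unit laws of the algebra to those of the monoid.\<close>

lemma single_induct [consumes 1, case_names zero add]:
  assumes f: "f \<in> carrier A" and z: "P \<zero>\<^bsub>A\<^esub>"
    and a: "\<And>c s g. c \<in> carrier K \<Longrightarrow> s \<in> supp K f \<Longrightarrow> s \<in> carrier M \<Longrightarrow> g \<in> carrier A \<Longrightarrow> P g \<Longrightarrow>
      P (single K c s \<oplus>\<^bsub>A\<^esub> g)"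
  shows "P f"
proof -
  have "g \<in> carrier A \<Longrightarrow> supp K g \<subseteq> F \<Longrightarrow> P g" if "finite F" "F \<subseteq> supp K f" for F g
    using that
  proof (induction F arbitrary: g)
    case empty
    then have "g = \<zero>\<^bsub>A\<^esub>" by (auto simp: zero_eq supp_def)
    with z show ?case by simp
  next
    case (insert s F)
    let ?g = "g(s := \<zero>\<^bsub>K\<^esub>)"
    have g': "?g \<in> carrier A"
      using insert.prems
      by (intro carrierI[of _ "supp K g"]) (auto simp: outside_supp dest: supp_in)
    have "supp K ?g \<subseteq> F" using insert.prems by (auto simp: supp_def)
    then have "P ?g" using insert.prems g' insert.IH[of ?g] by blast
    moreover have "g = single K (g s) s \<oplus>\<^bsub>A\<^esub> ?g"
      using insert.prems by (auto simp: fun_eq_iff add_apply single_def)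
    moreover have "s \<in> supp K f" "s \<in> carrier M"
      using insert.prems supp_in[OF f] by auto
    ultimately show ?case using a[of "g s" s ?g] insert.prems g' by simp
  qed
  from this[of "supp K f" f] show ?thesis using f by auto
qed

lemma mult_l_distr:
  assumes f: "f \<in> carrier A" "g \<in> carrier A" "h \<in> carrier A"
  shows "(f \<oplus>\<^bsub>A\<^esub> g) \<otimes>\<^bsub>A\<^esub> h = f \<otimes>\<^bsub>A\<^esub> h \<oplus>\<^bsub>A\<^esub> g \<otimes>\<^bsub>A\<^esub> h"
proof
  fix x
  let ?F = "supp K f \<union> supp K g" and ?H = "supp K h"
  have s: "supp K (f \<oplus>\<^bsub>A\<^esub> g) \<subseteq> ?F" using assms by (auto simp: supp_def add_apply)
  have fin: "finite ?F" "finite ?H" using assms by auto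
  show "((f \<oplus>\<^bsub>A\<^esub> g) \<otimes>\<^bsub>A\<^esub> h) x = (f \<otimes>\<^bsub>A\<^esub> h \<oplus>\<^bsub>A\<^esub> g \<otimes>\<^bsub>A\<^esub> h) x"
    unfolding add_apply[of "f \<otimes>\<^bsub>A\<^esub> h"]
    by (subst (1 2 3) mult_on[where F = ?F and G = ?H])
       (use s fin assms in \<open>auto simp: add_apply K.l_distr intro!: K.finsum_addf[symmetric]
           cong: K.finsum_cong\<close>)
qed

lemma mult_r_distr:
  assumes f: "f \<in> carrier A" "g \<in> carrier A" "h \<in> carrier A"
  shows "h \<otimes>\<^bsub>A\<^esub> (f \<oplus>\<^bsub>A\<^esub> g) = h \<otimes>\<^bsub>A\<^esub> f \<oplus>\<^bsub>A\<^esub> h \<otimes>\<^bsub>A\<^esub> g"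
proof
  fix x
  let ?F = "supp K f \<union> supp K g" and ?H = "supp K h"
  have s: "supp K (f \<oplus>\<^bsub>A\<^esub> g) \<subseteq> ?F" using assms by (auto simp: supp_def add_apply)
  have fin: "finite ?F" "finite ?H" using assms by auto
  show "(h \<otimes>\<^bsub>A\<^esub> (f \<oplus>\<^bsub>A\<^esub> g)) x = (h \<otimes>\<^bsub>A\<^esub> f \<oplus>\<^bsub>A\<^esub> h \<otimes>\<^bsub>A\<^esub> g) x"
    unfolding add_apply[of "h \<otimes>\<^bsub>A\<^esub> f"]
    by (subst (1 2 3) mult_on[where F = ?H and G = ?F])
       (use s fin assms in \<open>auto simp: add_apply K.r_distr intro!: K.finsum_addf[symmetric]
           cong: K.finsum_cong\<close>)
qed

lemma smult_mult_l:
  assumes "c \<in> carrier K" "f \<in> carrier A" "h \<in> carrier A"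
  shows "(c \<odot>\<^bsub>A\<^esub> f) \<otimes>\<^bsub>A\<^esub> h = c \<odot>\<^bsub>A\<^esub> (f \<otimes>\<^bsub>A\<^esub> h)"
proof
  fix x
  have s: "supp K (c \<odot>\<^bsub>A\<^esub> f) \<subseteq> supp K f" using assms by (auto simp: supp_def smult_apply)
  show "((c \<odot>\<^bsub>A\<^esub> f) \<otimes>\<^bsub>A\<^esub> h) x = (c \<odot>\<^bsub>A\<^esub> (f \<otimes>\<^bsub>A\<^esub> h)) x"
    unfolding smult_apply[of c "f \<otimes>\<^bsub>A\<^esub> h"]
    apply (subst (1 2) mult_on[where F = "supp K f" and G = "supp K h"])
    using s assms by (auto simp: smult_apply K.m_assoc intro!: K.finsum_rdistr[symmetric])
qed

lemma smult_mult_r: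
  assumes "c \<in> carrier K" "f \<in> carrier A" "h \<in> carrier A"
  shows "h \<otimes>\<^bsub>A\<^esub> (c \<odot>\<^bsub>A\<^esub> f) = c \<odot>\<^bsub>A\<^esub> (h \<otimes>\<^bsub>A\<^esub> f)"
proof
  fix x
  have s: "supp K (c \<odot>\<^bsub>A\<^esub> f) \<subseteq> supp K f" using assms by (auto simp: supp_def smult_apply)
  show "(h \<otimes>\<^bsub>A\<^esub> (c \<odot>\<^bsub>A\<^esub> f)) x = (c \<odot>\<^bsub>A\<^esub> (h \<otimes>\<^bsub>A\<^esub> f)) x"
    unfolding smult_apply[of c "h \<otimes>\<^bsub>A\<^esub> f"]
    apply (subst (1 2) mult_on[where F = "supp K h" and G = "supp K f"])
    using s assms by (auto simp: smult_apply K.m_lcomm K.finsum_rdistr intro!: K.finsum_cong')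
qed

lemma single_mult_single:
  assumes "c \<in> carrier K" "d \<in> carrier K" "s \<in> carrier M" "t \<in> carrier M"
  shows "single K c s \<otimes>\<^bsub>A\<^esub> single K d t = single K (c \<otimes>\<^bsub>K\<^esub> d) (s \<otimes>\<^bsub>M\<^esub> t)"
proof
  fix x
  have e: "{p \<in> {s} \<times> {t}. fst p \<otimes>\<^bsub>M\<^esub> snd p = x} = (if x = s \<otimes>\<^bsub>M\<^esub> t then {(s, t)} else {})"
    by auto
  have s: "supp K (single K c s) \<subseteq> {s}" "supp K (single K d t) \<subseteq> {t}"
    by (auto simp: supp_def single_def)
  show "(single K c s \<otimes>\<^bsub>A\<^esub> single K d t) x = single K (c \<otimes>\<^bsub>K\<^esub> d) (s \<otimes>\<^bsub>M\<^esub> t) x"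
    apply (subst mult_on[where F = "{s}" and G = "{t}"])
    using assms s unfolding e by simp_all (simp add: single_def)
qed

lemma zero_mult [simp]:
  assumes f: "f \<in> carrier A" shows "\<zero>\<^bsub>A\<^esub> \<otimes>\<^bsub>A\<^esub> f = \<zero>\<^bsub>A\<^esub>" "f \<otimes>\<^bsub>A\<^esub> \<zero>\<^bsub>A\<^esub> = \<zero>\<^bsub>A\<^esub>"
  by (auto simp: fun_eq_iff mult_eq zero_eq)

lemma mult_assoc_A:
  assumes f: "f \<in> carrier A" and g: "g \<in> carrier A" and h: "h \<in> carrier A"
  shows "(f \<otimes>\<^bsub>A\<^esub> g) \<otimes>\<^bsub>A\<^esub> h = f \<otimes>\<^bsub>A\<^esub> (g \<otimes>\<^bsub>A\<^esub> h)"
  using f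
proof (induction rule: single_induct)
  case zero show ?case using g h by simp
next
  case f: (add c s f)
  have "(single K c s \<otimes>\<^bsub>A\<^esub> g) \<otimes>\<^bsub>A\<^esub> h = single K c s \<otimes>\<^bsub>A\<^esub> (g \<otimes>\<^bsub>A\<^esub> h)"
    using g
  proof (induction rule: single_induct)
    case zero show ?case using f h by simp
  next
    case g: (add d t g)
    have "(single K c s \<otimes>\<^bsub>A\<^esub> single K d t) \<otimes>\<^bsub>A\<^esub> h = single K c s \<otimes>\<^bsub>A\<^esub> (single K d t \<otimes>\<^bsub>A\<^esub> h)"
      using h
    proof (induction rule: single_induct)
      case zero show ?case using f g by simp
    next
      case h: (add e u h)
      then show ?case using f g
        by (simp add: mult_r_distr single_mult_single K.m_assoc M.m_assoc)
    qed
    then show ?case using f g h by (simp add: mult_r_distr mult_l_distr)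
  qed
  then show ?case using f g h by (simp add: mult_l_distr)
qed

lemma one_mult_A:
  assumes f: "f \<in> carrier A"
  shows "\<one>\<^bsub>A\<^esub> \<otimes>\<^bsub>A\<^esub> f = f" "f \<otimes>\<^bsub>A\<^esub> \<one>\<^bsub>A\<^esub> = f"
  using f
  by (induction rule: single_induct)
     (simp_all add: one_eq mult_r_distr mult_l_distr single_mult_single)

lemma ring_A: "ring A"
proof (rule ringI)
  show "monoid A"
    by (rule monoidI) (auto simp: mult_assoc_A one_mult_A, simp add: one_eq)
qed (auto simp: abelian_group_A mult_l_distr mult_r_distr)

(* The left-hand side of this rule is the application of an arbitrary function to an arbitrary
   argument, so as a rewrite rule it matches almost every term. *)
declare value_in [simp del]

sublocale A: ring A by (rule ring_A)

lemma assoc_algebra_A: "assoc_algebra K A"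
  by (intro assoc_algebra.intro assoc_algebra_axioms.intro module_A ring_A smult_mult_l
      smult_mult_r[symmetric] smult_mult_r) auto

sublocale A: assoc_algebra K A by (rule assoc_algebra_A)

lemma smult_single: "c \<odot>\<^bsub>A\<^esub> single K d s = single K (c \<otimes>\<^bsub>K\<^esub> d) s" if "c \<in> carrier K"
  using that by (auto simp: fun_eq_iff smult_apply single_def)

end

section \<open>Leading terms and ascending chains\<close>

lemma (in abelian_group) add_minus_add_cancel:
  assumes "x \<in> carrier G" "u \<in> carrier G" "v \<in> carrier G"
  shows "(x \<oplus> u) \<ominus> (x \<oplus> v) = u \<ominus> v"
proof -
  have "(x \<oplus> u) \<oplus> (\<ominus> x \<oplus> \<ominus> v) = (x \<oplus> \<ominus> x) \<oplus> (u \<oplus> \<ominus> v)"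
    using assms by (simp only: a_ac a_inv_closed a_closed)
  then show ?thesis using assms by (simp add: a_minus_def minus_add r_neg)
qed

lemma (in module) submodule_closed:
  assumes "submodule I R M"
  shows "I \<subseteq> carrier M" "\<zero>\<^bsub>M\<^esub> \<in> I"
    "\<And>x y. x \<in> I \<Longrightarrow> y \<in> I \<Longrightarrow> x \<oplus>\<^bsub>M\<^esub> y \<in> I"
    "\<And>x y. x \<in> I \<Longrightarrow> y \<in> I \<Longrightarrow> x \<ominus>\<^bsub>M\<^esub> y \<in> I"
    "\<And>x. x \<in> I \<Longrightarrow> \<ominus>\<^bsub>M\<^esub> x \<in> I"
    "\<And>c x. c \<in> carrier R \<Longrightarrow> x \<in> I \<Longrightarrow> c \<odot>\<^bsub>M\<^esub> x \<in> I"
proof -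
  note E = submoduleE[OF assms]
  show "I \<subseteq> carrier M" "\<And>x y. x \<in> I \<Longrightarrow> y \<in> I \<Longrightarrow> x \<oplus>\<^bsub>M\<^esub> y \<in> I"
    "\<And>x. x \<in> I \<Longrightarrow> \<ominus>\<^bsub>M\<^esub> x \<in> I"
    "\<And>c x. c \<in> carrier R \<Longrightarrow> x \<in> I \<Longrightarrow> c \<odot>\<^bsub>M\<^esub> x \<in> I"
    using E by auto
  show "x \<in> I \<Longrightarrow> y \<in> I \<Longrightarrow> x \<ominus>\<^bsub>M\<^esub> y \<in> I" for x y
    unfolding a_minus_def using E by auto
  obtain x where "x \<in> I" using E(2) by auto
  then show "\<zero>\<^bsub>M\<^esub> \<in> I" using E(4)[of \<zero> x] E(1) by (auto simp: smult_l_null)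
qed

text \<open>The sequence \<open>\<phi>\<close> plays the role of an ordered basis. It may be linearly dependent, so it can
  enumerate a monoid with repetitions, and no normal form for the elements has to be chosen.\<close>

locale vector_sequence = K: field K + V: module K V
  for K :: "('k, 'c) ring_scheme" and V :: "('k, 'v, 'e) module_scheme" +
  fixes \<phi> :: "nat \<Rightarrow> 'v"
  assumes seq_carrier [simp, intro]: "\<phi> i \<in> carrier V"
begin

primrec initial_span :: "nat \<Rightarrow> 'v set" where
  "initial_span 0 = {\<zero>\<^bsub>V\<^esub>}"
| "initial_span (Suc d) = {c \<odot>\<^bsub>V\<^esub> \<phi> d \<oplus>\<^bsub>V\<^esub> u | c u. c \<in> carrier K \<and> u \<in> initial_span d}"

lemma initial_spanI:
  "c \<in> carrier K \<Longrightarrow> u \<in> initial_span d \<Longrightarrow> c \<odot>\<^bsub>V\<^esub> \<phi> d \<oplus>\<^bsub>V\<^esub> u \<in> initial_span (Suc d)"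
  by auto

lemma initial_span_carrier: "initial_span d \<subseteq> carrier V"
  by (induction d) auto

lemma initial_span_submodule: "submodule (initial_span d) K V"
proof (induction d)
  case 0
  show ?case by (intro V.submoduleI) auto
next
  case (Suc d)
  note IH = V.submodule_closed[OF Suc]
  have c: "x \<in> carrier V" if "x \<in> initial_span d" for x using IH(1) that by auto
  show ?case
  proof (intro V.submoduleI)
    show "initial_span (Suc d) \<subseteq> carrier V" by (rule initial_span_carrier)
    show "\<zero>\<^bsub>V\<^esub> \<in> initial_span (Suc d)" using initial_spanI[of "\<zero>\<^bsub>K\<^esub>" "\<zero>\<^bsub>V\<^esub>" d] IH(2) by simp
  next
    fix a assume "a \<in> initial_span (Suc d)"
    then obtain k u where "a = k \<odot>\<^bsub>V\<^esub> \<phi> d \<oplus>\<^bsub>V\<^esub> u" "k \<in> carrier K" "u \<in> initial_span d" by auto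
    moreover from this have "\<ominus>\<^bsub>V\<^esub> a = (\<ominus>\<^bsub>K\<^esub> k) \<odot>\<^bsub>V\<^esub> \<phi> d \<oplus>\<^bsub>V\<^esub> \<ominus>\<^bsub>V\<^esub> u"
      using c by (simp add: V.smult_l_minus V.minus_add)
    ultimately show "\<ominus>\<^bsub>V\<^esub> a \<in> initial_span (Suc d)" using IH(5) by auto
  next
    fix a b assume "a \<in> initial_span (Suc d)" "b \<in> initial_span (Suc d)"
    then obtain k u k' u' where "a = k \<odot>\<^bsub>V\<^esub> \<phi> d \<oplus>\<^bsub>V\<^esub> u" "k \<in> carrier K" "u \<in> initial_span d"
      "b = k' \<odot>\<^bsub>V\<^esub> \<phi> d \<oplus>\<^bsub>V\<^esub> u'" "k' \<in> carrier K" "u' \<in> initial_span d" by auto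
    moreover from this have "a \<oplus>\<^bsub>V\<^esub> b = (k \<oplus>\<^bsub>K\<^esub> k') \<odot>\<^bsub>V\<^esub> \<phi> d \<oplus>\<^bsub>V\<^esub> (u \<oplus>\<^bsub>V\<^esub> u')"
      using c by (simp add: V.smult_l_distr V.a_ac)
    ultimately show "a \<oplus>\<^bsub>V\<^esub> b \<in> initial_span (Suc d)" using IH(3) by (auto intro!: exI)
  next
    fix q a assume "q \<in> carrier K" "a \<in> initial_span (Suc d)"
    then obtain k u where "q \<in> carrier K"
      "a = k \<odot>\<^bsub>V\<^esub> \<phi> d \<oplus>\<^bsub>V\<^esub> u" "k \<in> carrier K" "u \<in> initial_span d" by auto
    moreover from this have "q \<odot>\<^bsub>V\<^esub> a = (q \<otimes>\<^bsub>K\<^esub> k) \<odot>\<^bsub>V\<^esub> \<phi> d \<oplus>\<^bsub>V\<^esub> q \<odot>\<^bsub>V\<^esub> u"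
      using c by (simp add: V.smult_r_distr V.smult_assoc1)
    ultimately show "q \<odot>\<^bsub>V\<^esub> a \<in> initial_span (Suc d)" using IH(6) by (auto intro!: exI)
  qed
qed

lemmas initial_span_closed = V.submodule_closed[OF initial_span_submodule]

lemma initial_span_Suc: "initial_span d \<subseteq> initial_span (Suc d)"
proof
  fix u assume u: "u \<in> initial_span d"
  then have "u \<in> carrier V" using initial_span_carrier by auto
  with u show "u \<in> initial_span (Suc d)" using initial_spanI[of "\<zero>\<^bsub>K\<^esub>" u d] by simp
qed

lemma initial_span_mono: "d \<le> e \<Longrightarrow> initial_span d \<subseteq> initial_span e"
  using lift_Suc_mono_le[of initial_span] initial_span_Suc by blast

lemma seq_initial_span: "\<phi> d \<in> initial_span (Suc d)"
  using initial_spanI[of "\<one>\<^bsub>K\<^esub>" "\<zero>\<^bsub>V\<^esub>" d] initial_span_closed(2) by simp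

text \<open>The positions of leading terms, as for the initial ideals of Groebner basis theory. If \<open>\<phi> d\<close>
  depends on its predecessors then \<open>d\<close> is a leading position of every subspace.\<close>

definition lead :: "'v set \<Rightarrow> nat set" where
  "lead I = {d. \<exists>u\<in>initial_span d. \<phi> d \<oplus>\<^bsub>V\<^esub> u \<in> I}"

lemma lead_mono: "I \<subseteq> J \<Longrightarrow> lead I \<subseteq> lead J"
  by (auto simp: lead_def)

text \<open>Division with remainder: a leading term of \<open>f\<close> at a position \<open>d \<ge> d0\<close> is also the leading term of
  an element of \<open>I\<close>, and subtracting a multiple of that element lowers the position. With \<open>d0 = 0\<close>
  the elements of \<open>J\<close> in an initial span belong to \<open>I\<close>; with larger \<open>d0\<close> they are congruent modulo \<open>I\<close> to
  combinations of the first \<open>d0\<close> vectors.\<close>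

lemma reduce_by_lead:
  assumes I: "submodule I K V" and J: "submodule J K V" and IJ: "I \<subseteq> J"
    and lead: "\<And>d. d \<ge> d0 \<Longrightarrow> d \<in> lead J \<Longrightarrow> d \<in> lead I"
    and f: "f \<in> J" "f \<in> initial_span d"
  shows "\<exists>i\<in>I. \<exists>u\<in>J \<inter> initial_span d0. f = i \<oplus>\<^bsub>V\<^esub> u"
  using f
proof (induction d arbitrary: f)
  note IC = V.submodule_closed[OF I] and JC = V.submodule_closed[OF J]
  have trivial: "\<exists>i\<in>I. \<exists>u\<in>J \<inter> initial_span d0. f = i \<oplus>\<^bsub>V\<^esub> u"
    if "f \<in> J" "f \<in> initial_span d0" for f
    by (rule bexI[OF bexI[of _ f] IC(2)]) (use that JC(1) in auto)
  case 0
  then show ?case using trivial initial_span_mono by blast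
next
  note IC = V.submodule_closed[OF I] and JC = V.submodule_closed[OF J]
  have trivial: "\<exists>i\<in>I. \<exists>u\<in>J \<inter> initial_span d0. f = i \<oplus>\<^bsub>V\<^esub> u"
    if "f \<in> J" "f \<in> initial_span d0" for f
    by (rule bexI[OF bexI[of _ f] IC(2)]) (use that JC(1) in auto)
  case (Suc d)
  show ?case
  proof (cases "Suc d \<le> d0")
    case True
    then show ?thesis using trivial Suc.prems initial_span_mono by blast
  next
    case False
    obtain c u where f: "f = c \<odot>\<^bsub>V\<^esub> \<phi> d \<oplus>\<^bsub>V\<^esub> u" and c: "c \<in> carrier K" and u: "u \<in> initial_span d"
      using Suc.prems by auto
    have uV: "u \<in> carrier V" using u initial_span_carrier by auto
    show ?thesis
    proof (cases "c = \<zero>\<^bsub>K\<^esub>")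
      case True
      then show ?thesis using f u uV Suc by auto
    next
      case False
      then have unit: "c \<in> Units K" using c by (simp add: K.field_Units)
      let ?c = "inv\<^bsub>K\<^esub> c"
      have c': "?c \<in> carrier K" using unit by simp
      have "?c \<odot>\<^bsub>V\<^esub> f = (?c \<otimes>\<^bsub>K\<^esub> c) \<odot>\<^bsub>V\<^esub> \<phi> d \<oplus>\<^bsub>V\<^esub> ?c \<odot>\<^bsub>V\<^esub> u"
        using f c c' uV by (simp add: V.smult_r_distr V.smult_assoc1)
      also have "\<dots> = \<phi> d \<oplus>\<^bsub>V\<^esub> ?c \<odot>\<^bsub>V\<^esub> u" using unit by simp
      finally have "d \<in> lead J"
        using JC(6)[OF c' Suc.prems(1)] initial_span_closed(6)[OF c' u] by (auto simp: lead_def)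
      then have "d \<in> lead I" using lead \<open>\<not> Suc d \<le> d0\<close> by simp
      then obtain w where w: "w \<in> initial_span d" "\<phi> d \<oplus>\<^bsub>V\<^esub> w \<in> I" by (auto simp: lead_def)
      have wV: "w \<in> carrier V" using w initial_span_carrier by auto
      let ?i = "c \<odot>\<^bsub>V\<^esub> (\<phi> d \<oplus>\<^bsub>V\<^esub> w)"
      have i: "?i \<in> I" using IC(6) c w by simp
      have eq: "f \<ominus>\<^bsub>V\<^esub> ?i = u \<ominus>\<^bsub>V\<^esub> c \<odot>\<^bsub>V\<^esub> w"
        using f c uV wV
        by (simp add: V.smult_r_distr V.add_minus_add_cancel)
      have "f \<ominus>\<^bsub>V\<^esub> ?i \<in> J" using JC(4) Suc.prems(1) i IJ by auto
      moreover have "f \<ominus>\<^bsub>V\<^esub> ?i \<in> initial_span d"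
        unfolding eq using initial_span_closed c u w by auto
      ultimately obtain j v where j: "j \<in> I" "v \<in> J \<inter> initial_span d0" "f \<ominus>\<^bsub>V\<^esub> ?i = j \<oplus>\<^bsub>V\<^esub> v"
        using Suc.IH by blast
      have car: "f \<in> carrier V" "?i \<in> carrier V" "j \<in> carrier V" "v \<in> carrier V"
        using Suc.prems(1) i j IC(1) JC(1) by auto
      have "f = ?i \<oplus>\<^bsub>V\<^esub> (f \<ominus>\<^bsub>V\<^esub> ?i)"
        using car(1,2) by (simp add: a_minus_def V.a_lcomm V.r_neg)
      also have "\<dots> = (?i \<oplus>\<^bsub>V\<^esub> j) \<oplus>\<^bsub>V\<^esub> v" using car j(3) by (simp add: V.a_assoc)
      finally show ?thesis using IC(3)[OF i j(1)] j(2) by blast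
    qed
  qed
qed

end

text \<open>In each residue class modulo \<open>r\<close> the union of the chain is determined by its least element,
  and that element already belongs to a member of the chain.\<close>

lemma shift_closed_chain_stabilises:
  fixes D :: "nat \<Rightarrow> nat set"
  assumes r: "r > 0" and mono: "\<And>k. D k \<subseteq> D (Suc k)" and shift: "\<And>k d. d \<in> D k \<Longrightarrow> d + r \<in> D k"
  shows "\<exists>N. \<forall>k\<ge>N. D k = D N"
proof -
  have le: "D j \<subseteq> D k" if "j \<le> k" for j k using lift_Suc_mono_le[of D, OF mono that] .
  have mult: "d + q * r \<in> D k" if "d \<in> D k" for d k q
  proof (induction q)
    case (Suc q)
    from shift[OF Suc] show ?case by (simp add: algebra_simps)
  qed (use that in simp)
  define S where "S i = {d \<in> (\<Union>k. D k). d mod r = i}" for i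
  define m where "m i = (LEAST d. d \<in> S i)" for i
  have m: "m i \<in> S i" if "S i \<noteq> {}" for i
    unfolding m_def using that by (auto intro: LeastI)
  define N where "N = Max (insert 0 ((\<lambda>i. SOME k. m i \<in> D k) ` {..<r}))"
  have "D k \<subseteq> D N" for k
  proof
    fix d assume "d \<in> D k"
    let ?i = "d mod r"
    have d: "d \<in> S ?i" using \<open>d \<in> D k\<close> by (auto simp: S_def)
    then have mi: "m ?i \<in> S ?i" using m by blast
    have le_d: "m ?i \<le> d" unfolding m_def using d by (rule Least_le)
    obtain j where "m ?i \<in> D j" using mi by (auto simp: S_def)
    then have "m ?i \<in> D (SOME k. m ?i \<in> D k)" by (rule someI)
    moreover have "(SOME k. m ?i \<in> D k) \<le> N"
      unfolding N_def using r by (intro Max_ge) auto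
    ultimately have "m ?i \<in> D N" using le by blast
    moreover have "m ?i mod r = d mod r" using mi by (simp add: S_def)
    then obtain q where "d = m ?i + q * r"
      using le_d by (metis mod_eq_dvd_iff_nat dvd_div_mult_self le_add_diff_inverse)
    ultimately show "d \<in> D N" using mult by metis
  qed
  then show ?thesis using le by blast
qed

text \<open>The model is a module generated by \<open>r\<close> elements over the polynomials in one variable: the
  products of the \<open>i\<close>-th generator with the powers of the variable occupy the positions
  \<open>i, i + r, i + 2 r, \<dots>\<close>, and \<open>T\<close> is the multiplication by the variable.\<close>

locale shift_sequence = vector_sequence K V \<phi>
  for K :: "('k, 'c) ring_scheme" and V :: "('k, 'v, 'e) module_scheme" and \<phi> +
  fixes T :: "'v \<Rightarrow> 'v" and r :: nat
  assumes r_pos: "r > 0"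
    and T_add: "x \<in> carrier V \<Longrightarrow> y \<in> carrier V \<Longrightarrow> T (x \<oplus>\<^bsub>V\<^esub> y) = T x \<oplus>\<^bsub>V\<^esub> T y"
    and T_smult: "c \<in> carrier K \<Longrightarrow> x \<in> carrier V \<Longrightarrow> T (c \<odot>\<^bsub>V\<^esub> x) = c \<odot>\<^bsub>V\<^esub> T x"
    and T_seq: "T (\<phi> i) = \<phi> (i + r)"
    and spanning: "carrier V \<subseteq> (\<Union>d. initial_span d)"
begin

lemma shift_initial_span: "u \<in> initial_span d \<Longrightarrow> T u \<in> initial_span (d + r)"
proof (induction d arbitrary: u)
  case 0
  have "T \<zero>\<^bsub>V\<^esub> = T (\<zero>\<^bsub>K\<^esub> \<odot>\<^bsub>V\<^esub> \<phi> 0)" by simp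
  also have "\<dots> = \<zero>\<^bsub>V\<^esub>" by (subst T_smult) (auto simp: T_seq)
  finally show ?case using 0 initial_span_closed(2) by simp
next
  case (Suc d)
  then obtain c w where w: "u = c \<odot>\<^bsub>V\<^esub> \<phi> d \<oplus>\<^bsub>V\<^esub> w" "c \<in> carrier K" "w \<in> initial_span d" by auto
  then have "T u = c \<odot>\<^bsub>V\<^esub> \<phi> (d + r) \<oplus>\<^bsub>V\<^esub> T w"
    using initial_span_carrier by (subst w(1), subst T_add) (auto simp: T_smult T_seq)
  with Suc.IH[OF w(3)] w(2) show ?case by auto
qed

lemma lead_shift:
  assumes "\<And>x. x \<in> I \<Longrightarrow> T x \<in> I" and "d \<in> lead I"
  shows "d + r \<in> lead I"
proof -
  obtain u where u: "u \<in> initial_span d" "\<phi> d \<oplus>\<^bsub>V\<^esub> u \<in> I" using assms by (auto simp: lead_def)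
  have "T (\<phi> d \<oplus>\<^bsub>V\<^esub> u) = \<phi> (d + r) \<oplus>\<^bsub>V\<^esub> T u"
    using u initial_span_carrier by (subst T_add) (auto simp: T_seq)
  with assms(1)[OF u(2)] shift_initial_span[OF u(1)] show ?thesis by (auto simp: lead_def)
qed

text \<open>The argument of Hilbert's basis theorem in one variable: the leading positions of a \<open>T\<close>-stable
  subspace are closed under the shift by \<open>r\<close>, so they become stationary along the chain, and they
  determine the members of the chain.\<close>

lemma shift_stable_chain_stabilises:
  assumes sub: "\<And>k::nat. submodule (I k) K V" and T: "\<And>k x. x \<in> I k \<Longrightarrow> T x \<in> I k"
    and chain: "\<And>k. I k \<subseteq> I (Suc k)"
  shows "\<exists>N. \<forall>k\<ge>N. I k = I N"
proof -
  have "\<exists>N. \<forall>k\<ge>N. lead (I k) = lead (I N)"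
    using chain T by (intro shift_closed_chain_stabilises[OF r_pos]) (auto intro: lead_shift dest: lead_mono)
  then obtain N where N: "\<And>k. k \<ge> N \<Longrightarrow> lead (I k) = lead (I N)" by blast
  have "I k \<subseteq> I N" if k: "k \<ge> N" for k
  proof
    fix f assume f: "f \<in> I k"
    have IN: "I N \<subseteq> I k" using lift_Suc_mono_le[of I, OF chain k] .
    have "f \<in> carrier V" using f V.submodule_closed(1)[OF sub] by blast
    then obtain d where "f \<in> initial_span d" using spanning by blast
    then obtain i u where "i \<in> I N" "u \<in> initial_span 0" "f = i \<oplus>\<^bsub>V\<^esub> u"
      using reduce_by_lead[OF sub sub IN, of 0 f d] N[OF k] f by blast
    then show "f \<in> I N" using V.submodule_closed(1)[OF sub[of N]] by (auto simp: subset_iff)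
  qed
  then show ?thesis using lift_Suc_mono_le[of I, OF chain] by blast
qed

end

section \<open>Prime ideals over a central subring\<close>

lemma (in abelian_group) add_diff_cancel:
  assumes "x \<in> carrier G" "y \<in> carrier G"
  shows "(x \<oplus> y) \<ominus> x = y" "(x \<ominus> y) \<oplus> y = x" "x \<ominus> (x \<ominus> y) = y"
  using assms by (simp_all add: a_minus_def minus_add a_assoc l_neg r_neg r_neg2 a_comm[of x y])

context ring
begin

lemma left_ideal_iff:
  "left_ideal L R \<longleftrightarrow> L \<subseteq> carrier R \<and> \<zero> \<in> L \<and> (\<forall>x\<in>L. \<forall>y\<in>L. x \<oplus> y \<in> L) \<and>
     (\<forall>x\<in>L. \<forall>a\<in>carrier R. a \<otimes> x \<in> L)" (is "_ \<longleftrightarrow> ?r")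
proof
  assume l: "left_ideal L R"
  then interpret additive_subgroup L R by (simp add: left_ideal_def)
  show ?r using l a_subset by (auto simp: left_ideal_def)
next
  assume r: ?r
  have "additive_subgroup L R"
  proof (intro additive_subgroupI, rule add.subgroupI)
    fix a assume a: "a \<in> L"
    then have "(\<ominus> \<one>) \<otimes> a \<in> L" using r by blast
    moreover have "(\<ominus> \<one>) \<otimes> a = \<ominus> a" using a r by (simp add: l_minus subset_iff)
    ultimately show "\<ominus> a \<in> L" by simp
  qed (use r in auto)
  then show "left_ideal L R" using r by (simp add: left_ideal_def)
qed

lemma left_idealD:
  assumes "left_ideal L R"
  shows "L \<subseteq> carrier R" "x \<in> L \<Longrightarrow> x \<in> carrier R" "\<zero> \<in> L"
    "x \<in> L \<Longrightarrow> y \<in> L \<Longrightarrow> x \<oplus> y \<in> L"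
    "a \<in> carrier R \<Longrightarrow> x \<in> L \<Longrightarrow> a \<otimes> x \<in> L"
    "x \<in> L \<Longrightarrow> \<ominus> x \<in> L" "x \<in> L \<Longrightarrow> y \<in> L \<Longrightarrow> x \<ominus> y \<in> L"
proof -
  show b: "L \<subseteq> carrier R" "x \<in> L \<Longrightarrow> x \<in> carrier R" "\<zero> \<in> L"
    "x \<in> L \<Longrightarrow> y \<in> L \<Longrightarrow> x \<oplus> y \<in> L"
    "a \<in> carrier R \<Longrightarrow> x \<in> L \<Longrightarrow> a \<otimes> x \<in> L" for a x y
    using assms by (auto simp: left_ideal_iff)
  show m: "x \<in> L \<Longrightarrow> \<ominus> x \<in> L" for x
    using b(5)[of "\<ominus> \<one>" x] b(2)[of x] by (simp add: l_minus)
  show "x \<in> L \<Longrightarrow> y \<in> L \<Longrightarrow> x \<ominus> y \<in> L" for x y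
    unfolding a_minus_def by (intro b(4) m)
qed

lemma ideal_left_ideal: "ideal I R \<Longrightarrow> left_ideal I R"
  by (simp add: left_ideal_def ideal.axioms(1) ideal.I_l_closed)

lemma left_ideal_ideal:
  assumes "left_ideal I R" "\<And>x a. x \<in> I \<Longrightarrow> a \<in> carrier R \<Longrightarrow> x \<otimes> a \<in> I"
  shows "ideal I R"
  using assms ring_axioms
  by (auto simp: left_ideal_def intro!: ideal.intro ideal_axioms.intro)

text \<open>The set of all \<open>y\<close> with \<open>a R y \<subseteq> P\<close> is a two-sided ideal, and so is its left annihilator modulo
  \<open>P\<close>. The product of the second with the first lies in \<open>P\<close>.\<close>

lemma nc_prime_idealD:
  assumes P: "nc_prime_ideal P R" and a: "a \<in> carrier R" and b: "b \<in> carrier R"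
    and aRb: "\<And>s. s \<in> carrier R \<Longrightarrow> a \<otimes> s \<otimes> b \<in> P"
  shows "a \<in> P \<or> b \<in> P"
proof -
  have PI: "ideal P R" using P by (simp add: nc_prime_ideal_def)
  interpret P: ideal P R by (rule PI)
  define J where "J = {y \<in> carrier R. \<forall>s\<in>carrier R. a \<otimes> s \<otimes> y \<in> P}"
  define I where "I = {x \<in> carrier R. \<forall>y\<in>J. x \<otimes> y \<in> P}"
  have J: "ideal J R"
  proof (rule left_ideal_ideal)
    show "left_ideal J R" unfolding left_ideal_iff
    proof (intro conjI ballI)
      fix x s assume "x \<in> J" and s: "s \<in> carrier R"
      then have x: "x \<in> carrier R" "\<And>t. t \<in> carrier R \<Longrightarrow> a \<otimes> t \<otimes> x \<in> P" by (auto simp: J_def)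
      have "a \<otimes> t \<otimes> (s \<otimes> x) \<in> P" if "t \<in> carrier R" for t
        using x(2)[of "t \<otimes> s"] x(1) s that a by (simp add: m_assoc)
      then show "s \<otimes> x \<in> J" using x s by (auto simp: J_def)
    next
      fix x y assume "x \<in> J" "y \<in> J"
      then show "x \<oplus> y \<in> J" using a by (simp add: J_def r_distr)
    next
      show "J \<subseteq> carrier R" "\<zero> \<in> J" using a by (auto simp: J_def)
    qed
    fix x s assume "x \<in> J" and s: "s \<in> carrier R"
    then have x: "x \<in> carrier R" "\<And>t. t \<in> carrier R \<Longrightarrow> a \<otimes> t \<otimes> x \<in> P" by (auto simp: J_def)
    have "a \<otimes> t \<otimes> (x \<otimes> s) \<in> P" if "t \<in> carrier R" for t
      using P.I_r_closed[OF x(2)[OF that] s] x(1) s that a by (simp add: m_assoc)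
    then show "x \<otimes> s \<in> J" using x s by (auto simp: J_def)
  qed
  interpret J: ideal J R by (rule J)
  have I: "ideal I R"
  proof (rule left_ideal_ideal)
    show "left_ideal I R" unfolding left_ideal_iff
    proof (intro conjI ballI)
      show "I \<subseteq> carrier R" by (auto simp: I_def)
      show "\<zero> \<in> I" using J.Icarr by (simp add: I_def)
    next
      fix x y assume "x \<in> I" "y \<in> I"
      then show "x \<oplus> y \<in> I" using J.Icarr by (simp add: I_def l_distr)
    next
      fix x s assume "x \<in> I" "s \<in> carrier R"
      then show "s \<otimes> x \<in> I" using J.Icarr P.I_l_closed by (simp add: I_def m_assoc)
    qed
    fix x s assume "x \<in> I" "s \<in> carrier R"
    then show "x \<otimes> s \<in> I"
      using J.I_l_closed J.Icarr by (simp add: I_def m_assoc)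
  qed
  have "I \<cdot>\<^bsub>R\<^esub> J \<subseteq> P"
  proof
    fix s assume "s \<in> I \<cdot>\<^bsub>R\<^esub> J"
    then show "s \<in> P"
    proof induction
      case (prod i j) then show ?case unfolding I_def by blast
    next
      case (sum s t) then show ?case using P.a_closed by blast
    qed
  qed
  then have "I \<subseteq> P \<or> J \<subseteq> P" using P I J by (simp add: nc_prime_ideal_def)
  moreover have "b \<in> J" unfolding J_def using aRb b by blast
  moreover have "a \<in> I"
  proof -
    have "a \<otimes> y \<in> P" if "y \<in> J" for y
    proof -
      have "a \<otimes> \<one> \<otimes> y \<in> P" using that unfolding J_def by blast
      then show ?thesis using a by simp
    qed
    then show ?thesis using a by (simp add: I_def)
  qed
  ultimately show ?thesis by blast
qed

end

locale finite_over_central = ring R for R (structure) +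
  fixes C P :: "'a set" and \<phi> :: "nat \<Rightarrow> 'a" and r :: nat
  assumes C: "subring C R"
    and central: "c \<in> C \<Longrightarrow> x \<in> carrier R \<Longrightarrow> c \<otimes> x = x \<otimes> c"
    and gen_carrier [simp]: "\<phi> i \<in> carrier R"
    and prime: "nc_prime_ideal P R"
begin

primrec gen_span :: "nat \<Rightarrow> 'a set" where
  "gen_span 0 = {\<zero>}"
| "gen_span (Suc d) = {c \<otimes> \<phi> d \<oplus> v | c v. c \<in> C \<and> v \<in> gen_span d}"

sublocale P: ideal P R using prime by (simp add: nc_prime_ideal_def)

lemma C_closed [simp]:
  "c \<in> C \<Longrightarrow> c \<in> carrier R" "\<zero> \<in> C" "\<one> \<in> C" "c \<in> C \<Longrightarrow> d \<in> C \<Longrightarrow> c \<otimes> d \<in> C"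
  "c \<in> C \<Longrightarrow> d \<in> C \<Longrightarrow> c \<oplus> d \<in> C" "c \<in> C \<Longrightarrow> \<ominus> c \<in> C"
  using subringE[OF C] by auto

lemma gen_span_carrier [simp]: "v \<in> gen_span d \<Longrightarrow> v \<in> carrier R"
  by (induction d arbitrary: v) auto

lemma gen_spanI: "c \<in> C \<Longrightarrow> v \<in> gen_span d \<Longrightarrow> c \<otimes> \<phi> d \<oplus> v \<in> gen_span (Suc d)"
  by auto

lemma gen_span_zero: "\<zero> \<in> gen_span d"
proof (induction d)
  case (Suc d)
  then show ?case using gen_spanI[of \<zero> \<zero> d] by simp
qed simp

lemma gen_span_gen: "j < d \<Longrightarrow> c \<in> C \<Longrightarrow> c \<otimes> \<phi> j \<in> gen_span d"
proof (induction d)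
  case (Suc d)
  show ?case
  proof (cases "j = d")
    case True
    then show ?thesis using gen_spanI[of c \<zero> d] gen_span_zero Suc.prems by simp
  next
    case False
    then have "c \<otimes> \<phi> j \<in> gen_span d" using Suc by simp
    then show ?thesis using gen_spanI[of \<zero> "c \<otimes> \<phi> j" d] Suc.prems by simp
  qed
qed simp

lemma gen_span_smult: "c \<in> C \<Longrightarrow> v \<in> gen_span d \<Longrightarrow> c \<otimes> v \<in> gen_span d"
proof (induction d arbitrary: v)
  case (Suc d)
  then obtain b w where w: "v = b \<otimes> \<phi> d \<oplus> w" "b \<in> C" "w \<in> gen_span d" by auto
  have "c \<otimes> v = (c \<otimes> b) \<otimes> \<phi> d \<oplus> c \<otimes> w" using w Suc.prems by (simp add: r_distr m_assoc)
  then show ?case using w Suc by (auto intro!: exI)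
qed auto

lemma gen_span_add: "v \<in> gen_span d \<Longrightarrow> w \<in> gen_span d \<Longrightarrow> v \<oplus> w \<in> gen_span d"
proof (induction d arbitrary: v w)
  case (Suc d)
  then obtain b v' c w' where "v = b \<otimes> \<phi> d \<oplus> v'" "b \<in> C" "v' \<in> gen_span d"
    "w = c \<otimes> \<phi> d \<oplus> w'" "c \<in> C" "w' \<in> gen_span d" by auto
  moreover from this have "v \<oplus> w = (b \<oplus> c) \<otimes> \<phi> d \<oplus> (v' \<oplus> w')"
    by (simp add: l_distr a_ac)
  ultimately show ?case using Suc.IH by (auto intro!: exI)
qed auto

lemma gen_span_diff:
  assumes "v \<in> gen_span d" "w \<in> gen_span d" "b \<in> C" "c \<in> C"
  shows "b \<otimes> v \<ominus> c \<otimes> w \<in> gen_span d"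
proof -
  have "b \<otimes> v \<ominus> c \<otimes> w = b \<otimes> v \<oplus> (\<ominus> c) \<otimes> w"
    using assms by (simp add: a_minus_def l_minus)
  then show ?thesis using assms by (simp add: gen_span_add gen_span_smult)
qed

text \<open>Inverting \<open>\<Sigma>\<close> in \<open>R\<close> modulo \<open>P\<close> gives an algebra over the field of fractions of \<open>C / (C \<inter> P)\<close>. The
  localization is not formed: its left ideals are represented by the saturated left ideals of \<open>R\<close>
  defined below.\<close>

definition \<Sigma> :: "'a set" where "\<Sigma> = C - P"

lemma \<Sigma>I: "c \<in> C \<Longrightarrow> c \<notin> P \<Longrightarrow> c \<in> \<Sigma>" by (simp add: \<Sigma>_def)

lemma \<Sigma>_C [simp]: "s \<in> \<Sigma> \<Longrightarrow> s \<in> C" and \<Sigma>_notin: "s \<in> \<Sigma> \<Longrightarrow> s \<notin> P"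
  by (simp_all add: \<Sigma>_def)

text \<open>Primeness makes every central element outside \<open>P\<close> a nonzerodivisor modulo \<open>P\<close>.\<close>

lemma regular: "x \<in> P" if s: "s \<in> \<Sigma>" and x: "x \<in> carrier R" "s \<otimes> x \<in> P"
proof -
  have "s \<otimes> t \<otimes> x \<in> P" if t: "t \<in> carrier R" for t
    using P.I_l_closed[OF x(2) t] central[of s t] s t x(1) by (simp add: m_assoc[symmetric])
  then show ?thesis using nc_prime_idealD[OF prime _ x(1), of s] s \<Sigma>_notin by auto
qed

lemma \<Sigma>_one [simp]: "\<one> \<in> \<Sigma>"
  using prime P.one_imp_carrier by (intro \<Sigma>I) (auto simp: nc_prime_ideal_def)

lemma \<Sigma>_mult [simp]: "s \<in> \<Sigma> \<Longrightarrow> t \<in> \<Sigma> \<Longrightarrow> s \<otimes> t \<in> \<Sigma>"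
  using regular[of s t] \<Sigma>_notin[of t] by (intro \<Sigma>I) auto

definition saturated :: "'a set \<Rightarrow> bool" where
  "saturated L \<longleftrightarrow> left_ideal L R \<and> P \<subseteq> L \<and>
     (\<forall>s\<in>\<Sigma>. \<forall>x\<in>carrier R. s \<otimes> x \<in> L \<longrightarrow> x \<in> L)"

lemma saturatedD:
  assumes "saturated L"
  shows "left_ideal L R" "P \<subseteq> L"
    "\<And>s x. s \<in> \<Sigma> \<Longrightarrow> x \<in> carrier R \<Longrightarrow> s \<otimes> x \<in> L \<Longrightarrow> x \<in> L"
  using assms unfolding saturated_def by blast+

definition saturation :: "'a set \<Rightarrow> 'a set" where
  "saturation L = {x \<in> carrier R. \<exists>s\<in>\<Sigma>. s \<otimes> x \<in> L}"

lemma saturation_saturated: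
  assumes L: "left_ideal L R" and PL: "P \<subseteq> L"
  shows "saturated (saturation L)" "L \<subseteq> saturation L"
proof -
  note LD = left_idealD[OF L]
  show LL: "L \<subseteq> saturation L" using LD by (auto simp: saturation_def intro!: bexI[of _ \<one>])
  show "saturated (saturation L)" unfolding saturated_def left_ideal_iff
  proof (intro conjI ballI impI)
    show "saturation L \<subseteq> carrier R" by (auto simp: saturation_def)
    show "\<zero> \<in> saturation L" using LL LD(3) by blast
    show "P \<subseteq> saturation L" using LL PL by blast
  next
    fix x y assume "x \<in> saturation L" "y \<in> saturation L"
    then obtain s t where s: "x \<in> carrier R" "s \<in> \<Sigma>" "s \<otimes> x \<in> L" "y \<in> carrier R" "t \<in> \<Sigma>" "t \<otimes> y \<in> L"
      by (auto simp: saturation_def)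
    have "s \<otimes> t \<otimes> (x \<oplus> y) = t \<otimes> (s \<otimes> x) \<oplus> s \<otimes> (t \<otimes> y)"
      using s central[of s t] by (simp add: r_distr m_assoc[symmetric])
    also have "\<dots> \<in> L" using s LD by simp
    finally show "x \<oplus> y \<in> saturation L" using s by (auto simp: saturation_def)
  next
    fix x a assume "x \<in> saturation L" and a: "a \<in> carrier R"
    then obtain s where s: "x \<in> carrier R" "s \<in> \<Sigma>" "s \<otimes> x \<in> L" by (auto simp: saturation_def)
    have "s \<otimes> (a \<otimes> x) = a \<otimes> (s \<otimes> x)" using s a central[of s a] by (simp add: m_assoc[symmetric])
    also have "\<dots> \<in> L" using s a LD by simp
    finally show "a \<otimes> x \<in> saturation L" using s a by (auto simp: saturation_def)
  next
    fix s x assume s: "s \<in> \<Sigma>" and x: "x \<in> carrier R" and "s \<otimes> x \<in> saturation L"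
    then obtain t where "t \<in> \<Sigma>" "t \<otimes> (s \<otimes> x) \<in> L" by (auto simp: saturation_def)
    then show "x \<in> saturation L"
      using s x by (auto simp: saturation_def m_assoc[symmetric] intro!: bexI[of _ "t \<otimes> s"])
  qed
qed

text \<open>The pivots of a row echelon form over the field of fractions of \<open>C / (C \<inter> P)\<close>; their number is
  the dimension of the localized left ideal up to a constant, which accounts for the linear relations
  between the generators modulo \<open>P\<close>.\<close>

definition pivots :: "'a set \<Rightarrow> nat set" where
  "pivots L = {i. i < r \<and> (\<exists>s\<in>\<Sigma>. \<exists>v\<in>gen_span i. s \<otimes> \<phi> i \<oplus> v \<in> L)}"

lemma pivots_mono: "L \<subseteq> L' \<Longrightarrow> pivots L \<subseteq> pivots L'" by (auto simp: pivots_def)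

lemma finite_pivots [simp]: "finite (pivots L)"
  by (rule finite_subset[of _ "{..<r}"]) (auto simp: pivots_def)

end

text \<open>Generation is required only modulo \<open>P\<close>, because an algebra that is finite over \<open>K[z]\<close> becomes finite
  over the scalars alone only modulo a suitable prime.\<close>

locale finite_over_central_gen = finite_over_central +
  assumes gen: "x \<in> carrier R \<Longrightarrow> \<exists>v\<in>gen_span r. x \<ominus> v \<in> P"
begin

text \<open>Gaussian elimination: a coefficient in \<open>P\<close> can be discarded, and any other coefficient lies in
  \<open>\<Sigma>\<close>, so that a multiple of the leading term by an element of \<open>\<Sigma>\<close> is cancelled by an element of \<open>L\<close>.
  Since there are at most \<open>r\<close> pivots, the saturated left ideals satisfy the descending chain
  condition.\<close>

lemma pivots_determine:
  assumes L: "saturated L" and L': "left_ideal L' R" "L \<subseteq> L'" and piv: "pivots L' \<subseteq> pivots L"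
  shows "L' = L"
proof -
  note LI = saturatedD(1)[OF L] and PL = saturatedD(2)[OF L] and sat = saturatedD(3)[OF L]
  note LD = left_idealD[OF LI] and LD' = left_idealD[OF L'(1)]
  have *: "f \<in> L" if "d \<le> r" "f \<in> L'" "f \<in> gen_span d" for d f
    using that
  proof (induction d arbitrary: f)
    case 0 then show ?case using LD(3) by simp
  next
    case (Suc d)
    then obtain c v where f: "f = c \<otimes> \<phi> d \<oplus> v" and c: "c \<in> C" and v: "v \<in> gen_span d" by auto
    have fc: "f \<in> carrier R" using f c v by simp
    show ?case
    proof (cases "c \<in> P")
      case True
      then have cp: "c \<otimes> \<phi> d \<in> P" using P.I_r_closed by simp
      have "v = f \<ominus> c \<otimes> \<phi> d" 
        unfolding f using c v add_diff_cancel(1)[of "c \<otimes> \<phi> d" v] by simp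
      then have "v \<in> L'" using LD'(7)[OF Suc.prems(2)] cp PL L'(2) by auto
      then have "v \<in> L" using Suc v by simp
      then show ?thesis using f cp PL LD(4) by auto
    next
      case False
      then have cs: "c \<in> \<Sigma>" using c by (intro \<Sigma>I)
      then have "d \<in> pivots L'" using Suc.prems f v by (auto simp: pivots_def)
      then have "d \<in> pivots L" using piv by blast
      then obtain s w where w: "s \<in> \<Sigma>" "w \<in> gen_span d" "s \<otimes> \<phi> d \<oplus> w \<in> L"
        unfolding pivots_def by blast
      let ?g = "c \<otimes> (s \<otimes> \<phi> d \<oplus> w)"
      have g: "?g \<in> L" using w c LD by simp
      have e1: "s \<otimes> f = (c \<otimes> s) \<otimes> \<phi> d \<oplus> s \<otimes> v"
        using f c v w central[of s c] by (simp add: r_distr m_assoc[symmetric])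
      have e2: "?g = (c \<otimes> s) \<otimes> \<phi> d \<oplus> c \<otimes> w"
        using c w by (simp add: r_distr m_assoc[symmetric])
      have eq: "s \<otimes> f \<ominus> ?g = s \<otimes> v \<ominus> c \<otimes> w"
        unfolding e1 e2 using c v w by (intro add_minus_add_cancel) auto
      have "s \<otimes> f \<ominus> ?g \<in> L'" using LD'(7) LD'(5) Suc.prems(2) w(1) g L'(2) by auto
      moreover have "s \<otimes> f \<ominus> ?g \<in> gen_span d" unfolding eq using w v c by (simp add: gen_span_diff)
      ultimately have "s \<otimes> f \<ominus> ?g \<in> L" using Suc.IH Suc.prems(1) by simp
      from LD(4)[OF this g] have "s \<otimes> f \<in> L"
        using fc LD(2)[OF g] w(1) by (simp add: add_diff_cancel)
      then show ?thesis using sat[OF w(1) fc] by simp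
    qed
  qed
  have "f \<in> L" if f: "f \<in> L'" for f
  proof -
    have fc: "f \<in> carrier R" using f LD' by blast
    obtain v where v: "v \<in> gen_span r" "f \<ominus> v \<in> P" using gen[OF fc] by blast
    have "v = f \<ominus> (f \<ominus> v)" using fc gen_span_carrier[OF v(1)]
      by (simp add: add_diff_cancel)
    moreover have "f \<ominus> v \<in> L'" using v(2) PL L'(2) by blast
    ultimately have "v \<in> L'" using LD'(7)[OF f] by metis
    then have "v \<in> L" using *[of r v] v(1) by blast
    moreover have "f = (f \<ominus> v) \<oplus> v" using fc gen_span_carrier[OF v(1)]
      by (simp add: add_diff_cancel)
    moreover have "f \<ominus> v \<in> L" using v(2) PL by blast
    ultimately show ?thesis using LD(4) by metis
  qed
  with L'(2) show ?thesis by blast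
qed

text \<open>Incomparability for the extension \<open>C \<subseteq> R\<close>. The localized algebra is prime and of finite
  dimension over a field, hence simple, so it is generated by the image of \<open>Q\<close>; clearing
  denominators gives an element of \<open>\<Sigma>\<close> in \<open>Q\<close>. Simplicity is proved along with this statement. Let \<open>L\<close>
  be minimal among the saturated left ideals other than \<open>P\<close>. For every \<open>v\<close> in \<open>L\<close> outside \<open>P\<close> the saturation
  of \<open>Q v + P\<close> is \<open>L\<close>, so some \<open>s - q\<close> with \<open>s\<close> in \<open>\<Sigma>\<close> and \<open>q\<close> in \<open>Q\<close> annihilates \<open>v\<close> modulo \<open>P\<close>. A product of
  such elements annihilates any given finite subset of \<open>L\<close>, and is again of this form. By the
  descending chain condition some finite subset of \<open>L\<close> has the same annihilator as \<open>L\<close>, which is \<open>P\<close>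
  because \<open>P\<close> is prime. Hence \<open>s - q\<close> lies in \<open>P\<close> and \<open>s\<close> lies in \<open>Q\<close>.\<close>

theorem larger_ideal_meets_centre:
  assumes Q: "ideal Q R" and PQ: "P \<subset> Q"
  shows "\<exists>c\<in>C. c \<in> Q \<and> c \<notin> P"
proof -
  interpret Q: ideal Q R by (rule Q)
  obtain q0 where q0: "q0 \<in> Q" "q0 \<notin> P" using PQ by blast
  define LL where "LL = {L. saturated L \<and> L \<noteq> P}"
  have "carrier R \<in> LL" using prime P.Icarr
    by (auto simp: LL_def saturated_def left_ideal_iff nc_prime_ideal_def)
  then obtain L where L: "L \<in> LL" and min: "\<And>L'. L' \<in> LL \<Longrightarrow> card (pivots L) \<le> card (pivots L')"
    using exists_least_iff[of "\<lambda>n. \<exists>L\<in>LL. n = card (pivots L)"] by (metis leI)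
  have sL: "saturated L" and LI: "left_ideal L R" and PL: "P \<subseteq> L" and LP: "L \<noteq> P"
    using L saturatedD by (auto simp: LL_def)
  note LD = left_idealD[OF LI]
  have minimal: "N = L" if "N \<in> LL" "N \<subseteq> L" for N
  proof -
    have "pivots N = pivots L"
      using min[OF that(1)] pivots_mono[OF that(2)] by (intro card_seteq) auto
    then show ?thesis using pivots_determine[of N L] that LI by (auto simp: LL_def)
  qed
  (* Minimality of L, applied to the saturation of Q v + P. *)
  have fix1: "\<exists>s\<in>\<Sigma>. \<exists>q\<in>Q. (s \<ominus> q) \<otimes> v \<in> P" if v: "v \<in> L" for v
  proof (cases "v \<in> P")
    case True
    then show ?thesis by (intro bexI[of _ \<one>] bexI[of _ \<zero>]) (auto intro!: P.I_l_closed)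
  next
    case False
    have vc: "v \<in> carrier R" using v LD by blast
    define N where "N = {q \<otimes> v \<oplus> p | q p. q \<in> Q \<and> p \<in> P}"
    have NI: "left_ideal N R" unfolding left_ideal_iff
    proof (intro conjI ballI)
      show "N \<subseteq> carrier R" using vc by (auto simp: N_def Q.Icarr P.Icarr)
      show "\<zero> \<in> N" using vc unfolding N_def
        by (intro CollectI exI[of _ \<zero>]) simp
    next
      fix x y assume "x \<in> N" "y \<in> N"
      then obtain q p q' p' where e: "x = q \<otimes> v \<oplus> p" "q \<in> Q" "p \<in> P" "y = q' \<otimes> v \<oplus> p'" "q' \<in> Q" "p' \<in> P"
        by (auto simp: N_def)
      then have "x \<oplus> y = (q \<oplus> q') \<otimes> v \<oplus> (p \<oplus> p')"
        using vc by (simp add: l_distr Q.Icarr P.Icarr a_ac)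
      then show "x \<oplus> y \<in> N" using e by (auto simp: N_def intro!: exI)
    next
      fix x a assume "x \<in> N" and a: "a \<in> carrier R"
      then obtain q p where e: "x = q \<otimes> v \<oplus> p" "q \<in> Q" "p \<in> P" by (auto simp: N_def)
      then have "a \<otimes> x = (a \<otimes> q) \<otimes> v \<oplus> a \<otimes> p"
        using vc a by (simp add: r_distr Q.Icarr P.Icarr m_assoc)
      moreover have "a \<otimes> q \<in> Q" "a \<otimes> p \<in> P" using e a Q.I_l_closed P.I_l_closed by auto
      ultimately show "a \<otimes> x \<in> N" by (auto simp: N_def)
    qed
    have PN: "P \<subseteq> N"
    proof
      fix p assume p: "p \<in> P"
      then have "p = \<zero> \<otimes> v \<oplus> p" using vc P.Icarr by simp
      then show "p \<in> N" using p Q.zero_closed unfolding N_def by blast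
    qed
    have "\<exists>s\<in>carrier R. q0 \<otimes> s \<otimes> v \<notin> P"
      using nc_prime_idealD[OF prime Q.Icarr[OF q0(1)] vc] q0(2) False by blast
    then obtain s where s: "s \<in> carrier R" "q0 \<otimes> s \<otimes> v \<notin> P" by blast
    have "q0 \<otimes> s \<otimes> v \<in> N"
    proof -
      have "q0 \<otimes> s \<otimes> v = (q0 \<otimes> s) \<otimes> v \<oplus> \<zero>" using q0 s vc Q.Icarr by simp
      moreover have "q0 \<otimes> s \<in> Q" using q0 s Q.I_r_closed by simp
      ultimately show ?thesis unfolding N_def using P.zero_closed by blast
    qed
    then have "saturation N \<in> LL"
      using saturation_saturated[OF NI PN] s(2) by (auto simp: LL_def)
    moreover have "saturation N \<subseteq> L"
    proof
      fix x assume "x \<in> saturation N"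
      then obtain t where t: "x \<in> carrier R" "t \<in> \<Sigma>" "t \<otimes> x \<in> N" by (auto simp: saturation_def)
      have "N \<subseteq> L" using v PL LD(4,5) Q.Icarr by (auto simp: N_def subset_iff)
      then show "x \<in> L" using t saturatedD(3)[OF sL] by blast
    qed
    ultimately have "v \<in> saturation N" using minimal v by blast
    then obtain t q p where t: "t \<in> \<Sigma>" "t \<otimes> v = q \<otimes> v \<oplus> p" "q \<in> Q" "p \<in> P"
      by (auto simp: saturation_def N_def)
    have "(t \<ominus> q) \<otimes> v = t \<otimes> v \<ominus> q \<otimes> v"
      using t(1) vc Q.Icarr[OF t(3)] by (simp add: a_minus_def l_distr l_minus)
    also have "\<dots> = p"
      unfolding t(2) using vc Q.Icarr[OF t(3)] P.Icarr[OF t(4)]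
      by (intro add_diff_cancel(1)) auto
    finally have "(t \<ominus> q) \<otimes> v = p" .
    then show ?thesis using t by blast
  qed
  define annih where "annih F = {a \<in> carrier R. \<forall>v\<in>F. a \<otimes> v \<in> P}" for F
  have annih_sat: "saturated (annih F)" if F: "F \<subseteq> carrier R" for F
    unfolding saturated_def left_ideal_iff
  proof (intro conjI ballI impI)
    show "P \<subseteq> annih F" using P.Icarr P.I_r_closed F by (auto simp: annih_def)
  next
    fix s x assume s: "s \<in> \<Sigma>" and x: "x \<in> carrier R" and sx: "s \<otimes> x \<in> annih F"
    have "x \<otimes> v \<in> P" if "v \<in> F" for v
      using regular[OF s, of "x \<otimes> v"] sx x s that F by (auto simp: annih_def m_assoc subset_iff)
    then show "x \<in> annih F" using x by (simp add: annih_def)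
  qed (use F in \<open>auto simp: annih_def l_distr m_assoc P.I_l_closed subset_iff\<close>)
  define FF where "FF = {F. finite F \<and> F \<subseteq> L}"
  have "{} \<in> FF" by (simp add: FF_def)
  then obtain F where F: "F \<in> FF"
    and minF: "\<And>F'. F' \<in> FF \<Longrightarrow> card (pivots (annih F)) \<le> card (pivots (annih F'))"
    using exists_least_iff[of "\<lambda>n. \<exists>F\<in>FF. n = card (pivots (annih F))"] by (metis leI)
  have Fc: "F \<subseteq> carrier R" using F LD(1) by (auto simp: FF_def)
  have annP: "annih F \<subseteq> P"
  proof
    fix a assume a: "a \<in> annih F"
    have ac: "a \<in> carrier R" using a by (simp add: annih_def)
    have kill: "a \<otimes> v \<in> P" if v: "v \<in> L" for v
    proof -
      have sub: "annih (insert v F) \<subseteq> annih F" by (auto simp: annih_def)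
      have "insert v F \<in> FF" using F v by (auto simp: FF_def)
      then have "pivots (annih (insert v F)) = pivots (annih F)"
        using minF pivots_mono[OF sub] by (intro card_seteq) auto
      moreover have "saturated (annih (insert v F))"
        using Fc v LD(2) by (intro annih_sat) auto
      moreover have "left_ideal (annih F) R" using annih_sat[OF Fc] by (rule saturatedD)
      ultimately have "annih F = annih (insert v F)" using pivots_determine sub by blast
      with a have "a \<in> annih (insert v F)" by simp
      then show ?thesis by (simp add: annih_def)
    qed
    obtain w where w: "w \<in> L" "w \<notin> P" using PL LP by blast
    have "a \<otimes> s \<otimes> w \<in> P" if s: "s \<in> carrier R" for s
      using kill[OF LD(5)[OF s w(1)]] LD(2)[OF w(1)] s ac by (simp add: m_assoc)
    then show "a \<in> P" using nc_prime_idealD[OF prime ac] w LD(2) by blast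
  qed
  (* If s - q annihilates F' and s' - q' annihilates (s - q) v, then their product annihilates both
     F' and v. *)
  have "\<exists>s\<in>\<Sigma>. \<exists>q\<in>Q. \<forall>v\<in>F'. (s \<ominus> q) \<otimes> v \<in> P" if "finite F'" "F' \<subseteq> F" for F'
    using that
  proof (induction F')
    case empty
    then show ?case using \<Sigma>_one Q.zero_closed by blast
  next
    case (insert v F')
    then obtain s q where s: "s \<in> \<Sigma>" "q \<in> Q" "\<And>v. v \<in> F' \<Longrightarrow> (s \<ominus> q) \<otimes> v \<in> P" by auto
    have qc: "q \<in> carrier R" using s Q.Icarr by simp
    have vL: "v \<in> L" using insert.prems F by (auto simp: FF_def)
    have vc: "v \<in> carrier R" using vL LD(2) by blast
    have "(s \<ominus> q) \<otimes> v \<in> L" using vL LD(5) qc s(1) by simp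
    from fix1[OF this] obtain s' q' where s': "s' \<in> \<Sigma>" "q' \<in> Q" "(s' \<ominus> q') \<otimes> ((s \<ominus> q) \<otimes> v) \<in> P" by blast
    have qc': "q' \<in> carrier R" using s' Q.Icarr by simp
    let ?q = "q' \<otimes> s \<oplus> (s' \<ominus> q') \<otimes> q"
    have "?q \<in> Q" using s s' qc qc' Q.I_l_closed Q.I_r_closed by simp
    moreover have eq: "s' \<otimes> s \<ominus> ?q = (s' \<ominus> q') \<otimes> (s \<ominus> q)"
      using s s' qc qc'
      by (simp add: a_minus_def l_distr r_distr l_minus r_minus minus_add a_assoc)
    moreover have "(s' \<otimes> s \<ominus> ?q) \<otimes> w \<in> P" if w: "w \<in> insert v F'" for w
    proof -
      have wc: "w \<in> carrier R" using w insert.prems Fc vc by auto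
      have e: "(s' \<otimes> s \<ominus> ?q) \<otimes> w = (s' \<ominus> q') \<otimes> ((s \<ominus> q) \<otimes> w)"
        unfolding eq using s s' qc qc' wc by (simp add: m_assoc)
      show ?thesis unfolding e using w s'(3) s(3) P.I_l_closed s'(1) qc' by auto
    qed
    ultimately show ?case using s s' by (meson \<Sigma>_mult)
  qed
  from this[of F] obtain s q where s: "s \<in> \<Sigma>" "q \<in> Q" "\<forall>v\<in>F. (s \<ominus> q) \<otimes> v \<in> P"
    using F by (auto simp: FF_def)
  have qc: "q \<in> carrier R" using s Q.Icarr by simp
  have "s \<ominus> q \<in> annih F" using s(1,3) qc unfolding annih_def by simp
  then have "s \<ominus> q \<in> Q" using annP PQ by blast
  from Q.a_closed[OF this s(2)] have "s \<in> Q"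
    using add_diff_cancel(2)[of s q] s(1) qc by simp
  then show ?thesis using \<Sigma>_C[OF s(1)] \<Sigma>_notin[OF s(1)] by blast
qed

end

section \<open>Monoid algebras finite over a central power\<close>

text \<open>As the sequence may be dependent, a nonzero element is only known to have some leading term.\<close>

lemma (in vector_sequence) nonzero_leading_term:
  assumes "f \<in> initial_span d" "f \<noteq> \<zero>\<^bsub>V\<^esub>"
  shows "\<exists>k. \<exists>c\<in>carrier K. \<exists>u\<in>initial_span k. c \<noteq> \<zero>\<^bsub>K\<^esub> \<and> f = c \<odot>\<^bsub>V\<^esub> \<phi> k \<oplus>\<^bsub>V\<^esub> u"
  using assms
proof (induction d)
  case (Suc d)
  then obtain c u where f: "f = c \<odot>\<^bsub>V\<^esub> \<phi> d \<oplus>\<^bsub>V\<^esub> u" "c \<in> carrier K" "u \<in> initial_span d" by auto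
  have "u \<in> carrier V" using f(3) initial_span_carrier by blast
  then show ?case using Suc f by (cases "c = \<zero>\<^bsub>K\<^esub>") auto
qed auto

context monoid_alg
begin

lemma left_ideal_submodule:
  assumes "left_ideal I A" shows "submodule I K A"
proof (intro A.submoduleI)
  note I = A.left_idealD[OF assms]
  show "c \<odot>\<^bsub>A\<^esub> x \<in> I" if c: "c \<in> carrier K" and x: "x \<in> I" for c x
  proof -
    have "(c \<odot>\<^bsub>A\<^esub> \<one>\<^bsub>A\<^esub>) \<otimes>\<^bsub>A\<^esub> x = c \<odot>\<^bsub>A\<^esub> x"
      using c I(2)[OF x] by (subst smult_mult_l) auto
    moreover have "(c \<odot>\<^bsub>A\<^esub> \<one>\<^bsub>A\<^esub>) \<otimes>\<^bsub>A\<^esub> x \<in> I" using c x by (intro I(5)) auto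
    ultimately show ?thesis by simp
  qed
  show "I \<subseteq> carrier A" "\<zero>\<^bsub>A\<^esub> \<in> I" "x \<in> I \<Longrightarrow> \<ominus>\<^bsub>A\<^esub> x \<in> I" "x \<in> I \<Longrightarrow> y \<in> I \<Longrightarrow> x \<oplus>\<^bsub>A\<^esub> y \<in> I" for x y
    by (fact I(1), fact I(3), erule I(6), erule I(4))
qed

lemma right_ideal_submodule:
  assumes "right_ideal I A" shows "submodule I K A"
proof (intro A.submoduleI)
  interpret I: additive_subgroup I A using assms by (simp add: right_ideal_def)
  show "c \<odot>\<^bsub>A\<^esub> x \<in> I" if c: "c \<in> carrier K" and x: "x \<in> I" for c x
  proof -
    have "x \<otimes>\<^bsub>A\<^esub> (c \<odot>\<^bsub>A\<^esub> \<one>\<^bsub>A\<^esub>) \<in> I" using assms c x by (simp add: right_ideal_def)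
    then show ?thesis using c I.a_Hcarr[OF x] by (simp add: smult_mult_r)
  qed
  show "\<zero>\<^bsub>A\<^esub> \<in> I" "x \<in> I \<Longrightarrow> y \<in> I \<Longrightarrow> x \<oplus>\<^bsub>A\<^esub> y \<in> I" "x \<in> I \<Longrightarrow> \<ominus>\<^bsub>A\<^esub> x \<in> I" for x y
    using I.a_inv_closed by simp_all
  show "I \<subseteq> carrier A" by (rule I.a_subset)
qed

lemma single_central:
  assumes z: "z \<in> carrier M" and c: "c \<in> carrier K"
    and central: "\<And>s. s \<in> carrier M \<Longrightarrow> z \<otimes>\<^bsub>M\<^esub> s = s \<otimes>\<^bsub>M\<^esub> z" and f: "f \<in> carrier A"
  shows "single K c z \<otimes>\<^bsub>A\<^esub> f = f \<otimes>\<^bsub>A\<^esub> single K c z"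
  using f
  by (induction rule: single_induct)
     (use z c in \<open>simp_all add: mult_r_distr mult_l_distr single_mult_single central K.m_comm\<close>)

definition supported :: "'m set \<Rightarrow> ('m \<Rightarrow> 'k) set" where
  "supported X = {f \<in> carrier A. supp K f \<subseteq> X}"

lemma supportedD: "f \<in> supported X \<Longrightarrow> f \<in> carrier A" "f \<in> supported X \<Longrightarrow> supp K f \<subseteq> X"
  by (auto simp: supported_def)

lemma supported_add:
  assumes "f \<in> supported X" "g \<in> supported X" shows "f \<oplus>\<^bsub>A\<^esub> g \<in> supported X"
proof -
  have "x \<in> X" if "x \<in> supp K (f \<oplus>\<^bsub>A\<^esub> g)" for x
  proof (rule ccontr)
    assume "x \<notin> X"
    then have "f x = \<zero>\<^bsub>K\<^esub>" "g x = \<zero>\<^bsub>K\<^esub>" using assms by (auto simp: supported_def supp_def)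
    with that show False by (simp add: supp_def add_apply)
  qed
  then show ?thesis using assms by (auto simp: supported_def)
qed

lemma supported_smult:
  assumes "f \<in> supported X" "c \<in> carrier K" shows "c \<odot>\<^bsub>A\<^esub> f \<in> supported X"
proof -
  have "x \<in> X" if "x \<in> supp K (c \<odot>\<^bsub>A\<^esub> f)" for x
  proof (rule ccontr)
    assume "x \<notin> X"
    then have "f x = \<zero>\<^bsub>K\<^esub>" using assms by (auto simp: supported_def supp_def)
    with that show False using assms(2) by (simp add: supp_def smult_apply)
  qed
  then show ?thesis using assms by (auto simp: supported_def)
qed

lemma supported_zero: "\<zero>\<^bsub>A\<^esub> \<in> supported X"
  by (simp add: supported_def supp_def zero_apply)

lemma supported_single: "c \<in> carrier K \<Longrightarrow> s \<in> carrier M \<Longrightarrow> s \<in> X \<Longrightarrow> single K c s \<in> supported X"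
  by (simp add: supported_def) (auto simp: supp_def single_def)

lemma supported_minus:
  assumes f: "f \<in> supported X" shows "\<ominus>\<^bsub>A\<^esub> f \<in> supported X"
proof -
  have "\<ominus>\<^bsub>A\<^esub> f = (\<ominus>\<^bsub>K\<^esub> \<one>\<^bsub>K\<^esub>) \<odot>\<^bsub>A\<^esub> f" using supportedD(1)[OF f] by (simp add: A.smult_l_minus)
  then show ?thesis using supported_smult[OF f, of "\<ominus>\<^bsub>K\<^esub> \<one>\<^bsub>K\<^esub>"] by simp
qed

lemma supported_submodule: "submodule (supported X) K A"
  by (intro A.submoduleI)
     (auto simp: supported_add supported_smult supported_zero supported_minus dest: supportedD)

lemma supported_mult:
  assumes f: "f \<in> supported X" and g: "g \<in> supported Y"
    and XY: "\<And>s t. s \<in> X \<Longrightarrow> t \<in> Y \<Longrightarrow> s \<in> carrier M \<Longrightarrow> t \<in> carrier M \<Longrightarrow> s \<otimes>\<^bsub>M\<^esub> t \<in> W"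
  shows "f \<otimes>\<^bsub>A\<^esub> g \<in> supported W"
proof -
  note fD = supportedD[OF f] and gD = supportedD[OF g]
  have "supp K (f \<otimes>\<^bsub>A\<^esub> g) \<subseteq> W"
    using supp_mult[OF fD(1) gD(1)] supp_in[OF fD(1)] supp_in[OF gD(1)] fD(2) gD(2) XY by fast
  then show ?thesis using fD gD by (simp add: supported_def)
qed

lemma supported_mono: "X \<subseteq> Y \<Longrightarrow> supported X \<subseteq> supported Y" by (auto simp: supported_def)

lemma supported_carrier: "supported (carrier M) = carrier A"
  by (auto simp: supported_def dest: supp_in)

lemma supported_least:
  assumes W: "submodule W K A" and s: "\<And>s. s \<in> X \<Longrightarrow> s \<in> carrier M \<Longrightarrow> single K \<one>\<^bsub>K\<^esub> s \<in> W"
  shows "supported X \<subseteq> W"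
proof
  fix f assume f: "f \<in> supported X"
  note W = A.submodule_closed[OF W]
  show "f \<in> W" using supportedD(1)[OF f]
  proof (induction rule: single_induct)
    case zero show ?case by (rule W)
  next
    case (add c s g)
    have "single K c s = c \<odot>\<^bsub>A\<^esub> single K \<one>\<^bsub>K\<^esub> s" using add by (simp add: smult_single)
    moreover have "s \<in> X" using add supportedD(2)[OF f] by blast
    ultimately show ?case using W(3,6) s add by auto
  qed
qed

lemma supported_subring:
  assumes X: "\<one>\<^bsub>M\<^esub> \<in> X" "\<And>s t. s \<in> X \<Longrightarrow> t \<in> X \<Longrightarrow> s \<otimes>\<^bsub>M\<^esub> t \<in> X"
  shows "subring (supported X) A"
proof (intro A.subringI)
  show "\<one>\<^bsub>A\<^esub> \<in> supported X" using X by (simp add: one_eq supported_single)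
  show "f \<otimes>\<^bsub>A\<^esub> g \<in> supported X" if "f \<in> supported X" "g \<in> supported X" for f g
    using supported_mult[OF that] X(2) by blast
qed (auto simp: supported_add supported_minus dest: supportedD)

end

text \<open>Every element of the monoid arises from one of finitely many by multiplication with a power of a
  central element \<open>z\<close>; so the algebra is a finitely generated module over the polynomials in \<open>z\<close>.\<close>

locale finite_over_power = monoid_alg K M + K: field K
  for K :: "('k, 'c) ring_scheme" and M :: "('m, 'e) monoid_scheme" +
  fixes z :: 'm and B :: "'m set"
  assumes z [simp]: "z \<in> carrier M" and z_central: "s \<in> carrier M \<Longrightarrow> z \<otimes>\<^bsub>M\<^esub> s = s \<otimes>\<^bsub>M\<^esub> z"
    and B: "finite B" "B \<subseteq> carrier M"
    and B_gen: "s \<in> carrier M \<Longrightarrow> \<exists>k::nat. \<exists>b\<in>B. s = z [^]\<^bsub>M\<^esub> k \<otimes>\<^bsub>M\<^esub> b"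
begin

lemma power_central: "s \<in> carrier M \<Longrightarrow> z [^]\<^bsub>M\<^esub> (k::nat) \<otimes>\<^bsub>M\<^esub> s = s \<otimes>\<^bsub>M\<^esub> z [^]\<^bsub>M\<^esub> k"
proof (induction k)
  case (Suc k)
  have "z [^]\<^bsub>M\<^esub> Suc k \<otimes>\<^bsub>M\<^esub> s = z [^]\<^bsub>M\<^esub> k \<otimes>\<^bsub>M\<^esub> s \<otimes>\<^bsub>M\<^esub> z"
    using Suc.prems by (simp add: M.m_assoc z_central)
  also have "\<dots> = s \<otimes>\<^bsub>M\<^esub> z [^]\<^bsub>M\<^esub> Suc k" using Suc by (simp add: M.m_assoc)
  finally show ?case .
qed auto

definition b :: "nat \<Rightarrow> 'm" where "b = (SOME e. bij_betw e {0..<card B} B)"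

lemma b_bij: "bij_betw b {0..<card B} B"
  unfolding b_def using ex_bij_betw_nat_finite[OF B(1)] by (rule someI_ex)

abbreviation r where "r \<equiv> card B"

lemma r_pos: "r > 0"
  using B_gen[OF M.one_closed] B(1) by (auto simp: card_gt_0_iff)

lemma b_carrier [simp]: "i < r \<Longrightarrow> b i \<in> carrier M"
  using b_bij B(2) by (auto simp: bij_betw_def)

text \<open>All products of powers of \<open>z\<close> with elements of \<open>B\<close>, ordered by the exponent first, so that
  multiplication by \<open>z\<close> is the shift by \<open>r\<close>.\<close>

definition \<psi> :: "nat \<Rightarrow> 'm" where "\<psi> i = z [^]\<^bsub>M\<^esub> (i div r) \<otimes>\<^bsub>M\<^esub> b (i mod r)"

lemma \<psi>_carrier [simp, intro]: "\<psi> i \<in> carrier M"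
  using r_pos by (simp add: \<psi>_def)

lemma \<psi>_shift: "\<psi> (i + r) = z \<otimes>\<^bsub>M\<^esub> \<psi> i"
proof -
  have "\<psi> (i + r) = z [^]\<^bsub>M\<^esub> Suc (i div r) \<otimes>\<^bsub>M\<^esub> b (i mod r)"
    using r_pos by (simp add: \<psi>_def del: M.nat_pow_Suc)
  also have "z [^]\<^bsub>M\<^esub> Suc (i div r) = z \<otimes>\<^bsub>M\<^esub> z [^]\<^bsub>M\<^esub> (i div r)" by (rule M.nat_pow_Suc2) simp
  finally show ?thesis using r_pos by (simp add: \<psi>_def M.m_assoc)
qed

lemma \<psi>_shift_power: "\<psi> (i + k * r) = z [^]\<^bsub>M\<^esub> k \<otimes>\<^bsub>M\<^esub> \<psi> i"
proof (induction k)
  case (Suc k)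
  have "\<psi> (i + Suc k * r) = \<psi> ((i + k * r) + r)" by (simp add: algebra_simps)
  also have "\<dots> = z \<otimes>\<^bsub>M\<^esub> (z [^]\<^bsub>M\<^esub> k \<otimes>\<^bsub>M\<^esub> \<psi> i)" by (simp only: \<psi>_shift Suc)
  also have "\<dots> = z [^]\<^bsub>M\<^esub> Suc k \<otimes>\<^bsub>M\<^esub> \<psi> i" by (simp add: M.m_assoc[symmetric] z_central)
  finally show ?case .
qed simp

lemma \<psi>_surj: "s \<in> carrier M \<Longrightarrow> \<exists>i. s = \<psi> i"
proof -
  assume "s \<in> carrier M"
  then obtain k c where s: "c \<in> B" "s = z [^]\<^bsub>M\<^esub> (k::nat) \<otimes>\<^bsub>M\<^esub> c" using B_gen by blast
  obtain i where "i \<in> {0..<r}" and c: "c = b i"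
    using s(1) bij_betw_imp_surj_on[OF b_bij] by blast
  then have i: "i < r" "c = b i" by auto
  have "s = \<psi> (i + k * r)" using s i r_pos by (simp add: \<psi>_def)
  then show ?thesis by blast
qed

abbreviation Z where "Z \<equiv> single K \<one>\<^bsub>K\<^esub> z"

sublocale V: vector_sequence K A "\<lambda>i. single K \<one>\<^bsub>K\<^esub> (\<psi> i)"
  by (intro vector_sequence.intro vector_sequence_axioms.intro module_A K.field_axioms) auto

lemma V_spanning: "\<exists>d. f \<in> V.initial_span d" if f: "f \<in> carrier A"
  using f
proof (induction rule: single_induct)
  case zero then show ?case by (intro exI[of _ 0]) simp
next
  case (add c s g)
  obtain i where i: "s = \<psi> i" using \<psi>_surj add by blast
  obtain d where d: "g \<in> V.initial_span d" using add by blast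
  have "single K c s = c \<odot>\<^bsub>A\<^esub> single K \<one>\<^bsub>K\<^esub> (\<psi> i)" using add i by (simp add: smult_single)
  then have "single K c s \<in> V.initial_span (Suc i)"
    using V.initial_span_closed(6)[OF _ V.seq_initial_span] add by simp
  then have "single K c s \<in> V.initial_span (max (Suc i) d)" "g \<in> V.initial_span (max (Suc i) d)"
    using V.initial_span_mono d by (meson max.cobounded1 max.cobounded2 subsetD)+
  then show ?case using V.initial_span_closed(3) by blast
qed

sublocale V: shift_sequence K A "\<lambda>i. single K \<one>\<^bsub>K\<^esub> (\<psi> i)" "\<lambda>f. Z \<otimes>\<^bsub>A\<^esub> f" r
proof
  show "0 < r" by (rule r_pos)
  show "carrier A \<subseteq> (\<Union>d. V.initial_span d)" using V_spanning by blast
qed (auto simp: mult_r_distr smult_mult_r single_mult_single \<psi>_shift)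

lemma Z_central: "f \<in> carrier A \<Longrightarrow> Z \<otimes>\<^bsub>A\<^esub> f = f \<otimes>\<^bsub>A\<^esub> Z"
  by (rule single_central) (auto simp: z_central)

text \<open>One-sided ideals are subspaces, and as \<open>z\<close> is central both kinds are stable under
  multiplication by \<open>z\<close> from the left.\<close>

theorem left_noetherian_A: "left_noetherian A"
  unfolding left_noetherian_def
proof (intro conjI allI impI ring_A)
  fix I :: "nat \<Rightarrow> ('m \<Rightarrow> 'k) set"
  assume I: "\<forall>k. left_ideal (I k) A \<and> I k \<subseteq> I (Suc k)"
  show "\<exists>N. \<forall>k\<ge>N. I k = I N"
  proof (rule V.shift_stable_chain_stabilises)
    show "submodule (I k) K A" for k using I left_ideal_submodule by blast
    show "Z \<otimes>\<^bsub>A\<^esub> x \<in> I k" if "x \<in> I k" for k x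
      using I A.left_idealD(5)[of "I k" Z x] that by simp
  qed (use I in blast)
qed

theorem right_noetherian_A: "right_noetherian A"
  unfolding right_noetherian_def
proof (intro conjI allI impI ring_A)
  fix I :: "nat \<Rightarrow> ('m \<Rightarrow> 'k) set"
  assume I: "\<forall>k. right_ideal (I k) A \<and> I k \<subseteq> I (Suc k)"
  show "\<exists>N. \<forall>k\<ge>N. I k = I N"
  proof (rule V.shift_stable_chain_stabilises)
    show S: "submodule (I k) K A" for k using I right_ideal_submodule by blast
    show "Z \<otimes>\<^bsub>A\<^esub> x \<in> I k" if x: "x \<in> I k" for k x
    proof -
      have "x \<in> carrier A" using A.submodule_closed(1)[OF S] x by blast
      moreover have "x \<otimes>\<^bsub>A\<^esub> Z \<in> I k" using I x by (simp add: right_ideal_def)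
      ultimately show ?thesis by (simp add: Z_central)
    qed
  qed (use I in blast)
qed

definition powers :: "'m set" where "powers = range (\<lambda>k::nat. z [^]\<^bsub>M\<^esub> k)"

lemma powers_closed: "s \<in> powers \<Longrightarrow> s \<in> carrier M" "\<one>\<^bsub>M\<^esub> \<in> powers"
  "s \<in> powers \<Longrightarrow> t \<in> powers \<Longrightarrow> s \<otimes>\<^bsub>M\<^esub> t \<in> powers"
  "s \<in> powers \<Longrightarrow> t \<in> carrier M \<Longrightarrow> s \<otimes>\<^bsub>M\<^esub> t = t \<otimes>\<^bsub>M\<^esub> s"
proof -
  show "\<one>\<^bsub>M\<^esub> \<in> powers" unfolding powers_def by (rule range_eqI[of _ _ 0]) simp
qed (auto simp: powers_def M.nat_pow_mult power_central)

text \<open>The polynomials in \<open>z\<close>.\<close>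

abbreviation Cz where "Cz \<equiv> supported powers"

lemma Cz_central:
  assumes c: "c \<in> Cz" and f: "f \<in> carrier A" shows "c \<otimes>\<^bsub>A\<^esub> f = f \<otimes>\<^bsub>A\<^esub> c"
  using supportedD(1)[OF c]
proof (induction rule: single_induct)
  case zero then show ?case using f by simp
next
  case (add d s g)
  have "s \<in> powers" using add supportedD(2)[OF c] by blast
  then have "single K d s \<otimes>\<^bsub>A\<^esub> f = f \<otimes>\<^bsub>A\<^esub> single K d s"
    using add f powers_closed(4) by (intro single_central) auto
  then show ?case using add f by (simp add: mult_r_distr mult_l_distr)
qed

sublocale W: vector_sequence K A "\<lambda>k::nat. single K \<one>\<^bsub>K\<^esub> (z [^]\<^bsub>M\<^esub> k)"
  by (intro vector_sequence.intro vector_sequence_axioms.intro module_A K.field_axioms) auto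

lemma Cz_span: "\<exists>d. f \<in> W.initial_span d" if f: "f \<in> Cz"
  using supportedD(1)[OF f]
proof (induction rule: single_induct)
  case zero then show ?case by (intro exI[of _ 0]) simp
next
  case (add c s g)
  obtain i where i: "s = z [^]\<^bsub>M\<^esub> (i::nat)" using add supportedD(2)[OF f] by (auto simp: powers_def)
  obtain d where d: "g \<in> W.initial_span d" using add by blast
  have "single K c s = c \<odot>\<^bsub>A\<^esub> single K \<one>\<^bsub>K\<^esub> (z [^]\<^bsub>M\<^esub> i)" using add i by (simp add: smult_single)
  then have "single K c s \<in> W.initial_span (Suc i)"
    using W.initial_span_closed(6)[OF _ W.seq_initial_span] add by simp
  then have "single K c s \<in> W.initial_span (max (Suc i) d)" "g \<in> W.initial_span (max (Suc i) d)"
    using W.initial_span_mono d by (meson max.cobounded1 max.cobounded2 subsetD)+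
  then show ?case using W.initial_span_closed(3) by blast
qed

text \<open>Incomparability over the polynomials in \<open>z\<close> gives a polynomial in \<open>P1\<close> outside \<open>P0\<close>, hence a
  nonzero one. If its degree is \<open>k\<close>, then its products with the elements of \<open>B\<close> and with powers of
  \<open>z\<close> have leading positions from \<open>k r\<close> on, so all further positions can be eliminated modulo \<open>P1\<close>.\<close>

lemma prime_above_prime_finite_codimension:
  assumes P0: "nc_prime_ideal P0 A" and P1: "ideal P1 A" "P0 \<subset> P1"
  shows "\<exists>d. \<forall>f\<in>carrier A. \<exists>v\<in>V.initial_span d. f \<ominus>\<^bsub>A\<^esub> v \<in> P1"
proof -
  interpret P0: ideal P0 A using P0 by (simp add: nc_prime_ideal_def)
  interpret P1: ideal P1 A by (rule P1)
  interpret F: finite_over_central A Cz P0 "\<lambda>i. single K \<one>\<^bsub>K\<^esub> (\<psi> i)" r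
    by (intro finite_over_central.intro ring_A finite_over_central_axioms.intro
        supported_subring powers_closed Cz_central P0) auto
  have all: "f \<in> F.gen_span r" if "f \<in> carrier A" for f
    using that
  proof (induction rule: single_induct)
    case zero
    have "\<zero>\<^bsub>A\<^esub> \<otimes>\<^bsub>A\<^esub> single K \<one>\<^bsub>K\<^esub> (\<psi> 0) \<in> F.gen_span r"
      using r_pos F.C_closed(2) by (rule F.gen_span_gen)
    then show ?case by simp
  next
    case (add c s g)
    obtain i where i: "s = \<psi> i" using add \<psi>_surj by blast
    have "s = z [^]\<^bsub>M\<^esub> (i div r) \<otimes>\<^bsub>M\<^esub> \<psi> (i mod r)"
      unfolding i \<psi>_shift_power[symmetric] by simp
    then have "single K c s = single K c (z [^]\<^bsub>M\<^esub> (i div r)) \<otimes>\<^bsub>A\<^esub> single K \<one>\<^bsub>K\<^esub> (\<psi> (i mod r))"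
      using add by (simp add: single_mult_single)
    moreover have "single K c (z [^]\<^bsub>M\<^esub> (i div r)) \<in> Cz"
      using add by (intro supported_single) (auto simp: powers_def)
    ultimately have "single K c s \<in> F.gen_span r" using F.gen_span_gen[of "i mod r" r] r_pos by simp
    then show ?case using add F.gen_span_add by blast
  qed
  have gen: "\<exists>v\<in>F.gen_span r. f \<ominus>\<^bsub>A\<^esub> v \<in> P0" if f: "f \<in> carrier A" for f
    using all[OF f] f P0.zero_closed by (intro bexI[of _ f]) (simp_all add: a_minus_def A.r_neg)
  interpret F: finite_over_central_gen A Cz P0 "\<lambda>i. single K \<one>\<^bsub>K\<^esub> (\<psi> i)" r
    by unfold_locales (rule gen)
  obtain f where f: "f \<in> Cz" "f \<in> P1" "f \<notin> P0"
    using F.larger_ideal_meets_centre P1 by blast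
  obtain d where d: "f \<in> W.initial_span d" using Cz_span f by blast
  have "f \<noteq> \<zero>\<^bsub>A\<^esub>" using f P0.zero_closed by blast
  from W.nonzero_leading_term[OF d this] obtain k c u where
    c: "c \<in> carrier K" "c \<noteq> \<zero>\<^bsub>K\<^esub>" and u: "u \<in> W.initial_span k"
    and fe: "f = c \<odot>\<^bsub>A\<^esub> single K \<one>\<^bsub>K\<^esub> (z [^]\<^bsub>M\<^esub> k) \<oplus>\<^bsub>A\<^esub> u" by blast
  have uc: "u \<in> carrier A" using u W.initial_span_carrier by blast
  have unit: "c \<in> Units K" using c by (simp add: K.field_Units)
  let ?c = "inv\<^bsub>K\<^esub> c"
  have c': "?c \<in> carrier K" using unit by simp
  define w where "w = ?c \<odot>\<^bsub>A\<^esub> u"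
  have w: "w \<in> W.initial_span k" unfolding w_def using W.initial_span_closed(6) c' u by blast
  have wc: "w \<in> carrier A" using w W.initial_span_carrier by blast
  have "?c \<odot>\<^bsub>A\<^esub> f = single K (?c \<otimes>\<^bsub>K\<^esub> c) (z [^]\<^bsub>M\<^esub> k) \<oplus>\<^bsub>A\<^esub> w"
    unfolding fe w_def using c c' uc by (simp add: A.smult_r_distr smult_single)
  then have m: "?c \<odot>\<^bsub>A\<^esub> f = single K \<one>\<^bsub>K\<^esub> (z [^]\<^bsub>M\<^esub> k) \<oplus>\<^bsub>A\<^esub> w"
    using unit by simp
  have P1s: "submodule P1 K A" using P1 A.ideal_left_ideal left_ideal_submodule by blast
  have mP: "single K \<one>\<^bsub>K\<^esub> (z [^]\<^bsub>M\<^esub> k) \<oplus>\<^bsub>A\<^esub> w \<in> P1"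
    using A.submodule_closed(6)[OF P1s c' f(2)] unfolding m .
  have lead: "d \<in> V.lead P1" if d: "d \<ge> k * r" for d
  proof -
    obtain i where i: "d = i + k * r" using le_Suc_ex[OF d] by (auto simp: add.commute)
    let ?e = "single K \<one>\<^bsub>K\<^esub> (\<psi> i)"
    have "(single K \<one>\<^bsub>K\<^esub> (z [^]\<^bsub>M\<^esub> k) \<oplus>\<^bsub>A\<^esub> w) \<otimes>\<^bsub>A\<^esub> ?e \<in> P1"
      by (rule P1.I_r_closed[OF mP]) auto
    then have "single K \<one>\<^bsub>K\<^esub> (\<psi> d) \<oplus>\<^bsub>A\<^esub> w \<otimes>\<^bsub>A\<^esub> ?e \<in> P1"
      using wc by (simp add: mult_l_distr single_mult_single i \<psi>_shift_power)
    moreover have "w \<otimes>\<^bsub>A\<^esub> ?e \<in> V.initial_span d"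
    proof -
      have "v \<otimes>\<^bsub>A\<^esub> ?e \<in> V.initial_span (i + j * r)" if "v \<in> W.initial_span j" for v j
        using that
      proof (induction j arbitrary: v)
        case 0 then show ?case using V.initial_span_closed(2) by simp
      next
        case (Suc j)
        then obtain a v' where v: "v = a \<odot>\<^bsub>A\<^esub> single K \<one>\<^bsub>K\<^esub> (z [^]\<^bsub>M\<^esub> j) \<oplus>\<^bsub>A\<^esub> v'" "a \<in> carrier K" "v' \<in> W.initial_span j"
          by auto
        have "v' \<in> carrier A" using v(3) W.initial_span_carrier by blast
        then have "v \<otimes>\<^bsub>A\<^esub> ?e = a \<odot>\<^bsub>A\<^esub> single K \<one>\<^bsub>K\<^esub> (\<psi> (i + j * r)) \<oplus>\<^bsub>A\<^esub> v' \<otimes>\<^bsub>A\<^esub> ?e"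
          using v(2) by (simp add: v(1) mult_l_distr smult_mult_l single_mult_single \<psi>_shift_power)
        then have "v \<otimes>\<^bsub>A\<^esub> ?e \<in> V.initial_span (Suc (i + j * r))"
          using Suc.IH[OF v(3)] v(2) V.initial_spanI by simp
        then show ?case using V.initial_span_mono[of "Suc (i + j * r)" "i + Suc j * r"] r_pos by auto
      qed
      from this[OF w] show ?thesis by (simp add: i)
    qed
    ultimately show ?thesis by (auto simp: V.lead_def)
  qed
  have "\<exists>v\<in>V.initial_span (k * r). g \<ominus>\<^bsub>A\<^esub> v \<in> P1" if g: "g \<in> carrier A" for g
  proof -
    obtain e where e: "g \<in> V.initial_span e" using V_spanning[OF g] by blast
    obtain i v where iv: "i \<in> P1" "v \<in> V.initial_span (k * r)" "g = i \<oplus>\<^bsub>A\<^esub> v"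
      using V.reduce_by_lead[OF P1s A.carrier_is_submodule P1.a_subset lead g e] by blast
    have "v \<in> carrier A" using iv V.initial_span_carrier by blast
    then have "g \<ominus>\<^bsub>A\<^esub> v = i" using iv P1.Icarr A.add_diff_cancel(1)[of v i] A.a_comm by simp
    with iv(1,2) show ?thesis by metis
  qed
  then show ?thesis by blast
qed

text \<open>By the preceding lemma the algebra is spanned modulo \<open>P1\<close> by finitely many elements over the
  scalars alone. Incomparability over the scalars then gives a scalar in \<open>P2\<close> outside \<open>P1\<close>, that is,
  a unit in \<open>P2\<close>.\<close>

theorem no_long_prime_chain:
  assumes P0: "nc_prime_ideal P0 A" and P1: "nc_prime_ideal P1 A" and P2: "nc_prime_ideal P2 A"
    and "P0 \<subset> P1" "P1 \<subset> P2"
  shows False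
proof -
  interpret P1: ideal P1 A using P1 by (simp add: nc_prime_ideal_def)
  interpret P2: ideal P2 A using P2 by (simp add: nc_prime_ideal_def)
  obtain d where d: "\<And>f. f \<in> carrier A \<Longrightarrow> \<exists>v\<in>V.initial_span d. f \<ominus>\<^bsub>A\<^esub> v \<in> P1"
    using prime_above_prime_finite_codimension[OF P0 P1.ideal_axioms \<open>P0 \<subset> P1\<close>] by blast
  let ?C = "supported {\<one>\<^bsub>M\<^esub>}"
  have Ce: "\<exists>a\<in>carrier K. f = a \<odot>\<^bsub>A\<^esub> \<one>\<^bsub>A\<^esub>" if f: "f \<in> ?C" for f
  proof
    show "f \<one>\<^bsub>M\<^esub> \<in> carrier K" using value_in[OF supportedD(1)[OF f]] .
    show "f = f \<one>\<^bsub>M\<^esub> \<odot>\<^bsub>A\<^esub> \<one>\<^bsub>A\<^esub>"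
      using f \<open>f \<one>\<^bsub>M\<^esub> \<in> carrier K\<close>
      by (auto simp: fun_eq_iff smult_apply one_eq single_def supported_def supp_def)
  qed
  have cent: "c \<otimes>\<^bsub>A\<^esub> f = f \<otimes>\<^bsub>A\<^esub> c" if c: "c \<in> ?C" and f: "f \<in> carrier A" for c f
    using Ce[OF c] f by (auto simp: smult_mult_l smult_mult_r)
  interpret F: finite_over_central A ?C P1 "\<lambda>i. single K \<one>\<^bsub>K\<^esub> (\<psi> i)" d
    by (intro finite_over_central.intro ring_A finite_over_central_axioms.intro
        supported_subring cent P1) auto
  have "V.initial_span e \<subseteq> F.gen_span e" for e
  proof (induction e)
    case (Suc e)
    show ?case
    proof
      fix f assume "f \<in> V.initial_span (Suc e)"
      then obtain a u where f: "f = a \<odot>\<^bsub>A\<^esub> single K \<one>\<^bsub>K\<^esub> (\<psi> e) \<oplus>\<^bsub>A\<^esub> u" "a \<in> carrier K" "u \<in> V.initial_span e"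
        by auto
      have "f = single K a \<one>\<^bsub>M\<^esub> \<otimes>\<^bsub>A\<^esub> single K \<one>\<^bsub>K\<^esub> (\<psi> e) \<oplus>\<^bsub>A\<^esub> u"
        using f by (simp add: single_mult_single smult_single)
      moreover have "single K a \<one>\<^bsub>M\<^esub> \<in> ?C" using f by (intro supported_single) auto
      ultimately show "f \<in> F.gen_span (Suc e)" using f Suc by auto
    qed
  qed simp
  then have gen: "\<exists>v\<in>F.gen_span d. f \<ominus>\<^bsub>A\<^esub> v \<in> P1" if "f \<in> carrier A" for f
    using d[OF that] by blast
  interpret F: finite_over_central_gen A ?C P1 "\<lambda>i. single K \<one>\<^bsub>K\<^esub> (\<psi> i)" d
    by unfold_locales (rule gen)
  obtain f where f: "f \<in> ?C" "f \<in> P2" "f \<notin> P1"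
    using F.larger_ideal_meets_centre[OF P2.ideal_axioms \<open>P1 \<subset> P2\<close>] by blast
  obtain a where a: "a \<in> carrier K" "f = a \<odot>\<^bsub>A\<^esub> \<one>\<^bsub>A\<^esub>" using Ce f by blast
  have "a \<noteq> \<zero>\<^bsub>K\<^esub>" using f(3) a P1.zero_closed by auto
  then have unit: "a \<in> Units K" using a by (simp add: K.field_Units)
  have "submodule P2 K A" using P2.ideal_axioms A.ideal_left_ideal left_ideal_submodule by blast
  from A.submodule_closed(6)[OF this _ f(2), of "inv\<^bsub>K\<^esub> a"]
  have "(inv\<^bsub>K\<^esub> a) \<odot>\<^bsub>A\<^esub> (a \<odot>\<^bsub>A\<^esub> \<one>\<^bsub>A\<^esub>) \<in> P2" using unit a by simp
  then have "\<one>\<^bsub>A\<^esub> \<in> P2" using unit a by (simp add: A.smult_assoc1[symmetric])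
  then show False using P2 P2.one_imp_carrier by (simp add: nc_prime_ideal_def)
qed

end

section \<open>The standard polynomial identity\<close>

definition perms :: "nat \<Rightarrow> (nat \<Rightarrow> nat) set" where
  "perms m = {p. p permutes {..<m}}"

definition perm_word :: "nat \<Rightarrow> (nat \<Rightarrow> nat) \<Rightarrow> nat list" where
  "perm_word m p = map p [0..<m]"

lemma finite_perms [simp]: "finite (perms m)"
  by (simp add: perms_def finite_permutations)

lemma perm_word_inj: "inj_on (perm_word m) (perms m)"
proof (rule inj_onI)
  fix p q assume p: "p \<in> perms m" and q: "q \<in> perms m" and eq: "perm_word m p = perm_word m q"
  show "p = q"
  proof
    fix i show "p i = q i"
    proof (cases "i < m")
      case True
      then show ?thesis using arg_cong[OF eq, of "\<lambda>w. w ! i"] by (simp add: perm_word_def)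
    next
      case False
      then show ?thesis using p q by (simp add: perms_def permutes_not_in)
    qed
  qed
qed

lemma distinct_perm_word: "p \<in> perms m \<Longrightarrow> distinct (perm_word m p)"
  by (auto simp: perm_word_def perms_def distinct_map intro: permutes_inj_on)

lemma set_perm_word: "p \<in> perms m \<Longrightarrow> set (perm_word m p) = {..<m}"
  using permutes_image[of p "{..<m}"] by (simp add: perm_word_def perms_def atLeast0LessThan)

lemma perms_transpose:
  assumes "i < m" "j < m" "p \<in> perms m"
  shows "transpose i j \<circ> p \<in> perms m"
  using assms by (auto simp: perms_def intro!: permutes_compose permutes_swap_id)

lemma odd_perms_eq:
  assumes ij: "i < m" "j < m" "i \<noteq> j"
  shows "{p \<in> perms m. \<not> evenperm p} = (\<lambda>p. transpose i j \<circ> p) ` {p \<in> perms m. evenperm p}"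
proof -
  have e: "evenperm (transpose i j \<circ> p) \<longleftrightarrow> \<not> evenperm p" if "p \<in> perms m" for p
  proof -
    have "permutation p" using that unfolding perms_def permutation_permutes by blast
    then show ?thesis using ij by (simp add: evenperm_comp permutation_swap_id evenperm_swap)
  qed
  have "p \<in> (\<lambda>p. transpose i j \<circ> p) ` {p \<in> perms m. evenperm p}"
    if "p \<in> perms m" "\<not> evenperm p" for p
  proof (rule image_eqI)
    show "p = transpose i j \<circ> (transpose i j \<circ> p)" by (simp add: comp_assoc[symmetric])
    show "transpose i j \<circ> p \<in> {p \<in> perms m. evenperm p}"
      using that e perms_transpose ij by simp
  qed
  then show ?thesis using e perms_transpose ij by auto
qed

definition perm_sign :: "('k, 'c) ring_scheme \<Rightarrow> (nat \<Rightarrow> nat) \<Rightarrow> 'k" where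
  "perm_sign K p = (if evenperm p then \<one>\<^bsub>K\<^esub> else \<ominus>\<^bsub>K\<^esub> \<one>\<^bsub>K\<^esub>)"

text \<open>The polynomial \<open>\<Sum> sgn(p) X\<^bsub>p 0\<^esub> \<dots> X\<^bsub>p (m - 1)\<^esub>\<close>, summed over the permutations of \<open>{0, \<dots>, m - 1}\<close>.
  Different permutations give different words, so the coefficient of a word is the sign of the
  permutation it spells.\<close>

definition standard_polynomial :: "('k, 'c) ring_scheme \<Rightarrow> nat \<Rightarrow> nat list \<Rightarrow> 'k" where
  "standard_polynomial K m w =
     (if w \<in> perm_word m ` perms m then perm_sign K (the_inv_into (perms m) (perm_word m) w) else \<zero>\<^bsub>K\<^esub>)"

context assoc_algebra
begin

definition word_value :: "(nat \<Rightarrow> 'a) \<Rightarrow> nat list \<Rightarrow> 'a" where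
  "word_value a w = foldr (\<lambda>i y. a i \<otimes>\<^bsub>A\<^esub> y) w \<one>\<^bsub>A\<^esub>"

lemma word_value_simps [simp]:
  "word_value a [] = \<one>\<^bsub>A\<^esub>" "word_value a (i # w) = a i \<otimes>\<^bsub>A\<^esub> word_value a w"
  by (simp_all add: word_value_def)

lemma word_value_closed [simp]: "(\<And>i. a i \<in> carrier A) \<Longrightarrow> word_value a w \<in> carrier A"
  by (induction w) auto

lemma word_value_cong: "(\<And>i. i \<in> set w \<Longrightarrow> a i = b i) \<Longrightarrow> word_value a w = word_value b w"
  by (induction w) auto

lemma word_value_map: "word_value a (map g w) = word_value (a \<circ> g) w"
  by (induction w) auto

text \<open>A variable that occurs exactly once enters linearly, also over central elements.\<close>

lemma word_value_split:
  assumes "distinct w" "k \<in> set w" "\<And>i. a i \<in> carrier A"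
  shows "\<exists>u\<in>carrier A. \<exists>v\<in>carrier A. \<forall>x\<in>carrier A. word_value (a(k := x)) w = u \<otimes>\<^bsub>A\<^esub> x \<otimes>\<^bsub>A\<^esub> v"
  using assms(1,2)
proof (induction w)
  case (Cons i w)
  show ?case
  proof (cases "i = k")
    case True
    then have "word_value (a(k := x)) w = word_value a w" for x
      using Cons.prems by (intro word_value_cong) auto
    then show ?thesis using True assms(3)
      by (intro bexI[of _ "\<one>\<^bsub>A\<^esub>"] bexI[of _ "word_value a w"]) (auto simp del: fun_upd_apply, simp)
  next
    case False
    then obtain u v where uv: "u \<in> carrier A" "v \<in> carrier A"
      "\<forall>x\<in>carrier A. word_value (a(k := x)) w = u \<otimes>\<^bsub>A\<^esub> x \<otimes>\<^bsub>A\<^esub> v"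
      using Cons.IH Cons.prems by (metis distinct.simps(2) set_ConsD)
    have "word_value (a(k := x)) (i # w) = (a i \<otimes>\<^bsub>A\<^esub> u) \<otimes>\<^bsub>A\<^esub> x \<otimes>\<^bsub>A\<^esub> v" if x: "x \<in> carrier A" for x
      using uv(1,2) x assms(3) False by (simp only: word_value_simps bspec[OF uv(3) x]) (simp add: A.m_assoc)
    then show ?thesis using uv(1,2) assms(3) by blast
  qed
qed simp

definition alternating_sum :: "nat \<Rightarrow> (nat \<Rightarrow> 'a) \<Rightarrow> 'a" where
  "alternating_sum m a = (\<Oplus>\<^bsub>A\<^esub>p\<in>perms m. perm_sign K p \<odot>\<^bsub>A\<^esub> word_value a (perm_word m p))"

lemma perm_sign_closed [simp]: "perm_sign K p \<in> carrier K"
  by (simp add: perm_sign_def)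

text \<open>Composition with the transposition of \<open>i\<close> and \<open>j\<close> pairs the even permutations with the odd ones
  and leaves the value of the word unchanged.\<close>

lemma alternating_sum_repeated:
  assumes a: "\<And>i. a i \<in> carrier A" and ij: "i < m" "j < m" "i \<noteq> j" "a i = a j"
  shows "alternating_sum m a = \<zero>\<^bsub>A\<^esub>"
proof -
  let ?E = "{p \<in> perms m. evenperm p}" and ?O = "{p \<in> perms m. \<not> evenperm p}"
  let ?t = "\<lambda>p. word_value a (perm_word m p)"
  let ?f = "\<lambda>p. perm_sign K p \<odot>\<^bsub>A\<^esub> ?t p"
  have inj: "inj_on (\<lambda>p. transpose i j \<circ> p) ?E"
    by (rule inj_onI) (metis comp_assoc id_comp transpose_comp_involutory)
  have at: "a \<circ> transpose i j = a"
    using ij(4) by (auto simp: fun_eq_iff transpose_def)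
  have "?t (transpose i j \<circ> p) = ?t p" for p
  proof -
    have "?t (transpose i j \<circ> p) = word_value (a \<circ> transpose i j) (perm_word m p)"
      unfolding perm_word_def word_value_map by (simp add: comp_assoc)
    then show ?thesis by (simp add: at)
  qed
  then have f: "?f (transpose i j \<circ> p) = \<ominus>\<^bsub>A\<^esub> ?f p" if "p \<in> ?E" for p
  proof -
    have "transpose i j \<circ> p \<in> ?O" using odd_perms_eq[OF ij(1-3)] that by blast
    then show ?thesis
      using that a \<open>?t (transpose i j \<circ> p) = ?t p\<close> by (simp add: perm_sign_def smult_l_minus)
  qed
  have "alternating_sum m a = finsum A ?f (?E \<union> ?O)"
    unfolding alternating_sum_def by (rule arg_cong[where f = "finsum A ?f"]) auto
  also have "\<dots> = finsum A ?f ?E \<oplus>\<^bsub>A\<^esub> finsum A ?f ?O"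
    using a by (intro M.finsum_Un_disjoint) auto
  also have "finsum A ?f ?O = finsum A (\<lambda>p. ?f (transpose i j \<circ> p)) ?E"
    unfolding odd_perms_eq[OF ij(1-3)] using a inj by (intro M.finsum_reindex) auto
  also have "\<dots> = finsum A (\<lambda>p. \<ominus>\<^bsub>A\<^esub> ?f p) ?E"
    using f a by (intro M.finsum_cong') auto
  also have "finsum A ?f ?E \<oplus>\<^bsub>A\<^esub> \<dots> = finsum A (\<lambda>p. ?f p \<oplus>\<^bsub>A\<^esub> \<ominus>\<^bsub>A\<^esub> ?f p) ?E"
    using a by (intro M.finsum_addf[symmetric]) auto
  also have "\<dots> = finsum A (\<lambda>p. \<zero>\<^bsub>A\<^esub>) ?E"
    using a by (intro M.finsum_cong') (auto simp: M.r_neg)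
  finally show ?thesis by simp
qed

text \<open>Used with \<open>h\<close> the multiplication by a scalar and by a central element. Only the vanishing of the
  sum is carried over, which is what the closure of the set of zeros in one variable needs.\<close>

lemma alternating_sum_linear:
  assumes a: "\<And>i. a i \<in> carrier A" and k: "k < m"
    and h: "\<And>x. x \<in> carrier A \<Longrightarrow> h x \<in> carrier A"
    and hadd: "\<And>x y. x \<in> carrier A \<Longrightarrow> y \<in> carrier A \<Longrightarrow> h (x \<oplus>\<^bsub>A\<^esub> y) = h x \<oplus>\<^bsub>A\<^esub> h y"
    and hmul: "\<And>c x u v. c \<in> carrier K \<Longrightarrow> x \<in> carrier A \<Longrightarrow> u \<in> carrier A \<Longrightarrow> v \<in> carrier A \<Longrightarrow>
      c \<odot>\<^bsub>A\<^esub> (u \<otimes>\<^bsub>A\<^esub> h x \<otimes>\<^bsub>A\<^esub> v) = h (c \<odot>\<^bsub>A\<^esub> (u \<otimes>\<^bsub>A\<^esub> x \<otimes>\<^bsub>A\<^esub> v))"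
    and x: "x \<in> carrier A" and zero: "alternating_sum m (a(k := x)) = \<zero>\<^bsub>A\<^esub>"
  shows "alternating_sum m (a(k := h x)) = \<zero>\<^bsub>A\<^esub>"
proof -
  have h0: "h \<zero>\<^bsub>A\<^esub> = \<zero>\<^bsub>A\<^esub>"
    using hadd[of "\<zero>\<^bsub>A\<^esub>" "\<zero>\<^bsub>A\<^esub>"] h[of "\<zero>\<^bsub>A\<^esub>"] by (simp add: M.add.r_cancel_one')
  have hs: "h (finsum A f X) = finsum A (\<lambda>p. h (f p)) X" if "finite X" "f \<in> X \<rightarrow> carrier A" for X and f :: "_ \<Rightarrow> 'a"
    using that
  proof (induction X)
    case (insert y X)
    then show ?case using hadd h by (subst (1 2) M.finsum_insert) auto
  qed (simp add: h0)
  let ?f = "\<lambda>x p. perm_sign K p \<odot>\<^bsub>A\<^esub> word_value (a(k := x)) (perm_word m p)"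
  have c: "(a(k := x)) i \<in> carrier A" for i using a x by simp
  have "?f (h x) p = h (?f x p)" if p: "p \<in> perms m" for p
  proof -
    have "k \<in> set (perm_word m p)" using p k by (simp add: set_perm_word)
    from word_value_split[where a = a, OF distinct_perm_word[OF p] this a] obtain u v where
      uv: "u \<in> carrier A" "v \<in> carrier A" and
      eq: "\<forall>x\<in>carrier A. word_value (a(k := x)) (perm_word m p) = u \<otimes>\<^bsub>A\<^esub> x \<otimes>\<^bsub>A\<^esub> v"
      by blast
    show ?thesis unfolding bspec[OF eq x] bspec[OF eq h[OF x]]
      using uv x by (intro hmul) auto
  qed
  then have "alternating_sum m (a(k := h x)) = finsum A (\<lambda>p. h (?f x p)) (perms m)"
    unfolding alternating_sum_def using h c word_value_closed[of "a(k := x)", OF c]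
    by (intro M.finsum_cong') auto
  also have "\<dots> = h (alternating_sum m (a(k := x)))"
    unfolding alternating_sum_def using word_value_closed[of "a(k := x)", OF c] by (intro hs[symmetric]) auto
  finally show ?thesis using zero h0 by simp
qed

lemma alternating_sum_add:
  assumes a: "\<And>i. a i \<in> carrier A" and k: "k < m" and x: "x \<in> carrier A" and y: "y \<in> carrier A"
  shows "alternating_sum m (a(k := x \<oplus>\<^bsub>A\<^esub> y)) =
    alternating_sum m (a(k := x)) \<oplus>\<^bsub>A\<^esub> alternating_sum m (a(k := y))"
proof -
  let ?f = "\<lambda>x p. perm_sign K p \<odot>\<^bsub>A\<^esub> word_value (a(k := x)) (perm_word m p)"
  have c: "word_value (a(k := x)) w \<in> carrier A" if "x \<in> carrier A" for x w
    using a that by (intro word_value_closed) auto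
  have "?f (x \<oplus>\<^bsub>A\<^esub> y) p = ?f x p \<oplus>\<^bsub>A\<^esub> ?f y p" if p: "p \<in> perms m" for p
  proof -
    have "k \<in> set (perm_word m p)" using p k by (simp add: set_perm_word)
    from word_value_split[where a = a, OF distinct_perm_word[OF p] this a] obtain u v where
      uv: "u \<in> carrier A" "v \<in> carrier A" and
      eq: "\<forall>x\<in>carrier A. word_value (a(k := x)) (perm_word m p) = u \<otimes>\<^bsub>A\<^esub> x \<otimes>\<^bsub>A\<^esub> v"
      by blast
    have xy: "x \<oplus>\<^bsub>A\<^esub> y \<in> carrier A" using x y by simp
    show ?thesis unfolding bspec[OF eq x] bspec[OF eq y] bspec[OF eq xy]
      using uv x y by (simp add: A.l_distr A.r_distr smult_r_distr)
  qed
  then have "alternating_sum m (a(k := x \<oplus>\<^bsub>A\<^esub> y)) = finsum A (\<lambda>p. ?f x p \<oplus>\<^bsub>A\<^esub> ?f y p) (perms m)"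
    unfolding alternating_sum_def using c x y by (intro M.finsum_cong') auto
  also have "\<dots> = alternating_sum m (a(k := x)) \<oplus>\<^bsub>A\<^esub> alternating_sum m (a(k := y))"
    unfolding alternating_sum_def using c x y by (intro M.finsum_addf) auto
  finally show ?thesis .
qed

text \<open>The sum is alternating and linear over the central elements. By linearity the arguments may be
  taken from the finite set \<open>\<Phi>\<close> of generators, one argument after the other; as there are more
  arguments than generators, two of them coincide.\<close>

lemma alternating_sum_vanishes:
  assumes Phi: "finite \<Phi>" "\<Phi> \<subseteq> carrier A"
    and Zs: "\<And>z. z \<in> Zs \<Longrightarrow> z \<in> carrier A"
    and central: "\<And>z x. z \<in> Zs \<Longrightarrow> x \<in> carrier A \<Longrightarrow> z \<otimes>\<^bsub>A\<^esub> x = x \<otimes>\<^bsub>A\<^esub> z"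
    and gen: "\<And>W. submodule W K A \<Longrightarrow> \<Phi> \<subseteq> W \<Longrightarrow> (\<And>z x. z \<in> Zs \<Longrightarrow> x \<in> W \<Longrightarrow> z \<otimes>\<^bsub>A\<^esub> x \<in> W) \<Longrightarrow>
      carrier A \<subseteq> W"
    and m: "m > card \<Phi>" and a: "\<And>i. a i \<in> carrier A"
  shows "alternating_sum m a = \<zero>\<^bsub>A\<^esub>"
proof -
  have "alternating_sum m a = \<zero>\<^bsub>A\<^esub>"
    if "k \<le> m" "\<And>i. a i \<in> carrier A" "\<And>j. k \<le> j \<Longrightarrow> j < m \<Longrightarrow> a j \<in> \<Phi>" for k a
    using that
  proof (induction k arbitrary: a)
    case 0
    have "a ` {..<m} \<subseteq> \<Phi>" using 0 by auto
    then have "card (a ` {..<m}) < card {..<m}"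
      using card_mono[OF Phi(1)] m by (metis card_lessThan order.strict_trans1)
    then have "\<not> inj_on a {..<m}" by (rule pigeonhole)
    then obtain i j where "i < m" "j < m" "i \<noteq> j" "a i = a j" by (auto simp: inj_on_def)
    then show ?case using alternating_sum_repeated 0 by blast
  next
    case (Suc k)
    have k: "k < m" using Suc.prems by simp
    let ?W = "{x \<in> carrier A. alternating_sum m (a(k := x)) = \<zero>\<^bsub>A\<^esub>}"
    note ac = Suc.prems(2)
    have sm: "c \<odot>\<^bsub>A\<^esub> x \<in> ?W" if "c \<in> carrier K" "x \<in> ?W" for c x
    proof -
      have "alternating_sum m (a(k := c \<odot>\<^bsub>A\<^esub> x)) = \<zero>\<^bsub>A\<^esub>"
        using that
        by (intro alternating_sum_linear[OF ac k, where h = "\<lambda>x. c \<odot>\<^bsub>A\<^esub> x"])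
           (auto simp: smult_r_distr smult_mult_left smult_mult_right smult_assoc1[symmetric] m_comm)
      then show ?thesis using that by simp
    qed
    have "submodule ?W K A"
    proof (intro submoduleI)
      have "\<zero>\<^bsub>K\<^esub> \<odot>\<^bsub>A\<^esub> \<zero>\<^bsub>A\<^esub> = \<zero>\<^bsub>A\<^esub>" by simp
      have z: "alternating_sum m (a(k := \<zero>\<^bsub>A\<^esub>)) = alternating_sum m (a(k := \<zero>\<^bsub>A\<^esub>)) \<oplus>\<^bsub>A\<^esub> alternating_sum m (a(k := \<zero>\<^bsub>A\<^esub>))"
        using alternating_sum_add[OF ac k, of "\<zero>\<^bsub>A\<^esub>" "\<zero>\<^bsub>A\<^esub>"] by simp
      have "alternating_sum m (a(k := \<zero>\<^bsub>A\<^esub>)) \<in> carrier A"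
        unfolding alternating_sum_def using ac
        by (intro M.finsum_closed) (auto intro!: smult_closed word_value_closed)
      then have "alternating_sum m (a(k := \<zero>\<^bsub>A\<^esub>)) = \<zero>\<^bsub>A\<^esub>"
        using z by (metis M.add.r_cancel_one')
      then show "\<zero>\<^bsub>A\<^esub> \<in> ?W" by simp
      show "\<ominus>\<^bsub>A\<^esub> x \<in> ?W" if "x \<in> ?W" for x
        using sm[of "\<ominus>\<^bsub>K\<^esub> \<one>\<^bsub>K\<^esub>" x] that by (simp add: smult_l_minus)
      show "c \<odot>\<^bsub>A\<^esub> x \<in> ?W" if "c \<in> carrier K" "x \<in> ?W" for c x by (rule sm[OF that])
    qed (auto simp: alternating_sum_add[OF ac k])
    moreover have "\<Phi> \<subseteq> ?W"
    proof
      fix x assume x: "x \<in> \<Phi>"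
      have "alternating_sum m (a(k := x)) = \<zero>\<^bsub>A\<^esub>"
        using Suc.prems x Phi(2) by (intro Suc.IH) auto
      then show "x \<in> ?W" using x Phi(2) by auto
    qed
    moreover have "z \<otimes>\<^bsub>A\<^esub> x \<in> ?W" if z: "z \<in> Zs" and x: "x \<in> ?W" for z x
    proof -
      have c: "c \<odot>\<^bsub>A\<^esub> (u \<otimes>\<^bsub>A\<^esub> (z \<otimes>\<^bsub>A\<^esub> y) \<otimes>\<^bsub>A\<^esub> v) = z \<otimes>\<^bsub>A\<^esub> (c \<odot>\<^bsub>A\<^esub> (u \<otimes>\<^bsub>A\<^esub> y \<otimes>\<^bsub>A\<^esub> v))"
        if "c \<in> carrier K" "y \<in> carrier A" "u \<in> carrier A" "v \<in> carrier A" for c y u v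
      proof -
        have "u \<otimes>\<^bsub>A\<^esub> (z \<otimes>\<^bsub>A\<^esub> y) = z \<otimes>\<^bsub>A\<^esub> (u \<otimes>\<^bsub>A\<^esub> y)"
          using that Zs[OF z] central[OF z, of u] by (simp add: A.m_assoc[symmetric])
        then show ?thesis using that Zs[OF z] by (simp add: A.m_assoc smult_mult_right)
      qed
      have "alternating_sum m (a(k := z \<otimes>\<^bsub>A\<^esub> x)) = \<zero>\<^bsub>A\<^esub>"
        using x Zs[OF z] c
        by (intro alternating_sum_linear[OF ac k, where h = "\<lambda>x. z \<otimes>\<^bsub>A\<^esub> x"]) (auto simp: A.r_distr)
      then show ?thesis using x Zs[OF z] by simp
    qed
    ultimately have "carrier A \<subseteq> ?W" by (rule gen)
    then have "alternating_sum m (a(k := a k)) = \<zero>\<^bsub>A\<^esub>" using ac[of k] by blast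
    then show ?case by simp
  qed
  from this[of m a] show ?thesis using a by simp
qed

theorem PI_algebra_if_finite_over_central:
  assumes "field K" and Phi: "finite \<Phi>" "\<Phi> \<subseteq> carrier A"
    and Zs: "\<And>z. z \<in> Zs \<Longrightarrow> z \<in> carrier A"
    and central: "\<And>z x. z \<in> Zs \<Longrightarrow> x \<in> carrier A \<Longrightarrow> z \<otimes>\<^bsub>A\<^esub> x = x \<otimes>\<^bsub>A\<^esub> z"
    and gen: "\<And>W. submodule W K A \<Longrightarrow> \<Phi> \<subseteq> W \<Longrightarrow> (\<And>z x. z \<in> Zs \<Longrightarrow> x \<in> W \<Longrightarrow> z \<otimes>\<^bsub>A\<^esub> x \<in> W) \<Longrightarrow>
      carrier A \<subseteq> W"
  shows "PI_algebra K A"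
proof -
  interpret K: field K by fact
  (* One variable more than there are generators, for the pigeonhole principle. *)
  define m where "m = Suc (card \<Phi>)"
  let ?f = "standard_polynomial K m"
  have fw: "?f (perm_word m p) = perm_sign K p" if "p \<in> perms m" for p
    using that the_inv_into_f_f[OF perm_word_inj that] by (simp add: standard_polynomial_def)
  have sign_nz: "perm_sign K p \<noteq> \<zero>\<^bsub>K\<^esub>" for p
    using K.one_not_zero by (simp add: perm_sign_def)
  have nz: "{w. ?f w \<noteq> \<zero>\<^bsub>K\<^esub>} = perm_word m ` perms m"
    using fw sign_nz by (auto simp: standard_polynomial_def)
  interpret F: monoid_alg K "free_monoid UNIV"
    by (intro monoid_alg.intro R.is_cring monoidI) (auto simp: free_monoid_def)
  have fF: "?f \<in> carrier (free_algebra K)"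
    unfolding free_algebra_def
    by (rule F.carrierI[of _ "perm_word m ` perms m"])
       (auto simp: standard_polynomial_def free_monoid_def perm_sign_closed)
  have id: "id \<in> perms m" by (simp add: perms_def permutes_id)
  have "?f \<noteq> \<zero>\<^bsub>free_algebra K\<^esub>"
    unfolding free_algebra_def using fw[OF id] sign_nz[of id] F.zero_apply by metis
  moreover have "nc_eval K A a ?f = \<zero>\<^bsub>A\<^esub>" if "range a \<subseteq> carrier A" for a
  proof -
    have a: "a i \<in> carrier A" for i using that by auto
    have "nc_eval K A a ?f = (\<Oplus>\<^bsub>A\<^esub>w\<in>perm_word m ` perms m. ?f w \<odot>\<^bsub>A\<^esub> word_value a w)"
      unfolding nc_eval_def nz word_value_def ..
    also have "\<dots> = (\<Oplus>\<^bsub>A\<^esub>p\<in>perms m. ?f (perm_word m p) \<odot>\<^bsub>A\<^esub> word_value a (perm_word m p))"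
      using a perm_word_inj fw by (intro M.finsum_reindex) auto
    also have "\<dots> = alternating_sum m a"
      unfolding alternating_sum_def using a fw by (intro M.finsum_cong') auto
    also have "\<dots> = \<zero>\<^bsub>A\<^esub>"
      using a by (intro alternating_sum_vanishes[OF Phi Zs central gen]) (auto simp: m_def)
    finally show ?thesis .
  qed
  ultimately show ?thesis
    unfolding PI_algebra_def using fF assoc_algebra_axioms by blast
qed

end

lemma (in monoid_alg) PI_algebra_if_generated_over_central:
  assumes K: "field K" and B: "finite B" "B \<subseteq> carrier M"
    and Zs: "\<And>z. z \<in> Zs \<Longrightarrow> z \<in> carrier M"
    and central: "\<And>z s. z \<in> Zs \<Longrightarrow> s \<in> carrier M \<Longrightarrow> z \<otimes>\<^bsub>M\<^esub> s = s \<otimes>\<^bsub>M\<^esub> z"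
    and gen: "\<And>X. B \<subseteq> X \<Longrightarrow> (\<And>z s. z \<in> Zs \<Longrightarrow> s \<in> X \<Longrightarrow> s \<in> carrier M \<Longrightarrow> z \<otimes>\<^bsub>M\<^esub> s \<in> X) \<Longrightarrow>
      carrier M \<subseteq> X"
  shows "PI_algebra K A"
proof (rule A.PI_algebra_if_finite_over_central[OF K])
  let ?e = "\<lambda>s. single K \<one>\<^bsub>K\<^esub> s"
  show "finite (?e ` B)" "?e ` B \<subseteq> carrier A" using B by auto
  show "f \<in> carrier A" if "f \<in> ?e ` Zs" for f using that Zs by auto
  show "f \<otimes>\<^bsub>A\<^esub> g = g \<otimes>\<^bsub>A\<^esub> f" if "f \<in> ?e ` Zs" "g \<in> carrier A" for f g
    using that Zs central by (auto intro!: single_central)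
  fix W assume W: "submodule W K A" "?e ` B \<subseteq> W" "\<And>f g. f \<in> ?e ` Zs \<Longrightarrow> g \<in> W \<Longrightarrow> f \<otimes>\<^bsub>A\<^esub> g \<in> W"
  have "carrier M \<subseteq> {s. ?e s \<in> W}"
  proof (rule gen)
    show "B \<subseteq> {s. ?e s \<in> W}" using W(2) by auto
    fix z s assume z: "z \<in> Zs" and s: "s \<in> {s. ?e s \<in> W}" "s \<in> carrier M"
    have "?e z \<otimes>\<^bsub>A\<^esub> ?e s \<in> W" using W(3) z s(1) by blast
    then show "z \<otimes>\<^bsub>M\<^esub> s \<in> {s. ?e s \<in> W}" using Zs[OF z] s(2) by (simp add: single_mult_single)
  qed
  then show "carrier A \<subseteq> W" using supported_least[OF W(1), of "carrier M"] supported_carrier by blast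
qed

lemma (in finite_over_power) PI_algebra_A: "PI_algebra K A"
proof (rule PI_algebra_if_generated_over_central[OF K.field_axioms B, of "{z}"])
  fix X assume X: "B \<subseteq> X" "\<And>y s. y \<in> {z} \<Longrightarrow> s \<in> X \<Longrightarrow> s \<in> carrier M \<Longrightarrow> y \<otimes>\<^bsub>M\<^esub> s \<in> X"
  have "z [^]\<^bsub>M\<^esub> (k::nat) \<otimes>\<^bsub>M\<^esub> b \<in> X" if b: "b \<in> B" for b k
  proof (induction k)
    case 0
    have "b \<in> carrier M" "b \<in> X" using b X(1) B(2) by auto
    then show ?case by simp
  next
    case (Suc k)
    have bc: "b \<in> carrier M" using b B by auto
    have "z [^]\<^bsub>M\<^esub> Suc k \<otimes>\<^bsub>M\<^esub> b = z \<otimes>\<^bsub>M\<^esub> (z [^]\<^bsub>M\<^esub> k \<otimes>\<^bsub>M\<^esub> b)"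
      using bc by (subst M.nat_pow_Suc2) (auto simp: M.m_assoc)
    then show ?case using X(2)[OF _ Suc] bc by simp
  qed
  then show "carrier M \<subseteq> X" using B_gen by blast
qed (auto simp: z_central)

section \<open>Dimensions of graded monoid algebras\<close>

subsection \<open>Prime ideals from homomorphisms\<close>

lemma (in ring) nc_prime_kernel:
  assumes S: "ring S" and h: "h \<in> ring_hom R S" and nz: "\<one>\<^bsub>S\<^esub> \<noteq> \<zero>\<^bsub>S\<^esub>"
    and dom: "\<And>a b. a \<in> carrier S \<Longrightarrow> b \<in> carrier S \<Longrightarrow> a \<otimes>\<^bsub>S\<^esub> b = \<zero>\<^bsub>S\<^esub> \<Longrightarrow> a = \<zero>\<^bsub>S\<^esub> \<or> b = \<zero>\<^bsub>S\<^esub>"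
  shows "nc_prime_ideal {x \<in> carrier R. h x = \<zero>\<^bsub>S\<^esub>} R"
proof -
  interpret S: ring S by (rule S)
  interpret h: ring_hom_ring R S h
    by (intro ring_hom_ringI2 ring_axioms S h)
  let ?P = "{x \<in> carrier R. h x = \<zero>\<^bsub>S\<^esub>}"
  have I: "ideal ?P R" using h.kernel_is_ideal unfolding a_kernel_def' .
  show ?thesis unfolding nc_prime_ideal_def
  proof (intro conjI allI impI I)
    have "\<one> \<notin> ?P" using nz by simp
    then show "?P \<noteq> carrier R" by blast
    fix I J assume IJ: "ideal I R \<and> ideal J R \<and> I \<cdot>\<^bsub>R\<^esub> J \<subseteq> ?P"
    show "I \<subseteq> ?P \<or> J \<subseteq> ?P"
    proof (rule ccontr)
      assume "\<not> ?thesis"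
      then obtain a b where ab: "a \<in> I" "a \<notin> ?P" "b \<in> J" "b \<notin> ?P" by blast
      have c: "a \<in> carrier R" "b \<in> carrier R"
        using ideal.Icarr[of I R a] ideal.Icarr[of J R b] IJ ab by simp_all
      have "a \<otimes> b \<in> ?P" using IJ ideal_prod.prod[OF ab(1,3)] by blast
      then have "h a \<otimes>\<^bsub>S\<^esub> h b = \<zero>\<^bsub>S\<^esub>" using c h.hom_mult[of a b] by simp
      then show False using dom[of "h a" "h b"] c ab by auto
    qed
  qed
qed

lemma (in module) set_add_submodule:
  assumes V: "submodule V R M" and W: "submodule W R M"
  shows "submodule (V <+>\<^bsub>M\<^esub> W) R M"
proof (intro submoduleI)
  note VD = submodule_closed[OF V] and WD = submodule_closed[OF W]
  have m: "v \<oplus>\<^bsub>M\<^esub> w \<in> V <+>\<^bsub>M\<^esub> W" if "v \<in> V" "w \<in> W" for v w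
    using that unfolding set_add_def' by blast
  have e: "\<exists>v\<in>V. \<exists>w\<in>W. f = v \<oplus>\<^bsub>M\<^esub> w" if "f \<in> V <+>\<^bsub>M\<^esub> W" for f
    using that unfolding set_add_def' by blast
  show sub: "V <+>\<^bsub>M\<^esub> W \<subseteq> carrier M" using VD(1) WD(1) by (auto dest!: e)
  show "\<zero>\<^bsub>M\<^esub> \<in> V <+>\<^bsub>M\<^esub> W" using m[OF VD(2) WD(2)] by simp
  show sm: "c \<odot>\<^bsub>M\<^esub> f \<in> V <+>\<^bsub>M\<^esub> W" if c: "c \<in> carrier R" and f: "f \<in> V <+>\<^bsub>M\<^esub> W" for c f
  proof -
    obtain v w where vw: "v \<in> V" "w \<in> W" "f = v \<oplus>\<^bsub>M\<^esub> w" using e[OF f] by blast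
    then have "c \<odot>\<^bsub>M\<^esub> f = c \<odot>\<^bsub>M\<^esub> v \<oplus>\<^bsub>M\<^esub> c \<odot>\<^bsub>M\<^esub> w" using c VD(1) WD(1) by (simp add: smult_r_distr subset_iff)
    then show ?thesis using m[OF VD(6)[OF c vw(1)] WD(6)[OF c vw(2)]] by simp
  qed
  show "\<ominus>\<^bsub>M\<^esub> f \<in> V <+>\<^bsub>M\<^esub> W" if f: "f \<in> V <+>\<^bsub>M\<^esub> W" for f
    using sm[of "\<ominus>\<^bsub>R\<^esub> \<one>\<^bsub>R\<^esub>" f] f sub by (auto simp: smult_l_minus)
  show "f \<oplus>\<^bsub>M\<^esub> g \<in> V <+>\<^bsub>M\<^esub> W" if f: "f \<in> V <+>\<^bsub>M\<^esub> W" and g: "g \<in> V <+>\<^bsub>M\<^esub> W" for f g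
  proof -
    obtain v w where vw: "v \<in> V" "w \<in> W" "f = v \<oplus>\<^bsub>M\<^esub> w" using e[OF f] by blast
    obtain v' w' where vw': "v' \<in> V" "w' \<in> W" "g = v' \<oplus>\<^bsub>M\<^esub> w'" using e[OF g] by blast
    have c: "v \<in> carrier M" "w \<in> carrier M" "v' \<in> carrier M" "w' \<in> carrier M"
      using vw vw' VD(1) WD(1) by auto
    have "f \<oplus>\<^bsub>M\<^esub> g = (v \<oplus>\<^bsub>M\<^esub> v') \<oplus>\<^bsub>M\<^esub> (w \<oplus>\<^bsub>M\<^esub> w')" using vw vw' c by (simp add: M.a_ac)
    then show ?thesis using m[OF VD(3)[OF vw(1) vw'(1)] WD(3)[OF vw(2) vw'(2)]] by simp
  qed
qed

definition nat_monoid :: "nat monoid" where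
  "nat_monoid = \<lparr>carrier = UNIV, monoid.mult = (+), one = 0\<rparr>"

lemma nat_monoid_simps [simp]:
  "carrier nat_monoid = UNIV" "x \<otimes>\<^bsub>nat_monoid\<^esub> y = x + y" "\<one>\<^bsub>nat_monoid\<^esub> = 0"
  by (simp_all add: nat_monoid_def)

lemma monoid_nat_monoid: "monoid nat_monoid"
  by (rule monoidI) auto

text \<open>The product of the leading terms is the leading term of the product.\<close>

lemma nat_monoid_algebra_domain:
  assumes "field K" and f: "f \<in> carrier (monoid_algebra K nat_monoid)"
    and g: "g \<in> carrier (monoid_algebra K nat_monoid)"
    and fg: "f \<otimes>\<^bsub>monoid_algebra K nat_monoid\<^esub> g = \<zero>\<^bsub>monoid_algebra K nat_monoid\<^esub>"
  shows "f = \<zero>\<^bsub>monoid_algebra K nat_monoid\<^esub> \<or> g = \<zero>\<^bsub>monoid_algebra K nat_monoid\<^esub>"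
proof (rule ccontr)
  interpret K: field K by fact
  interpret N: monoid_alg K nat_monoid
    by (intro monoid_alg.intro K.is_cring monoid_nat_monoid)
  assume "\<not> ?thesis"
  then have ne: "supp K f \<noteq> {}" "supp K g \<noteq> {}" by (auto simp: supp_def N.zero_eq)
  define m where "m = Max (supp K f)"
  define n where "n = Max (supp K g)"
  have m: "f m \<noteq> \<zero>\<^bsub>K\<^esub>" "\<And>i. f i \<noteq> \<zero>\<^bsub>K\<^esub> \<Longrightarrow> i \<le> m"
    using Max_in[OF N.supp_finite[OF f] ne(1)] Max_ge[OF N.supp_finite[OF f]]
    unfolding m_def supp_def by blast+
  have n: "g n \<noteq> \<zero>\<^bsub>K\<^esub>" "\<And>i. g i \<noteq> \<zero>\<^bsub>K\<^esub> \<Longrightarrow> i \<le> n"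
    using Max_in[OF N.supp_finite[OF g] ne(2)] Max_ge[OF N.supp_finite[OF g]]
    unfolding n_def supp_def by blast+
  have "i = m \<and> j = n" if "f i \<noteq> \<zero>\<^bsub>K\<^esub>" "g j \<noteq> \<zero>\<^bsub>K\<^esub>" "i + j = m + n" for i j
    using m(2)[OF that(1)] n(2)[OF that(2)] that(3) by linarith
  then have e: "{(y, z). f y \<noteq> \<zero>\<^bsub>K\<^esub> \<and> g z \<noteq> \<zero>\<^bsub>K\<^esub> \<and> y \<otimes>\<^bsub>nat_monoid\<^esub> z = m + n} = {(m, n)}"
    using m(1) n(1) by auto
  have "(f \<otimes>\<^bsub>N.A\<^esub> g) (m + n) = f m \<otimes>\<^bsub>K\<^esub> g n"
    unfolding N.mult_eq e using N.value_in[OF f] N.value_in[OF g] by simp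
  moreover have "(f \<otimes>\<^bsub>N.A\<^esub> g) (m + n) = \<zero>\<^bsub>K\<^esub>" using fg by (simp add: N.zero_eq)
  ultimately show False
    using m(1) n(1) K.integral[of "f m" "g n"] N.value_in[OF f] N.value_in[OF g] by auto
qed

text \<open>A grading by the natural numbers in which the identity is the only element of degree zero. The
  element \<open>x\<close> of degree one makes the algebra infinite-dimensional.\<close>

locale graded_central_power = finite_over_power K M z B
  for K :: "('k, 'c) ring_scheme" and M :: "('m, 'e) monoid_scheme" and z B +
  fixes deg :: "'m \<Rightarrow> nat" and x :: 'm
  assumes deg_mult: "s \<in> carrier M \<Longrightarrow> t \<in> carrier M \<Longrightarrow> deg (s \<otimes>\<^bsub>M\<^esub> t) = deg s + deg t"
    and deg_eq_0: "s \<in> carrier M \<Longrightarrow> deg s = 0 \<longleftrightarrow> s = \<one>\<^bsub>M\<^esub>"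
    and x: "x \<in> carrier M" "deg x = 1"
    and z_deg: "deg z > 0"
begin

lemma deg_one [simp]: "deg \<one>\<^bsub>M\<^esub> = 0" using deg_eq_0 by simp

lemma deg_power: "s \<in> carrier M \<Longrightarrow> deg (s [^]\<^bsub>M\<^esub> (k::nat)) = k * deg s"
  by (induction k) (auto simp: deg_mult)

subsection \<open>Classical Krull dimension\<close>

text \<open>In degree zero there is only the identity, so the coefficient at the identity is a homomorphism
  to the base field.\<close>

lemma augmentation_prime: "nc_prime_ideal {f \<in> carrier A. f \<one>\<^bsub>M\<^esub> = \<zero>\<^bsub>K\<^esub>} A"
proof (rule A.nc_prime_kernel)
  show "(\<lambda>f. f \<one>\<^bsub>M\<^esub>) \<in> ring_hom A K"
  proof (rule ring_hom_memI)
    fix f g assume f: "f \<in> carrier A" and g: "g \<in> carrier A"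
    show "(f \<otimes>\<^bsub>A\<^esub> g) \<one>\<^bsub>M\<^esub> = f \<one>\<^bsub>M\<^esub> \<otimes>\<^bsub>K\<^esub> g \<one>\<^bsub>M\<^esub>"
    proof -
      let ?F = "insert \<one>\<^bsub>M\<^esub> (supp K f)" and ?G = "insert \<one>\<^bsub>M\<^esub> (supp K g)"
      have *: "s = \<one>\<^bsub>M\<^esub> \<and> t = \<one>\<^bsub>M\<^esub>" if "s \<in> ?F" "t \<in> ?G" "s \<otimes>\<^bsub>M\<^esub> t = \<one>\<^bsub>M\<^esub>" for s t
      proof -
        have c: "s \<in> carrier M" "t \<in> carrier M" using that supp_in[OF f] supp_in[OF g] by auto
        then have "deg s + deg t = 0" using deg_mult[OF c] that(3) by simp
        then show ?thesis using c deg_eq_0 by simp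
      qed
      have "p = (\<one>\<^bsub>M\<^esub>, \<one>\<^bsub>M\<^esub>)" if p: "p \<in> ?F \<times> ?G" "fst p \<otimes>\<^bsub>M\<^esub> snd p = \<one>\<^bsub>M\<^esub>" for p
        using *[OF _ _ p(2)] p(1) by (simp only: mem_Times_iff prod_eq_iff fst_conv snd_conv)
      then have e: "{p \<in> ?F \<times> ?G. fst p \<otimes>\<^bsub>M\<^esub> snd p = \<one>\<^bsub>M\<^esub>} = {(\<one>\<^bsub>M\<^esub>, \<one>\<^bsub>M\<^esub>)}"
        by (intro equalityI subsetI) simp_all
      have "(f \<otimes>\<^bsub>A\<^esub> g) \<one>\<^bsub>M\<^esub> =
          (\<Oplus>\<^bsub>K\<^esub>p\<in>{p \<in> ?F \<times> ?G. fst p \<otimes>\<^bsub>M\<^esub> snd p = \<one>\<^bsub>M\<^esub>}. f (fst p) \<otimes>\<^bsub>K\<^esub> g (snd p))"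
        using f g by (intro mult_on) auto
      then show ?thesis unfolding e using value_in[OF f] value_in[OF g] by simp
    qed
  next
    show "f \<one>\<^bsub>M\<^esub> \<in> carrier K" if "f \<in> carrier A" for f using that by (rule value_in)
  qed (auto simp: add_apply one_eq single_def)
  show "a = \<zero>\<^bsub>K\<^esub> \<or> b = \<zero>\<^bsub>K\<^esub>"
    if "a \<in> carrier K" "b \<in> carrier K" "a \<otimes>\<^bsub>K\<^esub> b = \<zero>\<^bsub>K\<^esub>" for a b
    using that K.integral by blast
qed (rule K.ring_axioms, rule K.one_not_zero)

text \<open>The homomorphism to the polynomials in one variable \<open>t\<close> that maps \<open>s\<close> to \<open>t\<close> to the power \<open>deg s\<close>.\<close>

definition total :: "('m \<Rightarrow> 'k) \<Rightarrow> nat \<Rightarrow> 'k" where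
  "total f d = (\<Oplus>\<^bsub>K\<^esub>s\<in>{s \<in> supp K f. deg s = d}. f s)"

lemma total_on:
  assumes "f \<in> carrier A" "finite F" "supp K f \<subseteq> F"
  shows "total f d = (\<Oplus>\<^bsub>K\<^esub>s\<in>{s \<in> F. deg s = d}. f s)"
  unfolding total_def using assms value_in[OF assms(1)] by (intro K.finsum_superset) (auto simp: supp_def)

lemma total_add:
  assumes f: "f \<in> carrier A" and g: "g \<in> carrier A"
  shows "total (f \<oplus>\<^bsub>A\<^esub> g) d = total f d \<oplus>\<^bsub>K\<^esub> total g d"
proof -
  let ?F = "supp K f \<union> supp K g"
  have F: "finite ?F" "supp K f \<subseteq> ?F" "supp K g \<subseteq> ?F" using f g by auto
  have s: "supp K (f \<oplus>\<^bsub>A\<^esub> g) \<subseteq> ?F" by (auto simp: supp_def add_apply)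
  have fg: "f \<oplus>\<^bsub>A\<^esub> g \<in> carrier A" using f g by simp
  show ?thesis
    unfolding total_on[OF f F(1,2)] total_on[OF g F(1,3)] total_on[OF fg F(1) s] add_apply
    using value_in[OF f] value_in[OF g] by (intro K.finsum_addf) auto
qed

lemma total_single: "c \<in> carrier K \<Longrightarrow> s \<in> carrier M \<Longrightarrow> total (single K c s) = single K c (deg s)"
proof
  fix d assume c: "c \<in> carrier K" and s: "s \<in> carrier M"
  have e: "{t \<in> {s}. deg t = d} = (if d = deg s then {s} else {})" by auto
  have "supp K (single K c s) \<subseteq> {s}" by (auto simp: supp_def single_def)
  from total_on[OF single_carrier[OF c s] _ this, of d]
  have t: "total (single K c s) d = (\<Oplus>\<^bsub>K\<^esub>t\<in>(if d = deg s then {s} else {}). single K c s t)"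
    unfolding e by simp
  have "single K c s s = c" by (simp add: single_def)
  then show "total (single K c s) d = single K c (deg s) d"
    unfolding t using c by (simp add: single_def[of K c "deg s"])
qed

lemma total_zero: "total \<zero>\<^bsub>A\<^esub> = (\<lambda>d. \<zero>\<^bsub>K\<^esub>)"
proof
  fix d
  have e: "{s \<in> supp K \<zero>\<^bsub>A\<^esub>. deg s = d} = {}" by (auto simp: supp_def zero_apply)
  show "total \<zero>\<^bsub>A\<^esub> d = \<zero>\<^bsub>K\<^esub>" unfolding total_def e by simp
qed

sublocale N: monoid_alg K nat_monoid
  by (intro monoid_alg.intro K.is_cring monoid_nat_monoid)

lemma total_add': "f \<in> carrier A \<Longrightarrow> g \<in> carrier A \<Longrightarrow> total (f \<oplus>\<^bsub>A\<^esub> g) = total f \<oplus>\<^bsub>N.A\<^esub> total g"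
  by (auto simp: fun_eq_iff total_add N.add_apply)

lemma total_carrier [simp]: "f \<in> carrier A \<Longrightarrow> total f \<in> carrier N.A"
proof (induction rule: single_induct)
  case zero
  show ?case unfolding total_zero N.zero_eq[symmetric] by simp
next
  case (add c s g)
  then show ?case by (simp add: total_add' total_single)
qed

lemma total_mult:
  assumes f: "f \<in> carrier A" and g: "g \<in> carrier A"
  shows "total (f \<otimes>\<^bsub>A\<^esub> g) = total f \<otimes>\<^bsub>N.A\<^esub> total g"
  using f
proof (induction rule: single_induct)
  have z: "total \<zero>\<^bsub>A\<^esub> = \<zero>\<^bsub>N.A\<^esub>" by (simp add: total_zero N.zero_eq)
  case zero
  show ?case using g by (simp add: z)
next
  have z: "total \<zero>\<^bsub>A\<^esub> = \<zero>\<^bsub>N.A\<^esub>" by (simp add: total_zero N.zero_eq)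
  case (add c s f)
  have "total (single K c s \<otimes>\<^bsub>A\<^esub> g) = total (single K c s) \<otimes>\<^bsub>N.A\<^esub> total g"
    using g
  proof (induction rule: single_induct)
    case zero
    show ?case using add by (simp add: z)
  next
    case g: (add d t g)
    then show ?case using add
      by (simp add: mult_r_distr total_add' single_mult_single total_single N.mult_r_distr
          N.single_mult_single deg_mult)
  qed
  then show ?case using add g by (simp add: mult_l_distr total_add' N.mult_l_distr)
qed

lemma degree_prime: "nc_prime_ideal {f \<in> carrier A. total f = \<zero>\<^bsub>N.A\<^esub>} A"
proof (rule A.nc_prime_kernel[OF N.ring_A])
  show "total \<in> ring_hom A N.A"
    by (rule ring_hom_memI) (auto simp: total_mult total_add' one_eq N.one_eq total_single)
  show "\<one>\<^bsub>N.A\<^esub> \<noteq> \<zero>\<^bsub>N.A\<^esub>"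
    using K.one_not_zero by (auto simp: N.one_eq N.zero_eq single_def fun_eq_iff)
qed (rule nat_monoid_algebra_domain[OF K.field_axioms])

text \<open>The kernel of \<open>total\<close> is properly contained in the kernel of the coefficient at the identity, as
  only the second contains \<open>x\<close>.\<close>

theorem clKdim_A: "clKdim A = 1"
proof -
  let ?P0 = "{f \<in> carrier A. total f = \<zero>\<^bsub>N.A\<^esub>}" and ?P1 = "{f \<in> carrier A. f \<one>\<^bsub>M\<^esub> = \<zero>\<^bsub>K\<^esub>}"
  have "f \<one>\<^bsub>M\<^esub> = \<zero>\<^bsub>K\<^esub>" if f: "f \<in> ?P0" for f
  proof -
    have fc: "f \<in> carrier A" using f by simp
    have "s = \<one>\<^bsub>M\<^esub>" if "s \<in> insert \<one>\<^bsub>M\<^esub> (supp K f)" "deg s = 0" for s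
      using that deg_eq_0 supp_in[OF fc] by auto
    then have e: "{s \<in> insert \<one>\<^bsub>M\<^esub> (supp K f). deg s = 0} = {\<one>\<^bsub>M\<^esub>}" by auto
    have "total f 0 = f \<one>\<^bsub>M\<^esub>"
      using total_on[OF fc, of "insert \<one>\<^bsub>M\<^esub> (supp K f)" 0] fc value_in[OF fc] unfolding e by auto
    then show ?thesis using f by (simp add: N.zero_eq)
  qed
  then have sub: "?P0 \<subseteq> ?P1" by auto
  have "single K \<one>\<^bsub>K\<^esub> x \<one>\<^bsub>M\<^esub> = \<zero>\<^bsub>K\<^esub>" using x by (auto simp: single_def)
  then have "single K \<one>\<^bsub>K\<^esub> x \<in> ?P1" using x by simp
  moreover have "single K \<one>\<^bsub>K\<^esub> x \<notin> ?P0"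
  proof
    assume "single K \<one>\<^bsub>K\<^esub> x \<in> ?P0"
    then have "single K \<one>\<^bsub>K\<^esub> (deg x) = \<zero>\<^bsub>N.A\<^esub>" using x by (simp add: total_single)
    from fun_cong[OF this, of "deg x"] show False by (simp add: single_def N.zero_apply)
  qed
  ultimately have "?P0 \<subset> ?P1" using sub by blast
  then have "\<exists>P :: nat \<Rightarrow> ('m \<Rightarrow> 'k) set. (\<forall>i\<le>1. nc_prime_ideal (P i) A) \<and> (\<forall>i<1. P i \<subset> P (Suc i))"
    using degree_prime augmentation_prime
    by (intro exI[of _ "\<lambda>i. if i = 0 then ?P0 else ?P1"]) auto
  then have "1 \<le> clKdim A"
    unfolding clKdim_def by (intro Sup_upper CollectI exI[of _ 1]) simp
  moreover have "clKdim A \<le> 1"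
    unfolding clKdim_def
  proof (rule Sup_least, safe)
    fix m and P :: "nat \<Rightarrow> ('m \<Rightarrow> 'k) set"
    assume P: "\<forall>i\<le>m. nc_prime_ideal (P i) A" "\<forall>i<m. P i \<subset> P (Suc i)"
    have "m \<le> 1"
    proof (rule ccontr)
      assume "\<not> m \<le> 1"
      then show False
        using no_long_prime_chain[of "P 0" "P 1" "P 2"] P
        by (auto simp: numeral_2_eq_2)
    qed
    then show "ereal (real m) \<le> 1" by (simp add: one_ereal_def)
  qed
  ultimately show ?thesis by (rule antisym[rotated])
qed

subsection \<open>Gelfand-Kirillov dimension\<close>

abbreviation F where "F \<equiv> scalars K A"

lemma scalar_mult: "c \<in> carrier K \<Longrightarrow> f \<in> carrier A \<Longrightarrow> (c \<odot>\<^bsub>A\<^esub> \<one>\<^bsub>A\<^esub>) \<otimes>\<^bsub>A\<^esub> f = c \<odot>\<^bsub>A\<^esub> f"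
  by (simp add: smult_mult_l)

lemma subfield_F: "subfield F A"
proof -
  have nz: "\<one>\<^bsub>A\<^esub> \<noteq> \<zero>\<^bsub>A\<^esub>"
    using K.one_not_zero by (auto simp: one_eq zero_eq single_def fun_eq_iff)
  have "ring_hom_ring K A (\<lambda>c. c \<odot>\<^bsub>A\<^esub> \<one>\<^bsub>A\<^esub>)"
    by (intro ring_hom_ringI2 K.ring_axioms ring_A ring_hom_memI)
       (auto simp: A.smult_l_distr A.smult_assoc1 scalar_mult)
  from ring_hom_ring.img_is_subfield(2)[OF this K.carrier_is_subfield nz]
  show ?thesis by (simp add: scalars_def)
qed

lemma submodule_iff_subalgebra: "submodule V K A \<longleftrightarrow> subalgebra F V A"
proof
  assume V: "submodule V K A"
  then show "subalgebra F V A"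
    using A.submodule_closed(1,6)[OF V] scalar_mult
    by (intro subalgebra.intro subalgebra_axioms.intro)
       (auto simp: scalars_def submodule.axioms(1) subset_iff)
next
  assume V: "subalgebra F V A"
  have "V \<subseteq> carrier A" using subgroup.subset[OF subalgebra.axioms(1)[OF V]] by simp
  show "submodule V K A"
  proof (intro submodule.intro submodule_axioms.intro subalgebra.axioms(1)[OF V])
    fix c f assume c: "c \<in> carrier K" and f: "f \<in> V"
    have "c \<odot>\<^bsub>A\<^esub> \<one>\<^bsub>A\<^esub> \<in> F" using c by (auto simp: scalars_def)
    from subalgebra.smult_closed[OF V this f] show "c \<odot>\<^bsub>A\<^esub> f \<in> V"
      using scalar_mult[OF c] f \<open>V \<subseteq> carrier A\<close> by auto
  qed
qed

lemma dimension_supported: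
  assumes "finite X" "X \<subseteq> carrier M"
  shows "A.dimension (card X) F (supported X)"
  using assms
proof (induction X)
  case empty
  have "supported {} = {\<zero>\<^bsub>A\<^esub>}"
    using supported_zero by (auto simp: supported_def supp_def zero_eq)
  then show ?case by (simp add: A.zero_dim)
next
  case (insert s X)
  let ?e = "single K \<one>\<^bsub>K\<^esub> s"
  have s: "s \<in> carrier M" using insert by simp
  have "A.line_extension F ?e (supported X) = supported (insert s X)"
  proof (intro equalityI subsetI)
    fix f assume "f \<in> A.line_extension F ?e (supported X)"
    then obtain c v where f: "f = (c \<odot>\<^bsub>A\<^esub> \<one>\<^bsub>A\<^esub>) \<otimes>\<^bsub>A\<^esub> ?e \<oplus>\<^bsub>A\<^esub> v" "c \<in> carrier K" "v \<in> supported X"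
      by (auto simp: A.line_extension_mem_iff scalars_def)
    have "v \<in> supported (insert s X)" using f(3) supported_mono[of X "insert s X"] by auto
    moreover have "c \<odot>\<^bsub>A\<^esub> ?e \<in> supported (insert s X)"
      using f(2) s by (intro supported_smult supported_single) auto
    ultimately show "f \<in> supported (insert s X)"
      using f s by (simp add: scalar_mult supported_add)
  next
    fix f assume f: "f \<in> supported (insert s X)"
    note fD = supportedD[OF f]
    note fv = value_in[OF fD(1)]
    let ?g = "f(s := \<zero>\<^bsub>K\<^esub>)"
    have "?g \<in> carrier A"
      using fD(1) fv supp_in[OF fD(1)] by (intro carrierI[of _ "supp K f"]) (auto simp: outside_supp)
    moreover have "supp K ?g \<subseteq> X" using fD(2) by (auto simp: supp_def)
    ultimately have g: "?g \<in> supported X" by (simp add: supported_def)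
    have "f = f s \<odot>\<^bsub>A\<^esub> ?e \<oplus>\<^bsub>A\<^esub> ?g"
      using fv by (auto simp: fun_eq_iff add_apply smult_apply single_def)
    then have "f = (f s \<odot>\<^bsub>A\<^esub> \<one>\<^bsub>A\<^esub>) \<otimes>\<^bsub>A\<^esub> ?e \<oplus>\<^bsub>A\<^esub> ?g"
      using fv s by (simp add: scalar_mult)
    then show "f \<in> A.line_extension F ?e (supported X)"
      using g fv unfolding A.line_extension_mem_iff scalars_def by blast
  qed
  moreover have "?e \<notin> supported X"
    using insert.hyps(2) K.one_not_zero by (auto simp: supported_def supp_def single_def)
  ultimately show ?case
    using A.Suc_dim[of ?e "supported X" "card X" F] insert s by simp
qed

definition upto :: "nat \<Rightarrow> 'm set" where "upto d = {s \<in> carrier M. deg s \<le> d}"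

text \<open>Since \<open>z\<close> has positive degree, an element of degree at most \<open>d\<close> is the product of one of the powers
  \<open>z\<^sup>0, \<dots>, z\<^sup>d\<close> with an element of \<open>B\<close>. This linear bound is the source of the dimension one.\<close>

lemma card_upto: "finite (upto d)" "card (upto d) \<le> Suc d * card B"
proof -
  have sub: "upto d \<subseteq> (\<lambda>(k, b). z [^]\<^bsub>M\<^esub> k \<otimes>\<^bsub>M\<^esub> b) ` ({..d} \<times> B)"
  proof
    fix s assume s: "s \<in> upto d"
    then obtain k b where kb: "b \<in> B" "s = z [^]\<^bsub>M\<^esub> (k::nat) \<otimes>\<^bsub>M\<^esub> b"
      using B_gen[of s] by (auto simp: upto_def)
    have "b \<in> carrier M" using kb B(2) by auto
    then have "k * deg z + deg b \<le> d" using s kb by (simp add: upto_def deg_mult deg_power)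
    moreover have "k \<le> k * deg z" using z_deg by simp
    ultimately have "k \<le> d" by linarith
    then show "s \<in> (\<lambda>(k, b). z [^]\<^bsub>M\<^esub> k \<otimes>\<^bsub>M\<^esub> b) ` ({..d} \<times> B)" using kb by force
  qed
  have fin: "finite ({..d} \<times> B)" using B by simp
  show "finite (upto d)" using finite_subset[OF sub] fin by simp
  have "card (upto d) \<le> card ({..d} \<times> B)"
    using card_mono[OF finite_imageI[OF fin] sub] card_image_le[OF fin] le_trans by blast
  then show "card (upto d) \<le> Suc d * card B" by (simp add: card_cartesian_product)
qed

lemma upto_carrier: "upto d \<subseteq> carrier M" by (auto simp: upto_def)

lemma one_upto: "\<one>\<^bsub>M\<^esub> \<in> upto d" by (simp add: upto_def)

lemma scalars_supported: "F \<subseteq> supported (upto d)"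
  using one_upto by (auto simp: scalars_def one_eq intro!: supported_smult supported_single)

lemma finite_dimension_bounded:
  assumes V: "A.finite_dimension F V"
  shows "\<exists>q. V \<subseteq> supported (upto q)"
proof -
  obtain n where "A.dimension n F V" using V by auto
  then obtain Us where Us: "set Us \<subseteq> carrier A" "A.Span F Us = V"
    using A.exists_base[OF subfield_F] by blast
  define q where "q = Max (insert 0 (deg ` (\<Union>u\<in>set Us. supp K u)))"
  have "set Us \<subseteq> supported (upto q)"
  proof
    fix u assume u: "u \<in> set Us"
    have "deg s \<le> q" if "s \<in> supp K u" for s
      unfolding q_def using Us(1) u that by (intro Max_ge) (auto simp: subset_iff)
    then show "u \<in> supported (upto q)"
      using Us(1) u supp_in[of u] by (auto simp: supported_def upto_def)
  qed
  then have "A.Span F Us \<subseteq> supported (upto q)"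
    using supported_submodule submodule_iff_subalgebra by (intro A.subalgebra_Span_incl[OF subfield_F]) auto
  then show ?thesis using Us by blast
qed

lemma ideal_prod_submodule:
  assumes V: "submodule V K A" and W: "submodule W K A"
  shows "submodule (V \<cdot>\<^bsub>A\<^esub> W) K A"
proof (intro A.submoduleI)
  note VD = A.submodule_closed[OF V] and WD = A.submodule_closed[OF W]
  show sub: "V \<cdot>\<^bsub>A\<^esub> W \<subseteq> carrier A"
  proof
    fix f assume "f \<in> V \<cdot>\<^bsub>A\<^esub> W"
    then show "f \<in> carrier A"
    proof induction
      case (prod i j)
      then show ?case using VD(1) WD(1) by (intro mult_carrier) auto
    qed (rule add_carrier)
  qed
  show "\<zero>\<^bsub>A\<^esub> \<in> V \<cdot>\<^bsub>A\<^esub> W" using ideal_prod.prod[OF VD(2) WD(2), of A] by simp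
  show sm: "c \<odot>\<^bsub>A\<^esub> f \<in> V \<cdot>\<^bsub>A\<^esub> W" if c: "c \<in> carrier K" and f: "f \<in> V \<cdot>\<^bsub>A\<^esub> W" for c f
    using f
  proof induction
    case (prod i j)
    then have "c \<odot>\<^bsub>A\<^esub> (i \<otimes>\<^bsub>A\<^esub> j) = (c \<odot>\<^bsub>A\<^esub> i) \<otimes>\<^bsub>A\<^esub> j"
      using c VD(1) WD(1) by (simp add: smult_mult_l subset_iff)
    then show ?case using ideal_prod.prod[OF VD(6)[OF c prod(1)] prod(2), of A] by simp
  next
    case (sum s t)
    then have "s \<in> carrier A" "t \<in> carrier A" using sub by blast+
    then show ?case using ideal_prod.sum[OF sum(3,4)] c by (simp add: A.smult_r_distr)
  qed
  show "\<ominus>\<^bsub>A\<^esub> f \<in> V \<cdot>\<^bsub>A\<^esub> W" if f: "f \<in> V \<cdot>\<^bsub>A\<^esub> W" for f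
    using sm[of "\<ominus>\<^bsub>K\<^esub> \<one>\<^bsub>K\<^esub>" f] f sub by (auto simp: A.smult_l_minus)
qed (rule ideal_prod.sum)

lemma filtration_submodule:
  assumes V: "submodule V K A"
  shows "submodule (subspace_power K A V m) K A" "submodule (subspace_filtration K A V m) K A"
proof -
  have s: "submodule F K A"
    using A.finite_dimension_imp_subalgebra[OF subfield_F A.finite_dimensionI[OF A.dimension_one[OF subfield_F]]]
    by (simp add: submodule_iff_subalgebra)
  show p: "submodule (subspace_power K A V m) K A" for m
    by (induction m) (auto simp: s ideal_prod_submodule V)
  show "submodule (subspace_filtration K A V m) K A"
    by (induction m) (auto simp: s A.set_add_submodule p simp del: subspace_power.simps)
qed

text \<open>Degrees are additive, so the \<open>m\<close>-th power of a subspace in degrees up to \<open>q\<close> lives in degrees up to \<open>m q\<close>.\<close>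

lemma filtration_bounded:
  assumes V: "V \<subseteq> supported (upto q)"
  shows "subspace_power K A V m \<subseteq> supported (upto (m * q))"
    "subspace_filtration K A V m \<subseteq> supported (upto (m * q))"
proof -
  have mono: "upto d \<subseteq> upto e" if "d \<le> e" for d e using that by (auto simp: upto_def)
  show p: "subspace_power K A V m \<subseteq> supported (upto (m * q))" for m
  proof (induction m)
    case 0
    show ?case using scalars_supported by simp
  next
    case (Suc m)
    show ?case
    proof
      fix f assume "f \<in> subspace_power K A V (Suc m)"
      then have "f \<in> subspace_power K A V m \<cdot>\<^bsub>A\<^esub> V" by simp
      then show "f \<in> supported (upto (Suc m * q))"
      proof induction
        case (prod i j)
        then show ?case
          using Suc V
          by (intro supported_mult[of i "upto (m * q)" j "upto q"]) (auto simp: upto_def deg_mult)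
      qed (rule supported_add)
    qed
  qed
  show "subspace_filtration K A V m \<subseteq> supported (upto (m * q))"
  proof (induction m)
    case 0
    show ?case using scalars_supported by simp
  next
    case (Suc m)
    have "subspace_filtration K A V m \<subseteq> supported (upto (Suc m * q))"
      using Suc supported_mono[OF mono[of "m * q" "Suc m * q"]] by auto
    then show ?case using p[of "Suc m"]
      by (auto simp: set_add_def' simp del: subspace_power.simps intro!: supported_add)
  qed
qed

lemma filtration_dim:
  assumes V: "A.finite_dimension F V" "V \<subseteq> supported (upto q)"
  shows "A.finite_dimension F (subspace_filtration K A V m)"
    "A.dim F (subspace_filtration K A V m) \<le> Suc (m * q) * card B"
proof -
  let ?E = "subspace_filtration K A V m"
  have dimU: "A.dimension (card (upto (m * q))) F (supported (upto (m * q)))"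
    by (intro dimension_supported card_upto upto_carrier)
  have "submodule V K A"
    using A.finite_dimension_imp_subalgebra[OF subfield_F V(1)] submodule_iff_subalgebra by simp
  then have "subalgebra F ?E A" using filtration_submodule submodule_iff_subalgebra by simp
  then show fin: "A.finite_dimension F ?E"
    using A.subalbegra_incl_imp_finite_dimension[OF subfield_F A.finite_dimensionI[OF dimU]]
      filtration_bounded(2)[OF V(2)] by blast
  then have dE: "A.dimension (A.dim F ?E) F ?E"
    using A.finite_dimensionE[OF subfield_F fin] by (simp add: over_def)
  obtain Us where Us: "A.independent F Us" "length Us = A.dim F ?E" "A.Span F Us = ?E" "set Us \<subseteq> carrier A"
    using A.exists_base[OF subfield_F dE] by blast
  have "set Us \<subseteq> supported (upto (m * q))"
    using A.Span_base_incl[OF subfield_F Us(4)] Us(3) filtration_bounded(2)[OF V(2)] by blast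
  from A.independent_length_le_dimension[OF subfield_F dimU Us(1) this]
  show "A.dim F ?E \<le> Suc (m * q) * card B" using Us(2) card_upto(2)[of "m * q"] by simp
qed

lemma log_linear_tendsto: 
  fixes C :: real assumes C: "C > 0"
  shows "(\<lambda>m. ereal (log (real m) (C * real m))) \<longlonglongrightarrow> 1"
proof -
  have "(\<lambda>m. ln C / ln (real m) + 1) \<longlonglongrightarrow> 0 + 1"
    by (intro tendsto_add tendsto_const tendsto_divide_0[OF tendsto_const]
        filterlim_at_top_imp_at_infinity filterlim_compose[OF ln_at_top filterlim_real_sequentially])
  moreover have "eventually (\<lambda>m. ln C / ln (real m) + 1 = log (real m) (C * real m)) sequentially"
    using eventually_ge_at_top[of "2::nat"]
  proof eventually_elim
    case (elim m)
    then show ?case using C by (simp add: log_def ln_mult add_divide_distrib)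
  qed
  ultimately have "(\<lambda>m. log (real m) (C * real m)) \<longlonglongrightarrow> 1"
    using Lim_transform_eventually by fastforce
  then show ?thesis by (simp add: one_ereal_def)
qed

text \<open>The dimension of the filtration is at most \<open>C m\<close> with \<open>C\<close> independent of \<open>m\<close>.\<close>

lemma growth_upper_bound:
  assumes V: "A.finite_dimension F V"
  shows "limsup (\<lambda>m. ereal (log (real m) (real (A.dim F (subspace_filtration K A V m))))) \<le> 1"
proof -
  obtain q where q: "V \<subseteq> supported (upto q)" using finite_dimension_bounded[OF V] by blast
  define C where "C = real (Suc q * card B)"
  have "Suc q * card B \<ge> 1" using r_pos by simp
  then have C1: "C \<ge> 1" unfolding C_def by linarith
  have "eventually (\<lambda>m. ereal (log (real m) (real (A.dim F (subspace_filtration K A V m))))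
      \<le> ereal (log (real m) (C * real m))) sequentially"
    using eventually_ge_at_top[of "2::nat"]
  proof eventually_elim
    case (elim m)
    let ?d = "A.dim F (subspace_filtration K A V m)"
    have "?d \<le> Suc (m * q) * card B" by (rule filtration_dim[OF V q])
    also have "\<dots> \<le> (Suc q * m) * card B" using elim by (intro mult_right_mono) auto
    finally have "real ?d \<le> real ((Suc q * m) * card B)" by (simp only: of_nat_le_iff)
    then have le: "real ?d \<le> C * real m" unfolding C_def by (simp add: algebra_simps)
    show ?case
    (* The logarithm of zero is zero by convention, so this case is bounded separately. *)
    proof (cases "?d = 0")
      case True
      have "C * real m \<ge> 1" using mult_mono[of 1 C 1 "real m"] C1 elim by simp
      then show ?thesis using True elim by (simp add: log_def)
    next
      case False
      then show ?thesis using le elim C1 by (simp add: log_le_cancel_iff)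
    qed
  qed
  then have "limsup (\<lambda>m. ereal (log (real m) (real (A.dim F (subspace_filtration K A V m)))))
      \<le> limsup (\<lambda>m. ereal (log (real m) (C * real m)))"
    by (rule Limsup_mono)
  also have "\<dots> = 1" using C1 by (intro lim_imp_Limsup log_linear_tendsto) auto
  finally show ?thesis .
qed

text \<open>The powers \<open>x\<^sup>0, \<dots>, x\<^sup>m\<close> lie in the filtration and are independent, having different degrees.\<close>

lemma growth_lower_bound:
  defines "V \<equiv> supported {x}"
  shows "A.finite_dimension F V"
    "1 \<le> limsup (\<lambda>m. ereal (log (real m) (real (A.dim F (subspace_filtration K A V m)))))"
proof -
  show V: "A.finite_dimension F V"
    unfolding V_def using dimension_supported[of "{x}"] x by (intro A.finite_dimensionI) auto
  have Vs: "submodule V K A" unfolding V_def by (rule supported_submodule)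
  have pw: "single K \<one>\<^bsub>K\<^esub> (x [^]\<^bsub>M\<^esub> k) \<in> subspace_power K A V k" for k :: nat
  proof (induction k)
    case 0
    have "\<one>\<^bsub>A\<^esub> = \<one>\<^bsub>K\<^esub> \<odot>\<^bsub>A\<^esub> \<one>\<^bsub>A\<^esub>" by simp
    then have "\<one>\<^bsub>A\<^esub> \<in> F" unfolding scalars_def using K.one_closed by (rule image_eqI)
    then show ?case unfolding one_eq[symmetric] M.nat_pow_0 by simp
  next
    case (Suc k)
    have "single K \<one>\<^bsub>K\<^esub> x \<in> V" unfolding V_def using x by (intro supported_single) auto
    from ideal_prod.prod[OF Suc this, of A] show ?case using x by (simp add: single_mult_single)
  qed
  have zero_in: "\<zero>\<^bsub>A\<^esub> \<in> subspace_power K A V k" "\<zero>\<^bsub>A\<^esub> \<in> subspace_filtration K A V k" for k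
    by (rule A.submodule_closed(2)[OF filtration_submodule(1)[OF Vs]],
        rule A.submodule_closed(2)[OF filtration_submodule(2)[OF Vs]])
  have cF: "subspace_filtration K A V k \<subseteq> carrier A" and cP: "subspace_power K A V k \<subseteq> carrier A" for k
    by (rule A.submodule_closed(1)[OF filtration_submodule(2)[OF Vs]],
        rule A.submodule_closed(1)[OF filtration_submodule(1)[OF Vs]])
  have fl: "single K \<one>\<^bsub>K\<^esub> (x [^]\<^bsub>M\<^esub> k) \<in> subspace_filtration K A V m" if "k \<le> m" for k m :: nat
    using that
  proof (induction m)
    case 0 then show ?case using pw[of 0] by simp
  next
    case (Suc m)
    have e: "single K \<one>\<^bsub>K\<^esub> (x [^]\<^bsub>M\<^esub> k) \<in> carrier A" using x by simp
    show ?case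
    proof (cases "k = Suc m")
      case True
      then have "\<zero>\<^bsub>A\<^esub> \<oplus>\<^bsub>A\<^esub> single K \<one>\<^bsub>K\<^esub> (x [^]\<^bsub>M\<^esub> k) \<in> subspace_filtration K A V (Suc m)"
        using zero_in(2)[of m] pw[of k] unfolding subspace_filtration.simps set_add_def' by blast
      then show ?thesis using e by simp
    next
      case False
      then have "single K \<one>\<^bsub>K\<^esub> (x [^]\<^bsub>M\<^esub> k) \<in> subspace_filtration K A V m" using Suc by simp
      then have "single K \<one>\<^bsub>K\<^esub> (x [^]\<^bsub>M\<^esub> k) \<oplus>\<^bsub>A\<^esub> \<zero>\<^bsub>A\<^esub> \<in> subspace_filtration K A V (Suc m)"
        using zero_in(1)[of "Suc m"] unfolding subspace_filtration.simps set_add_def' by blast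
      then show ?thesis using e by simp
    qed
  qed
  have dim: "Suc m \<le> A.dim F (subspace_filtration K A V m)" for m
  proof -
    let ?X = "(\<lambda>k. x [^]\<^bsub>M\<^esub> k) ` {..m}" and ?E = "subspace_filtration K A V m"
    have "inj_on (\<lambda>k::nat. x [^]\<^bsub>M\<^esub> k) {..m}"
      using x by (intro inj_onI) (metis deg_power mult.right_neutral)
    then have "card ?X = Suc m" by (simp add: card_image)
    moreover have "A.dimension (card ?X) F (supported ?X)" using x by (intro dimension_supported) auto
    ultimately have "A.dimension (Suc m) F (supported ?X)" by simp
    then obtain Us where Us: "A.independent F Us" "length Us = Suc m" "A.Span F Us = supported ?X" "set Us \<subseteq> carrier A"
      using A.exists_base[OF subfield_F] by blast
    obtain q where q: "V \<subseteq> supported (upto q)" using finite_dimension_bounded[OF V] by blast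
    have "A.dimension (A.dim F ?E) F ?E"
      using A.finite_dimensionE[OF subfield_F filtration_dim(1)[OF V q]] by (simp add: over_def)
    moreover have "supported ?X \<subseteq> ?E"
      using fl by (intro supported_least filtration_submodule Vs) auto
    then have "set Us \<subseteq> ?E" using A.Span_base_incl[OF subfield_F Us(4)] Us(3) by blast
    ultimately show ?thesis
      using A.independent_length_le_dimension[OF subfield_F _ Us(1)] Us(2) by metis
  qed
  have "eventually (\<lambda>m. 1 \<le> ereal (log (real m) (real (A.dim F (subspace_filtration K A V m))))) sequentially"
    using eventually_ge_at_top[of "2::nat"]
  proof eventually_elim
    case (elim m)
    have "log (real m) (real m) \<le> log (real m) (real (A.dim F (subspace_filtration K A V m)))"
      using dim[of m] elim by (subst log_le_cancel_iff) auto
    then show ?case using elim by (simp add: one_ereal_def)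
  qed
  then show "1 \<le> limsup (\<lambda>m. ereal (log (real m) (real (A.dim F (subspace_filtration K A V m)))))"
    by (intro le_Limsup) auto
qed

theorem GKdim_A: "GKdim K A = 1"
  unfolding GKdim_def
proof (rule antisym)
  show "(SUP V\<in>{V. A.finite_dimension F V}. limsup (\<lambda>m. ereal (log (real m) (real (A.dim F (subspace_filtration K A V m)))))) \<le> 1"
    using growth_upper_bound by (intro SUP_least) auto
  show "1 \<le> (SUP V\<in>{V. A.finite_dimension F V}. limsup (\<lambda>m. ereal (log (real m) (real (A.dim F (subspace_filtration K A V m))))))"
    using growth_lower_bound by (intro SUP_upper2[of "supported {x}"]) auto
qed

end

section \<open>Principal ideals in group algebras of finite-by-cyclic groups\<close>

lemma (in abelian_group) diff_diff_diff:
  assumes "x \<in> carrier G" "y \<in> carrier G" "z \<in> carrier G"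
  shows "(x \<ominus> z) \<ominus> (x \<ominus> y) = y \<ominus> z"
proof -
  have "(x \<oplus> \<ominus> z) \<oplus> (\<ominus> x \<oplus> y) = (x \<oplus> \<ominus> x) \<oplus> (y \<oplus> \<ominus> z)"
    using assms by (simp only: a_ac a_inv_closed a_closed)
  then show ?thesis using assms by (simp add: a_minus_def minus_add r_neg)
qed

text \<open>An extension of the infinite cyclic group by a finite abelian group whose order is invertible in
  \<open>K\<close>. Its group algebra is a crossed product: elements supported on the kernel \<open>N\<close> are the
  coefficients, and powers of the unit \<open>x\<close> move between the degrees.\<close>

locale finite_by_cyclic = monoid_alg K M + K: field K + M: group M
  for K :: "('k, 'c) ring_scheme" and M :: "('m, 'e) monoid_scheme" +
  fixes deg :: "'m \<Rightarrow> int" and x :: 'm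
  assumes deg_mult: "s \<in> carrier M \<Longrightarrow> t \<in> carrier M \<Longrightarrow> deg (s \<otimes>\<^bsub>M\<^esub> t) = deg s + deg t"
    and x [simp]: "x \<in> carrier M" and deg_x: "deg x = 1"
    and kernel_finite: "finite {s \<in> carrier M. deg s = 0}"
    and kernel_comm: "s \<in> carrier M \<Longrightarrow> t \<in> carrier M \<Longrightarrow> deg s = 0 \<Longrightarrow> deg t = 0 \<Longrightarrow>
      s \<otimes>\<^bsub>M\<^esub> t = t \<otimes>\<^bsub>M\<^esub> s"
    and kernel_invertible: "[card {s \<in> carrier M. deg s = 0}] \<cdot>\<^bsub>K\<^esub> \<one>\<^bsub>K\<^esub> \<noteq> \<zero>\<^bsub>K\<^esub>"
begin

definition N :: "'m set" where "N = {s \<in> carrier M. deg s = 0}"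

abbreviation e where "e s \<equiv> single K \<one>\<^bsub>K\<^esub> s"

lemma e_mult: "s \<in> carrier M \<Longrightarrow> t \<in> carrier M \<Longrightarrow> e s \<otimes>\<^bsub>A\<^esub> e t = e (s \<otimes>\<^bsub>M\<^esub> t)"
  by (simp add: single_mult_single)

lemma e_one: "e \<one>\<^bsub>M\<^esub> = \<one>\<^bsub>A\<^esub>" by (simp add: one_eq)

lemma deg_one [simp]: "deg \<one>\<^bsub>M\<^esub> = 0"
  using deg_mult[of "\<one>\<^bsub>M\<^esub>" "\<one>\<^bsub>M\<^esub>"] by simp

lemma deg_inv: "s \<in> carrier M \<Longrightarrow> deg (inv\<^bsub>M\<^esub> s) = - deg s"
  using deg_mult[of "inv\<^bsub>M\<^esub> s" s] by (simp add: M.l_inv)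

lemma N_carrier: "s \<in> N \<Longrightarrow> s \<in> carrier M" and N_finite: "finite N" and N_one: "\<one>\<^bsub>M\<^esub> \<in> N"
  and N_mult: "s \<in> N \<Longrightarrow> t \<in> N \<Longrightarrow> s \<otimes>\<^bsub>M\<^esub> t \<in> N" and N_inv: "s \<in> N \<Longrightarrow> inv\<^bsub>M\<^esub> s \<in> N"
  using kernel_finite by (auto simp: N_def deg_mult deg_inv)

lemma supported_N_mult: "f \<in> supported N \<Longrightarrow> g \<in> supported N \<Longrightarrow> f \<otimes>\<^bsub>A\<^esub> g \<in> supported N"
  by (rule supported_mult) (auto simp: N_mult)

lemma supported_N_comm:
  assumes f: "f \<in> supported N" and g: "g \<in> supported N"
  shows "f \<otimes>\<^bsub>A\<^esub> g = g \<otimes>\<^bsub>A\<^esub> f"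
  using supportedD(1)[OF f]
proof (induction rule: single_induct)
  case zero then show ?case using supportedD(1)[OF g] by simp
next
  case f': (add c s h)
  have s: "s \<in> N" using f' supportedD(2)[OF f] by blast
  have "single K c s \<otimes>\<^bsub>A\<^esub> g = g \<otimes>\<^bsub>A\<^esub> single K c s"
    using supportedD(1)[OF g]
  proof (induction rule: single_induct)
    case zero then show ?case using f' by simp
  next
    case g': (add d t k)
    have "t \<in> N" using g' supportedD(2)[OF g] by blast
    then have "s \<otimes>\<^bsub>M\<^esub> t = t \<otimes>\<^bsub>M\<^esub> s" using s kernel_comm by (simp add: N_def)
    then show ?case using f' g'
      by (simp add: mult_l_distr mult_r_distr single_mult_single K.m_comm)
  qed
  then show ?case using f' supportedD(1)[OF g] by (simp add: mult_l_distr mult_r_distr)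
qed

subsection \<open>Maschke's theorem\<close>

text \<open>A subspace of a coordinate space has a complement spanned by coordinates: take a maximal set
  \<open>Y\<close> of coordinates whose span meets \<open>L\<close> trivially. Adding one more coordinate \<open>s\<close> to \<open>Y\<close> creates an element
  of \<open>L\<close> with nonzero coefficient at \<open>s\<close>, which expresses the basis vector \<open>s\<close> modulo \<open>L\<close> by coordinates
  in \<open>Y\<close>.\<close>

lemma coordinate_complement:
  assumes X: "finite X" "X \<subseteq> carrier M" and L: "submodule L K A"
  shows "\<exists>Y\<subseteq>X. L \<inter> supported Y = {\<zero>\<^bsub>A\<^esub>} \<and> supported X \<subseteq> L <+>\<^bsub>A\<^esub> supported Y"
proof -
  note LD = A.submodule_closed[OF L]
  define YY where "YY = {Y. Y \<subseteq> X \<and> L \<inter> supported Y = {\<zero>\<^bsub>A\<^esub>}}"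
  have "supported {} = {\<zero>\<^bsub>A\<^esub>}" using supported_zero by (auto simp: supported_def supp_def zero_eq)
  then have "{} \<in> YY" using LD(2) by (auto simp: YY_def)
  moreover have "finite YY" using X(1) by (auto simp: YY_def intro: finite_subset[of _ "Pow X"])
  ultimately obtain Y where Y: "Y \<in> YY" and max: "\<And>Z. Z \<in> YY \<Longrightarrow> Y \<subseteq> Z \<Longrightarrow> Z = Y"
    using finite_has_maximal[of YY] by (metis empty_iff)
  have YX: "Y \<subseteq> X" and Y0: "L \<inter> supported Y = {\<zero>\<^bsub>A\<^esub>}" using Y by (auto simp: YY_def)
  let ?S = "L <+>\<^bsub>A\<^esub> supported Y"
  have S: "submodule ?S K A" by (intro A.set_add_submodule L supported_submodule)
  note SD = A.submodule_closed[OF S]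
  have in1: "f \<in> ?S" if "f \<in> L" for f
  proof -
    have "f \<oplus>\<^bsub>A\<^esub> \<zero>\<^bsub>A\<^esub> \<in> ?S" using that supported_zero unfolding set_add_def' by blast
    moreover have "f \<in> carrier A" using that LD(1) by blast
    ultimately show ?thesis by simp
  qed
  have in2: "f \<in> ?S" if "f \<in> supported Y" for f
  proof -
    have "\<zero>\<^bsub>A\<^esub> \<oplus>\<^bsub>A\<^esub> f \<in> ?S" using that LD(2) unfolding set_add_def' by blast
    then show ?thesis using supportedD(1)[OF that] by simp
  qed
  have "e s \<in> ?S" if s: "s \<in> X" for s
  proof (cases "s \<in> Y")
    case True
    then show ?thesis using in2[OF supported_single] s X by auto
  next
    case False
    have sc: "s \<in> carrier M" using s X by auto
    have "insert s Y \<notin> YY" using max[of "insert s Y"] False by auto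
    then have "L \<inter> supported (insert s Y) \<noteq> {\<zero>\<^bsub>A\<^esub>}" using YX s by (auto simp: YY_def)
    moreover have "\<zero>\<^bsub>A\<^esub> \<in> L \<inter> supported (insert s Y)" using LD(2) supported_zero by simp
    ultimately obtain f where f: "f \<in> L" "f \<in> supported (insert s Y)" "f \<noteq> \<zero>\<^bsub>A\<^esub>" by blast
    note fc = supportedD(1)[OF f(2)]
    let ?g = "f(s := \<zero>\<^bsub>K\<^esub>)"
    have "?g \<in> carrier A" using fc value_in[OF fc] supp_in[OF fc]
      by (intro carrierI[of _ "supp K f"]) (auto simp: outside_supp)
    moreover have "supp K ?g \<subseteq> Y" using supportedD(2)[OF f(2)] by (auto simp: supp_def)
    ultimately have g: "?g \<in> supported Y" by (simp add: supported_def)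
    have fs: "f s \<noteq> \<zero>\<^bsub>K\<^esub>"
    proof
      assume "f s = \<zero>\<^bsub>K\<^esub>"
      then have "?g = f" by (simp add: fun_upd_idem)
      with g f Y0 show False by auto
    qed
    have eq: "f \<ominus>\<^bsub>A\<^esub> ?g = f s \<odot>\<^bsub>A\<^esub> e s"
    proof -
      have "f = ?g \<oplus>\<^bsub>A\<^esub> f s \<odot>\<^bsub>A\<^esub> e s"
        using value_in[OF fc] by (auto simp: fun_eq_iff add_apply smult_apply single_def)
      then show ?thesis
        using A.add_diff_cancel(1)[of ?g "f s \<odot>\<^bsub>A\<^esub> e s"] supportedD(1)[OF g] value_in[OF fc] sc by simp
    qed
    have "f s \<odot>\<^bsub>A\<^esub> e s \<in> ?S" using SD(4)[OF in1[OF f(1)] in2[OF g]] unfolding eq .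
    moreover have "f s \<in> Units K" using fs value_in[OF fc] by (simp add: K.field_Units)
    ultimately have "inv\<^bsub>K\<^esub> f s \<odot>\<^bsub>A\<^esub> (f s \<odot>\<^bsub>A\<^esub> e s) \<in> ?S" using SD(6) by simp
    then show ?thesis using \<open>f s \<in> Units K\<close> sc value_in[OF fc] by (simp add: A.smult_assoc1[symmetric])
  qed
  then have "supported X \<subseteq> ?S" by (intro supported_least S)
  then show ?thesis using YX Y0 by blast
qed

lemma finsum_const: "finite X \<Longrightarrow> f \<in> carrier A \<Longrightarrow>
    (\<Oplus>\<^bsub>A\<^esub>s\<in>X. f) = ([card X] \<cdot>\<^bsub>K\<^esub> \<one>\<^bsub>K\<^esub>) \<odot>\<^bsub>A\<^esub> f"
proof (induction X rule: finite_induct)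
  case (insert s X)
  then show ?case by (simp add: A.smult_l_distr A.a_comm K.add.nat_pow_Suc)
qed simp

text \<open>Maschke's averaging argument. A linear projection \<open>\<pi>\<close> onto \<open>L\<close> is averaged over \<open>N\<close> to a module
  homomorphism, which maps the identity to the required element: on \<open>L\<close> the average is the identity
  map, and it is right multiplication by its value at \<open>\<one>\<close>.\<close>

lemma ideal_generated_by_idempotent:
  assumes L: "submodule L K A" "L \<subseteq> supported N"
    and mult: "\<And>s f. s \<in> N \<Longrightarrow> f \<in> L \<Longrightarrow> e s \<otimes>\<^bsub>A\<^esub> f \<in> L"
  shows "\<exists>\<epsilon>\<in>L. \<forall>f\<in>L. f \<otimes>\<^bsub>A\<^esub> \<epsilon> = f"
proof -
  note LD = A.submodule_closed[OF L(1)]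
  obtain Y where Y: "Y \<subseteq> N" "L \<inter> supported Y = {\<zero>\<^bsub>A\<^esub>}" "supported N \<subseteq> L <+>\<^bsub>A\<^esub> supported Y"
    using coordinate_complement[OF N_finite _ L(1)] N_carrier by blast
  note YD = A.submodule_closed[OF supported_submodule[of Y]]
  define \<pi> where "\<pi> f = (SOME l. l \<in> L \<and> f \<ominus>\<^bsub>A\<^esub> l \<in> supported Y)" for f
  have \<pi>: "\<pi> f \<in> L \<and> f \<ominus>\<^bsub>A\<^esub> \<pi> f \<in> supported Y" if f: "f \<in> supported N" for f
  proof -
    obtain l k where lk: "l \<in> L" "k \<in> supported Y" "f = l \<oplus>\<^bsub>A\<^esub> k"
      using Y(3) f unfolding set_add_def' by blast
    have "f \<ominus>\<^bsub>A\<^esub> l = k" unfolding lk(3)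
      using LD(1) lk(1) supportedD(1)[OF lk(2)] by (intro A.add_diff_cancel(1)) auto
    then have "l \<in> L \<and> f \<ominus>\<^bsub>A\<^esub> l \<in> supported Y" using lk by blast
    then show ?thesis unfolding \<pi>_def
      by (rule someI[where P = "\<lambda>l. l \<in> L \<and> f \<ominus>\<^bsub>A\<^esub> l \<in> supported Y"])
  qed
  have unique: "l = \<pi> f" if f: "f \<in> supported N" and l: "l \<in> L" "f \<ominus>\<^bsub>A\<^esub> l \<in> supported Y" for f l
  proof -
    have c: "f \<in> carrier A" "l \<in> carrier A" "\<pi> f \<in> carrier A"
      using supportedD(1)[OF f] l LD(1) \<pi>[OF f] by auto
    have "l \<ominus>\<^bsub>A\<^esub> \<pi> f = (f \<ominus>\<^bsub>A\<^esub> \<pi> f) \<ominus>\<^bsub>A\<^esub> (f \<ominus>\<^bsub>A\<^esub> l)"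
      using c by (simp add: A.diff_diff_diff)
    then have "l \<ominus>\<^bsub>A\<^esub> \<pi> f \<in> supported Y" using YD(4)[of "f \<ominus>\<^bsub>A\<^esub> \<pi> f" "f \<ominus>\<^bsub>A\<^esub> l"] \<pi>[OF f] l by metis
    moreover have "l \<ominus>\<^bsub>A\<^esub> \<pi> f \<in> L" using \<pi>[OF f] l LD(4) by blast
    ultimately have "l \<ominus>\<^bsub>A\<^esub> \<pi> f = \<zero>\<^bsub>A\<^esub>" using Y(2) by blast
    then show ?thesis using c by simp
  qed
  have \<pi>_fix: "\<pi> f = f" if f: "f \<in> L" for f
  proof (rule unique[symmetric])
    have "f \<ominus>\<^bsub>A\<^esub> f = \<zero>\<^bsub>A\<^esub>" using f LD(1) by (auto simp: a_minus_def A.r_neg)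
    then show "f \<ominus>\<^bsub>A\<^esub> f \<in> supported Y" using supported_zero by simp
  qed (use f L in auto)
  have \<pi>_add: "\<pi> (f \<oplus>\<^bsub>A\<^esub> g) = \<pi> f \<oplus>\<^bsub>A\<^esub> \<pi> g" if f: "f \<in> supported N" and g: "g \<in> supported N" for f g
  proof (rule unique[symmetric])
    have c: "f \<in> carrier A" "g \<in> carrier A" "\<pi> f \<in> carrier A" "\<pi> g \<in> carrier A"
      using supportedD(1) f g LD(1) \<pi> by auto
    have "(f \<oplus>\<^bsub>A\<^esub> g) \<ominus>\<^bsub>A\<^esub> (\<pi> f \<oplus>\<^bsub>A\<^esub> \<pi> g) = (f \<ominus>\<^bsub>A\<^esub> \<pi> f) \<oplus>\<^bsub>A\<^esub> (g \<ominus>\<^bsub>A\<^esub> \<pi> g)"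
      using c by (simp add: a_minus_def A.minus_add A.a_ac)
    then show "(f \<oplus>\<^bsub>A\<^esub> g) \<ominus>\<^bsub>A\<^esub> (\<pi> f \<oplus>\<^bsub>A\<^esub> \<pi> g) \<in> supported Y" using \<pi>[OF f] \<pi>[OF g] by (simp add: YD(3))
  qed (use f g \<pi> LD(3) in \<open>auto intro: supported_add\<close>)
  have \<pi>_smult: "\<pi> (c \<odot>\<^bsub>A\<^esub> f) = c \<odot>\<^bsub>A\<^esub> \<pi> f" if c: "c \<in> carrier K" and f: "f \<in> supported N" for c f
  proof (rule unique[symmetric])
    have fc: "f \<in> carrier A" "\<pi> f \<in> carrier A" using supportedD(1) f LD(1) \<pi> by auto
    have "c \<odot>\<^bsub>A\<^esub> f \<ominus>\<^bsub>A\<^esub> c \<odot>\<^bsub>A\<^esub> \<pi> f = c \<odot>\<^bsub>A\<^esub> (f \<ominus>\<^bsub>A\<^esub> \<pi> f)"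
      using c fc by (simp add: a_minus_def A.smult_r_distr A.smult_r_minus)
    then show "c \<odot>\<^bsub>A\<^esub> f \<ominus>\<^bsub>A\<^esub> c \<odot>\<^bsub>A\<^esub> \<pi> f \<in> supported Y" using \<pi>[OF f] c by (simp add: YD(6))
  qed (use f c \<pi> LD(6) in \<open>auto intro: supported_smult\<close>)
  have eN: "e s \<in> supported N" if "s \<in> N" for s using that N_carrier by (intro supported_single) auto
  have ec: "e s \<in> carrier A" if "s \<in> N" for s using supportedD(1)[OF eN[OF that]] .
  (* The terms of the average, before division by the order of N. *)
  define T where "T s f = e s \<otimes>\<^bsub>A\<^esub> \<pi> (e (inv\<^bsub>M\<^esub> s) \<otimes>\<^bsub>A\<^esub> f)" for s f
  define P where "P f = (\<Oplus>\<^bsub>A\<^esub>s\<in>N. T s f)" for f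
  have inner: "e (inv\<^bsub>M\<^esub> s) \<otimes>\<^bsub>A\<^esub> f \<in> supported N" if "s \<in> N" "f \<in> supported N" for s f
    using supported_N_mult[OF eN[OF N_inv]] that by blast
  have TL: "T s f \<in> L" if "s \<in> N" "f \<in> supported N" for s f
    unfolding T_def using mult that \<pi>[OF inner] by blast
  have Tc: "T s f \<in> carrier A" if "s \<in> N" "f \<in> supported N" for s f using TL[OF that] LD(1) by blast
  have PL: "P f \<in> L" if f: "f \<in> supported N" for f
  proof -
    have "(\<Oplus>\<^bsub>A\<^esub>s\<in>X. T s f) \<in> L" if "finite X" "X \<subseteq> N" for X
      using that
    proof (induction X)
      case empty then show ?case using LD(2) by simp
    next
      case (insert s X)
      then show ?case using TL[OF _ f] Tc[OF _ f] LD(3) by (subst A.finsum_insert) auto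
    qed
    then show ?thesis unfolding P_def using N_finite by blast
  qed
  have Pc: "P f \<in> carrier A" if "f \<in> supported N" for f using PL[OF that] LD(1) by blast
  have T_add: "T s (f \<oplus>\<^bsub>A\<^esub> g) = T s f \<oplus>\<^bsub>A\<^esub> T s g"
    if s: "s \<in> N" and f: "f \<in> supported N" and g: "g \<in> supported N" for s f g
  proof -
    have c: "f \<in> carrier A" "g \<in> carrier A" using supportedD(1) f g by auto
    have "\<pi> (e (inv\<^bsub>M\<^esub> s) \<otimes>\<^bsub>A\<^esub> f) \<in> carrier A" "\<pi> (e (inv\<^bsub>M\<^esub> s) \<otimes>\<^bsub>A\<^esub> g) \<in> carrier A"
      using \<pi>[OF inner[OF s f]] \<pi>[OF inner[OF s g]] LD(1) by auto
    then show ?thesis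
      unfolding T_def mult_r_distr[OF c ec[OF N_inv[OF s]]] \<pi>_add[OF inner[OF s f] inner[OF s g]]
      using ec[OF s] by (intro mult_r_distr)
  qed
  have T_smult: "T s (c \<odot>\<^bsub>A\<^esub> f) = c \<odot>\<^bsub>A\<^esub> T s f"
    if s: "s \<in> N" and f: "f \<in> supported N" and c: "c \<in> carrier K" for s f c
  proof -
    have "\<pi> (e (inv\<^bsub>M\<^esub> s) \<otimes>\<^bsub>A\<^esub> f) \<in> carrier A" using \<pi>[OF inner[OF s f]] LD(1) by auto
    then show ?thesis
      unfolding T_def smult_mult_r[OF c supportedD(1)[OF f] ec[OF N_inv[OF s]]] \<pi>_smult[OF c inner[OF s f]]
      using ec[OF s] c by (intro smult_mult_r)
  qed
  have P_add: "P (f \<oplus>\<^bsub>A\<^esub> g) = P f \<oplus>\<^bsub>A\<^esub> P g" if f: "f \<in> supported N" and g: "g \<in> supported N" for f g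
  proof -
    have "P (f \<oplus>\<^bsub>A\<^esub> g) = (\<Oplus>\<^bsub>A\<^esub>s\<in>N. T s f \<oplus>\<^bsub>A\<^esub> T s g)"
      unfolding P_def using T_add[OF _ f g] Tc f g by (intro A.finsum_cong') auto
    then show ?thesis unfolding P_def using Tc f g by (simp add: A.finsum_addf Pi_def)
  qed
  have P_smult: "P (c \<odot>\<^bsub>A\<^esub> f) = c \<odot>\<^bsub>A\<^esub> P f" if f: "f \<in> supported N" and c: "c \<in> carrier K" for f c
  proof -
    have "P (c \<odot>\<^bsub>A\<^esub> f) = (\<Oplus>\<^bsub>A\<^esub>s\<in>N. c \<odot>\<^bsub>A\<^esub> T s f)"
      unfolding P_def using T_smult[OF _ f c] Tc f c by (intro A.finsum_cong') auto
    then show ?thesis unfolding P_def using Tc f c N_finite by (simp add: A.finsum_smult_ldistr Pi_def)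
  qed
  have P_e: "P (e t \<otimes>\<^bsub>A\<^esub> f) = e t \<otimes>\<^bsub>A\<^esub> P f" if t: "t \<in> N" and f: "f \<in> supported N" for t f
  proof -
    note fc = supportedD(1)[OF f]
    have tc: "t \<in> carrier M" using t N_carrier by blast
    have tf: "e t \<otimes>\<^bsub>A\<^esub> f \<in> supported N" using supported_N_mult[OF eN[OF t] f] .
    have bij: "inj_on (\<lambda>s. t \<otimes>\<^bsub>M\<^esub> s) N" "(\<lambda>s. t \<otimes>\<^bsub>M\<^esub> s) ` N = N"
    proof -
      show "inj_on (\<lambda>s. t \<otimes>\<^bsub>M\<^esub> s) N" using tc N_carrier by (intro inj_onI) (simp add: M.Units_l_cancel)
      show "(\<lambda>s. t \<otimes>\<^bsub>M\<^esub> s) ` N = N"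
      proof (intro equalityI subsetI)
        fix s assume s: "s \<in> N"
        have "s = t \<otimes>\<^bsub>M\<^esub> (inv\<^bsub>M\<^esub> t \<otimes>\<^bsub>M\<^esub> s)"
          using tc N_carrier[OF s] by (simp add: M.m_assoc[symmetric] M.r_inv)
        then show "s \<in> (\<lambda>s. t \<otimes>\<^bsub>M\<^esub> s) ` N" using N_mult[OF N_inv[OF t] s] by blast
      qed (use N_mult t in auto)
    qed
    have step: "T (t \<otimes>\<^bsub>M\<^esub> s) (e t \<otimes>\<^bsub>A\<^esub> f) = e t \<otimes>\<^bsub>A\<^esub> T s f" if s: "s \<in> N" for s
    proof -
      have sc: "s \<in> carrier M" using s N_carrier by blast
      have "e (inv\<^bsub>M\<^esub> (t \<otimes>\<^bsub>M\<^esub> s)) \<otimes>\<^bsub>A\<^esub> (e t \<otimes>\<^bsub>A\<^esub> f) = e (inv\<^bsub>M\<^esub> (t \<otimes>\<^bsub>M\<^esub> s) \<otimes>\<^bsub>M\<^esub> t) \<otimes>\<^bsub>A\<^esub> f"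
        using fc tc sc by (simp add: A.m_assoc[symmetric] e_mult)
      also have "inv\<^bsub>M\<^esub> (t \<otimes>\<^bsub>M\<^esub> s) \<otimes>\<^bsub>M\<^esub> t = inv\<^bsub>M\<^esub> s"
        using tc sc by (simp add: M.inv_mult_group M.m_assoc M.l_inv)
      finally have q: "e (inv\<^bsub>M\<^esub> (t \<otimes>\<^bsub>M\<^esub> s)) \<otimes>\<^bsub>A\<^esub> (e t \<otimes>\<^bsub>A\<^esub> f) = e (inv\<^bsub>M\<^esub> s) \<otimes>\<^bsub>A\<^esub> f" .
      have "\<pi> (e (inv\<^bsub>M\<^esub> s) \<otimes>\<^bsub>A\<^esub> f) \<in> carrier A" using \<pi>[OF inner[OF s f]] LD(1) by auto
      then show ?thesis unfolding T_def q using tc sc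
        by (simp add: A.m_assoc[symmetric] e_mult)
    qed
    have "P (e t \<otimes>\<^bsub>A\<^esub> f) = finsum A (\<lambda>s. T s (e t \<otimes>\<^bsub>A\<^esub> f)) ((\<lambda>s. t \<otimes>\<^bsub>M\<^esub> s) ` N)"
      unfolding P_def bij(2) ..
    also have "\<dots> = finsum A (\<lambda>s. T (t \<otimes>\<^bsub>M\<^esub> s) (e t \<otimes>\<^bsub>A\<^esub> f)) N"
      using bij Tc[OF _ tf] by (intro A.finsum_reindex) auto
    also have "\<dots> = finsum A (\<lambda>s. e t \<otimes>\<^bsub>A\<^esub> T s f) N"
      using step Tc[OF _ f] ec[OF t] by (intro A.finsum_cong') auto
    also have "\<dots> = e t \<otimes>\<^bsub>A\<^esub> P f"
      unfolding P_def using N_finite Tc[OF _ f] ec[OF t] by (intro A.finsum_rdistr[symmetric]) auto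
    finally show ?thesis .
  qed
  have oneN: "\<one>\<^bsub>A\<^esub> \<in> supported N" using eN[OF N_one] by (simp add: e_one)
  have P_one: "f \<otimes>\<^bsub>A\<^esub> P \<one>\<^bsub>A\<^esub> = P f" if f: "f \<in> supported N" for f
  proof -
    have "supp K f \<subseteq> N" using supportedD(2)[OF f] .
    have "f \<otimes>\<^bsub>A\<^esub> P \<one>\<^bsub>A\<^esub> = P f \<and> f \<in> supported N"
      using supportedD(1)[OF f]
    proof (induction rule: single_induct)
      case zero
      have "P \<zero>\<^bsub>A\<^esub> = \<zero>\<^bsub>A\<^esub>"
        using P_smult[OF oneN K.zero_closed] Pc[OF oneN] by simp
      then show ?case using Pc[OF oneN] supported_zero by simp
    next
      case (add c s g)
      have s: "s \<in> N" using add supportedD(2)[OF f] by blast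
      have cs: "single K c s = c \<odot>\<^bsub>A\<^esub> e s" using add by (simp add: smult_single)
      have "P (e s \<otimes>\<^bsub>A\<^esub> \<one>\<^bsub>A\<^esub>) = e s \<otimes>\<^bsub>A\<^esub> P \<one>\<^bsub>A\<^esub>" by (rule P_e[OF s oneN])
      then have "single K c s \<otimes>\<^bsub>A\<^esub> P \<one>\<^bsub>A\<^esub> = P (single K c s)"
        unfolding cs using P_smult[OF eN[OF s]] add ec[OF s] Pc[OF oneN] by (simp add: smult_mult_l)
      moreover have "single K c s \<in> supported N" using add s by (intro supported_single) auto
      ultimately show ?case
        using add P_add Pc[OF oneN] by (simp add: mult_l_distr supported_add)
    qed
    then show ?thesis by blast
  qed
  define c where "c = [card N] \<cdot>\<^bsub>K\<^esub> \<one>\<^bsub>K\<^esub>"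
  have c: "c \<in> Units K" using kernel_invertible by (simp add: c_def N_def K.field_Units)
  have cc: "c \<in> carrier K" using c by (rule K.Units_closed)
  have P_fix: "P f = c \<odot>\<^bsub>A\<^esub> f" if f: "f \<in> L" for f
  proof -
    have fN: "f \<in> supported N" and fc: "f \<in> carrier A" using f L LD(1) by auto
    have "T s f = f" if s: "s \<in> N" for s
    proof -
      have "s \<in> carrier M" using s N_carrier by blast
      then show ?thesis
        unfolding T_def \<pi>_fix[OF mult[OF N_inv[OF s] f]]
        using fc by (simp add: A.m_assoc[symmetric] e_mult M.r_inv e_one)
    qed
    then have "P f = (\<Oplus>\<^bsub>A\<^esub>s\<in>N. f)" unfolding P_def using fc by (intro A.finsum_cong') auto
    then show ?thesis using finsum_const[OF N_finite fc] by (simp add: c_def)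
  qed
  show ?thesis
  proof (intro bexI[of _ "inv\<^bsub>K\<^esub> c \<odot>\<^bsub>A\<^esub> P \<one>\<^bsub>A\<^esub>"] ballI)
    show "inv\<^bsub>K\<^esub> c \<odot>\<^bsub>A\<^esub> P \<one>\<^bsub>A\<^esub> \<in> L" using LD(6) PL[OF oneN] c by simp
    fix f assume f: "f \<in> L"
    have fN: "f \<in> supported N" and fc: "f \<in> carrier A" using f L LD(1) by auto
    have "f \<otimes>\<^bsub>A\<^esub> (inv\<^bsub>K\<^esub> c \<odot>\<^bsub>A\<^esub> P \<one>\<^bsub>A\<^esub>) = inv\<^bsub>K\<^esub> c \<odot>\<^bsub>A\<^esub> P f"
      using fc c Pc[OF oneN] P_one[OF fN] by (simp add: smult_mult_r)
    also have "\<dots> = (inv\<^bsub>K\<^esub> c \<otimes>\<^bsub>K\<^esub> c) \<odot>\<^bsub>A\<^esub> f" using P_fix[OF f] c cc fc by (simp add: A.smult_assoc1[symmetric])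
    also have "\<dots> = f" using c fc by simp
    finally show "f \<otimes>\<^bsub>A\<^esub> (inv\<^bsub>K\<^esub> c \<odot>\<^bsub>A\<^esub> P \<one>\<^bsub>A\<^esub>) = f" .
  qed
qed

subsection \<open>Left ideals are principal\<close>

text \<open>As \<open>x\<close> is a unit, the width of the support matters and not the degrees themselves; so the
  support is normalized to have its top in degree zero.\<close>

definition window :: "nat \<Rightarrow> 'm set" where
  "window k = {s \<in> carrier M. - int k < deg s \<and> deg s \<le> 0}"

definition below :: "nat \<Rightarrow> 'm set" where
  "below k = {s \<in> carrier M. - int k < deg s \<and> deg s < 0}"

definition top :: "('m \<Rightarrow> 'k) \<Rightarrow> 'm \<Rightarrow> 'k" where
  "top f = (\<lambda>s. if deg s = 0 then f s else \<zero>\<^bsub>K\<^esub>)"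

lemma window_mono: "j \<le> k \<Longrightarrow> window j \<subseteq> window k"
  by (auto simp: window_def)

lemma top_supported: assumes f: "f \<in> carrier A" shows "top f \<in> supported N"
proof -
  have "top f \<in> carrier A"
    using value_in[OF f] supp_in[OF f] supp_finite[OF f]
    by (intro carrierI[of _ "supp K f"]) (auto simp: top_def outside_supp)
  moreover have "supp K (top f) \<subseteq> N" using supp_in[OF f] by (auto simp: top_def supp_def N_def)
  ultimately show ?thesis by (simp add: supported_def)
qed

lemma top_add: "top (f \<oplus>\<^bsub>A\<^esub> g) = top f \<oplus>\<^bsub>A\<^esub> top g"
  by (auto simp: fun_eq_iff top_def add_apply)

lemma top_smult: "c \<in> carrier K \<Longrightarrow> top (c \<odot>\<^bsub>A\<^esub> f) = c \<odot>\<^bsub>A\<^esub> top f"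
  by (auto simp: fun_eq_iff top_def smult_apply)

lemma top_zero: "top \<zero>\<^bsub>A\<^esub> = \<zero>\<^bsub>A\<^esub>"
  by (auto simp: fun_eq_iff top_def zero_apply)

lemma top_minus:
  assumes f: "f \<in> carrier A" and g: "g \<in> carrier A"
  shows "top (f \<ominus>\<^bsub>A\<^esub> g) = top f \<ominus>\<^bsub>A\<^esub> top g"
proof -
  have "f \<ominus>\<^bsub>A\<^esub> g = f \<oplus>\<^bsub>A\<^esub> (\<ominus>\<^bsub>K\<^esub> \<one>\<^bsub>K\<^esub>) \<odot>\<^bsub>A\<^esub> g"
    using g by (simp add: a_minus_def A.smult_l_minus)
  moreover have "top f \<ominus>\<^bsub>A\<^esub> top g = top f \<oplus>\<^bsub>A\<^esub> (\<ominus>\<^bsub>K\<^esub> \<one>\<^bsub>K\<^esub>) \<odot>\<^bsub>A\<^esub> top g"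
    using supportedD(1)[OF top_supported[OF g]] by (simp add: a_minus_def A.smult_l_minus)
  ultimately show ?thesis by (simp add: top_add top_smult)
qed

lemma top_split:
  assumes f: "f \<in> supported (window k)"
  shows "f \<ominus>\<^bsub>A\<^esub> top f \<in> supported (below k)"
proof -
  note fc = supportedD(1)[OF f]
  let ?g = "\<lambda>s. if deg s = 0 then \<zero>\<^bsub>K\<^esub> else f s"
  have "?g \<in> carrier A"
    using value_in[OF fc] supp_in[OF fc] supp_finite[OF fc]
    by (intro carrierI[of _ "supp K f"]) (auto simp: outside_supp)
  moreover have "supp K ?g \<subseteq> below k"
    using supportedD(2)[OF f] by (auto simp: supp_def window_def below_def subset_iff)
  ultimately have g: "?g \<in> supported (below k)" by (simp add: supported_def)
  have "f = top f \<oplus>\<^bsub>A\<^esub> ?g" using value_in[OF fc] by (auto simp: fun_eq_iff top_def add_apply)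
  then have "f \<ominus>\<^bsub>A\<^esub> top f = ?g"
    using A.add_diff_cancel(1)[OF supportedD(1)[OF top_supported[OF fc]] supportedD(1)[OF g]] by simp
  with g show ?thesis by simp
qed

lemma top_eq:
  assumes r: "r \<in> supported N" and u: "u \<in> supported (below k)"
  shows "top (r \<oplus>\<^bsub>A\<^esub> u) = r"
proof
  fix s
  have "u s = \<zero>\<^bsub>K\<^esub>" if "deg s = 0" using supportedD(2)[OF u] that by (auto simp: supp_def below_def)
  moreover have "r s = \<zero>\<^bsub>K\<^esub>" if "deg s \<noteq> 0" using supportedD(2)[OF r] that by (auto simp: supp_def N_def)
  ultimately show "top (r \<oplus>\<^bsub>A\<^esub> u) s = r s"
    using value_in[OF supportedD(1)[OF r]] by (auto simp: top_def add_apply)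
qed

lemma N_mult_window: "r \<in> supported N \<Longrightarrow> f \<in> supported (window k) \<Longrightarrow> r \<otimes>\<^bsub>A\<^esub> f \<in> supported (window k)"
  by (rule supported_mult) (auto simp: N_def window_def deg_mult)

lemma top_mult:
  assumes r: "r \<in> supported N" and f: "f \<in> supported (window k)"
  shows "top (r \<otimes>\<^bsub>A\<^esub> f) = r \<otimes>\<^bsub>A\<^esub> top f"
proof -
  note fc = supportedD(1)[OF f] and rc = supportedD(1)[OF r]
  note tc = supportedD(1)[OF top_supported[OF fc]] and sc = supportedD(1)[OF top_split[OF f]]
  have u: "r \<otimes>\<^bsub>A\<^esub> (f \<ominus>\<^bsub>A\<^esub> top f) \<in> supported (below k)"
    by (rule supported_mult[OF r top_split[OF f]]) (auto simp: N_def below_def deg_mult)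
  have "f = top f \<oplus>\<^bsub>A\<^esub> (f \<ominus>\<^bsub>A\<^esub> top f)"
    using A.add_diff_cancel(2)[OF fc tc] A.a_comm[OF tc sc] by simp
  then have "r \<otimes>\<^bsub>A\<^esub> f = r \<otimes>\<^bsub>A\<^esub> top f \<oplus>\<^bsub>A\<^esub> r \<otimes>\<^bsub>A\<^esub> (f \<ominus>\<^bsub>A\<^esub> top f)"
    using mult_r_distr[OF tc sc rc] by simp
  then show ?thesis using top_eq[OF supported_N_mult[OF r top_supported[OF fc]] u] by simp
qed

lemma e_x_cancel: "f \<in> carrier A \<Longrightarrow> e (inv\<^bsub>M\<^esub> x) \<otimes>\<^bsub>A\<^esub> (e x \<otimes>\<^bsub>A\<^esub> f) = f"
  by (simp add: A.m_assoc[symmetric] e_mult M.l_inv e_one)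

lemma shift_below: "f \<in> supported (below (Suc k)) \<Longrightarrow> e x \<otimes>\<^bsub>A\<^esub> f \<in> supported (window k)"
  by (rule supported_mult[of _ "{x}"]) (auto simp: below_def window_def deg_mult deg_x intro!: supported_single)

lemma shift_into_window:
  assumes f: "f \<in> carrier A"
  shows "\<exists>k. \<exists>y\<in>carrier M. e y \<otimes>\<^bsub>A\<^esub> f \<in> supported (window k)"
proof -
  define b where "b = Max (insert 0 ((\<lambda>s. \<bar>deg s\<bar>) ` supp K f))"
  have b0: "b \<ge> 0" and b: "\<bar>deg s\<bar> \<le> b" if "s \<in> supp K f" for s
    unfolding b_def using supp_finite[OF f] that by (auto intro: Max_ge)
  define n where "n = nat b"
  define y where "y = inv\<^bsub>M\<^esub> (x [^]\<^bsub>M\<^esub> n)"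
  have "deg (x [^]\<^bsub>M\<^esub> k) = int k" for k :: nat by (induction k) (auto simp: deg_mult deg_x)
  moreover have b0: "b \<ge> 0" unfolding b_def using supp_finite[OF f] by (intro Max_ge) auto
  moreover have "int n = b" using b0 by (simp add: n_def)
  ultimately have y: "y \<in> carrier M" "deg y = - b" by (auto simp: y_def deg_inv)
  have fs: "f \<in> supported (supp K f)" using f by (simp add: supported_def)
  have "e y \<otimes>\<^bsub>A\<^esub> f \<in> supported (window (Suc (nat (2 * b))))"
  proof (rule supported_mult[OF _ fs, of _ "{y}"])
    show "e y \<in> supported {y}" using y by (intro supported_single) auto
    fix s t assume s: "s \<in> {y}" "t \<in> supp K f" "s \<in> carrier M" "t \<in> carrier M"
    have "deg (s \<otimes>\<^bsub>M\<^esub> t) = deg t - b" using s y by (simp add: deg_mult)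
    then show "s \<otimes>\<^bsub>M\<^esub> t \<in> window (Suc (nat (2 * b)))"
      using b[OF s(2)] b0 s by (auto simp: window_def)
  qed
  then show ?thesis using y by blast
qed

text \<open>Let \<open>J k\<close> be the set of elements of \<open>I\<close> of width at most \<open>k\<close> and \<open>L k\<close> the ideal of their top
  components in the algebra of \<open>N\<close>, generated by the idempotent \<open>\<epsilon> k\<close>. An element of \<open>I\<close> is determined,
  up to narrower elements, by its top component. The single generator is built step by step: if \<open>a\<close>
  generates a left ideal containing \<open>J k\<close> and \<open>\<epsilon> k a = a\<close>, choose \<open>b\<close> in \<open>J (k + 1)\<close> with top component
  \<open>\<eta> = \<epsilon> (k + 1) - \<epsilon> k\<close> and \<open>\<eta> b = b\<close>. The idempotents \<open>\<epsilon> k\<close> and \<open>\<eta>\<close> are orthogonal, so both \<open>a\<close> and \<open>b\<close> are left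
  multiples of \<open>a + b\<close>. The ideals \<open>L k\<close> become stationary, and from then on no new generator is
  needed.\<close>

theorem principal_left_ideal_ring_A: "principal_left_ideal_ring A"
  unfolding principal_left_ideal_ring_def
proof (intro conjI allI impI ring_A)
  fix I assume I: "left_ideal I A"
  note ID = A.left_idealD[OF I]
  define J where "J k = I \<inter> supported (window k)" for k
  define L where "L k = top ` J k" for k
  have JI: "f \<in> I" and JW: "f \<in> supported (window k)" and Jc: "f \<in> carrier A" if "f \<in> J k" for f k
    using that by (auto simp: J_def dest: supportedD)
  have J0: "f = \<zero>\<^bsub>A\<^esub>" if "f \<in> J 0" for f
  proof -
    have "supp K f = {}" using JW[OF that] by (auto simp: supported_def window_def)
    then show ?thesis by (auto simp: zero_eq supp_def)
  qed
  have Jmono: "J j \<subseteq> J k" if "j \<le> k" for j k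
    using supported_mono[OF window_mono[OF that]] by (auto simp: J_def)
  have J_add: "f \<oplus>\<^bsub>A\<^esub> g \<in> J k" if "f \<in> J k" "g \<in> J k" for f g k
    using that ID(4) supported_add by (simp add: J_def)
  have Is: "submodule I K A" by (rule left_ideal_submodule[OF I])
  have J_smult: "c \<odot>\<^bsub>A\<^esub> f \<in> J k" if "c \<in> carrier K" "f \<in> J k" for c f k
    using that A.submodule_closed(6)[OF Is] supported_smult by (simp add: J_def)
  have J_mult: "r \<otimes>\<^bsub>A\<^esub> f \<in> J k" if "r \<in> supported N" "f \<in> J k" for r f k
    using that ID(5) N_mult_window supportedD(1) by (simp add: J_def)
  have J_minus: "f \<ominus>\<^bsub>A\<^esub> g \<in> J k" if f: "f \<in> J k" and g: "g \<in> J k" for f g k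
    using ID(7)[OF JI[OF f] JI[OF g]]
      A.submodule_closed(4)[OF supported_submodule JW[OF f] JW[OF g]] by (simp add: J_def)
  have J_zero: "\<zero>\<^bsub>A\<^esub> \<in> J k" for k using ID(3) supported_zero by (simp add: J_def)
  have LN: "L k \<subseteq> supported N" for k using top_supported Jc by (auto simp: L_def)
  have L_sub: "submodule (L k) K A" for k
  proof (intro A.submoduleI)
    show "L k \<subseteq> carrier A" using LN supportedD(1) by blast
    show "\<zero>\<^bsub>A\<^esub> \<in> L k" using J_zero[of k] top_zero by (force simp: L_def)
    show sm: "c \<odot>\<^bsub>A\<^esub> r \<in> L k" if "c \<in> carrier K" "r \<in> L k" for c r
      using that J_smult by (auto simp: L_def top_smult[symmetric])
    show "\<ominus>\<^bsub>A\<^esub> r \<in> L k" if r: "r \<in> L k" for r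
    proof -
      have "r \<in> carrier A" using r LN supportedD(1) by blast
      then have "\<ominus>\<^bsub>A\<^esub> r = (\<ominus>\<^bsub>K\<^esub> \<one>\<^bsub>K\<^esub>) \<odot>\<^bsub>A\<^esub> r" by (simp add: A.smult_l_minus)
      then show ?thesis using sm[OF _ r, of "\<ominus>\<^bsub>K\<^esub> \<one>\<^bsub>K\<^esub>"] by simp
    qed
    show "r \<oplus>\<^bsub>A\<^esub> r' \<in> L k" if "r \<in> L k" "r' \<in> L k" for r r'
      using that J_add by (auto simp: L_def top_add[symmetric])
  qed
  have L_mult: "r \<otimes>\<^bsub>A\<^esub> r' \<in> L k" if r: "r \<in> supported N" and r': "r' \<in> L k" for r r' k
  proof -
    obtain f where f: "f \<in> J k" "r' = top f" using r' by (auto simp: L_def)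
    have "r \<otimes>\<^bsub>A\<^esub> r' = top (r \<otimes>\<^bsub>A\<^esub> f)" using top_mult[OF r JW[OF f(1)]] f(2) by simp
    then show ?thesis using J_mult[OF r f(1)] by (auto simp: L_def)
  qed
  have eN: "e s \<in> supported N" if "s \<in> N" for s using that N_carrier by (intro supported_single) auto
  have "\<exists>\<epsilon>\<in>L k. \<forall>f\<in>L k. f \<otimes>\<^bsub>A\<^esub> \<epsilon> = f" for k
    using L_mult[OF eN] by (intro ideal_generated_by_idempotent L_sub LN)
  then obtain \<epsilon> where \<epsilon>L: "\<And>k. \<epsilon> k \<in> L k" and \<epsilon>: "\<And>k f. f \<in> L k \<Longrightarrow> f \<otimes>\<^bsub>A\<^esub> \<epsilon> k = f"
    by metis
  have \<epsilon>N: "\<epsilon> k \<in> supported N" and \<epsilon>c: "\<epsilon> k \<in> carrier A" for k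
    using \<epsilon>L LN supportedD(1) by blast+
  have Lmono: "L j \<subseteq> L k" if "j \<le> k" for j k using Jmono[OF that] by (auto simp: L_def)
  (* The union of the ideals L k is generated by one element, which lies in some L m. *)
  have "\<exists>m. \<forall>k. L k \<subseteq> L m"
  proof -
    let ?U = "\<Union>k. L k"
    have two: "\<exists>k. r \<in> L k \<and> r' \<in> L k" if r: "r \<in> ?U" "r' \<in> ?U" for r r'
    proof -
      obtain i j where "r \<in> L i" "r' \<in> L j" using r by blast
      then have "r \<in> L (max i j) \<and> r' \<in> L (max i j)"
        using Lmono[of i "max i j"] Lmono[of j "max i j"] by auto
      then show ?thesis by blast
    qed
    have "submodule ?U K A"
    proof (intro A.submoduleI)
      show "?U \<subseteq> carrier A" using LN supportedD(1) by blast
      show "\<zero>\<^bsub>A\<^esub> \<in> ?U" using A.submodule_closed(2)[OF L_sub] by blast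
      show "\<ominus>\<^bsub>A\<^esub> r \<in> ?U" if "r \<in> ?U" for r using A.submodule_closed(5)[OF L_sub] that by blast
      show "r \<oplus>\<^bsub>A\<^esub> r' \<in> ?U" if "r \<in> ?U" "r' \<in> ?U" for r r'
        using two[OF that] A.submodule_closed(3)[OF L_sub] by blast
      show "c \<odot>\<^bsub>A\<^esub> r \<in> ?U" if "c \<in> carrier K" "r \<in> ?U" for c r
        using A.submodule_closed(6)[OF L_sub] that by blast
    qed
    moreover have "?U \<subseteq> supported N" using LN by blast
    moreover have "e s \<otimes>\<^bsub>A\<^esub> f \<in> ?U" if "s \<in> N" "f \<in> ?U" for s f
      using L_mult[OF eN[OF that(1)]] that(2) by blast
    ultimately obtain \<delta> where \<delta>: "\<delta> \<in> ?U" "\<And>f. f \<in> ?U \<Longrightarrow> f \<otimes>\<^bsub>A\<^esub> \<delta> = f"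
      using ideal_generated_by_idempotent[of ?U] by blast
    then obtain m where m: "\<delta> \<in> L m" by blast
    have "L k \<subseteq> L m" for k
    proof
      fix f assume f: "f \<in> L k"
      have "f \<otimes>\<^bsub>A\<^esub> \<delta> \<in> L m" using L_mult[OF _ m] f LN by blast
      moreover have "f \<otimes>\<^bsub>A\<^esub> \<delta> = f" using \<delta>(2) f by blast
      ultimately show "f \<in> L m" by simp
    qed
    then show ?thesis by blast
  qed
  then obtain m where m: "\<And>k. L k \<subseteq> L m" by blast
  define princ where "princ a = {f \<otimes>\<^bsub>A\<^esub> a | f. f \<in> carrier A}" for a
  have princ_mult: "g \<otimes>\<^bsub>A\<^esub> f \<in> princ a"
    if a: "a \<in> carrier A" and g: "g \<in> carrier A" and f: "f \<in> princ a" for a f g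
  proof -
    obtain h where h: "h \<in> carrier A" "f = h \<otimes>\<^bsub>A\<^esub> a" using f by (auto simp: princ_def)
    have "g \<otimes>\<^bsub>A\<^esub> f = (g \<otimes>\<^bsub>A\<^esub> h) \<otimes>\<^bsub>A\<^esub> a" using h g a by (simp add: A.m_assoc)
    then show ?thesis using g h by (auto simp: princ_def)
  qed
  have princ_add: "f \<oplus>\<^bsub>A\<^esub> g \<in> princ a"
    if a: "a \<in> carrier A" and f: "f \<in> princ a" and g: "g \<in> princ a" for a f g
  proof -
    obtain h where h: "h \<in> carrier A" "f = h \<otimes>\<^bsub>A\<^esub> a" using f by (auto simp: princ_def)
    obtain h' where h': "h' \<in> carrier A" "g = h' \<otimes>\<^bsub>A\<^esub> a" using g by (auto simp: princ_def)
    have "f \<oplus>\<^bsub>A\<^esub> g = (h \<oplus>\<^bsub>A\<^esub> h') \<otimes>\<^bsub>A\<^esub> a" using h h' a by (simp add: A.l_distr)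
    then show ?thesis using h h' by (auto simp: princ_def)
  qed
  have e_x: "e x \<in> carrier A" "e (inv\<^bsub>M\<^esub> x) \<in> carrier A" by simp_all
  (* An element without top component is shifted by x into the next smaller window. *)
  have lower: "f \<in> princ a"
    if a: "a \<in> carrier A" and Ja: "J k \<subseteq> princ a" and f: "f \<in> J (Suc k)" and t: "top f = \<zero>\<^bsub>A\<^esub>" for a f k
  proof -
    have "f \<ominus>\<^bsub>A\<^esub> top f = f" using t Jc[OF f] by (simp add: a_minus_def)
    then have "f \<in> supported (below (Suc k))" using top_split[OF JW[OF f]] by simp
    then have "e x \<otimes>\<^bsub>A\<^esub> f \<in> J k" using shift_below ID(5)[OF e_x(1) JI[OF f]] by (simp add: J_def)
    then have "e x \<otimes>\<^bsub>A\<^esub> f \<in> princ a" using Ja by blast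
    from princ_mult[OF a e_x(2) this] show ?thesis using e_x_cancel[OF Jc[OF f]] by simp
  qed
  have "\<exists>a\<in>I. \<epsilon> k \<otimes>\<^bsub>A\<^esub> a = a \<and> J k \<subseteq> princ a" for k
  proof (induction k)
    case 0
    have "\<epsilon> 0 \<otimes>\<^bsub>A\<^esub> \<zero>\<^bsub>A\<^esub> = \<zero>\<^bsub>A\<^esub>" using \<epsilon>c[of 0] by simp
    moreover have "J 0 \<subseteq> princ \<zero>\<^bsub>A\<^esub>"
    proof
      fix f assume "f \<in> J 0"
      from J0[OF this] have "f = \<one>\<^bsub>A\<^esub> \<otimes>\<^bsub>A\<^esub> \<zero>\<^bsub>A\<^esub>" by (simp only: A.r_null A.one_closed)
      then show "f \<in> princ \<zero>\<^bsub>A\<^esub>" unfolding princ_def by blast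
    qed
    ultimately show ?case using ID(3) by blast
  next
    case (Suc k)
    then obtain a where a: "a \<in> I" "\<epsilon> k \<otimes>\<^bsub>A\<^esub> a = a" "J k \<subseteq> princ a" by blast
    have ac: "a \<in> carrier A" using a ID(2) by blast
    let ?p = "\<epsilon> k" and ?q = "\<epsilon> (Suc k)"
    define \<eta> where "\<eta> = ?q \<ominus>\<^bsub>A\<^esub> ?p"
    have pL: "?p \<in> L (Suc k)" using \<epsilon>L[of k] Lmono[of k "Suc k"] by auto
    have pq: "?p \<otimes>\<^bsub>A\<^esub> ?q = ?p" by (rule \<epsilon>[OF pL])
    have qp: "?q \<otimes>\<^bsub>A\<^esub> ?p = ?p" using pq supported_N_comm[OF \<epsilon>N \<epsilon>N] by metis
    have pp: "?p \<otimes>\<^bsub>A\<^esub> ?p = ?p" by (rule \<epsilon>[OF \<epsilon>L])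
    have qq: "?q \<otimes>\<^bsub>A\<^esub> ?q = ?q" by (rule \<epsilon>[OF \<epsilon>L])
    have \<eta>L: "\<eta> \<in> L (Suc k)" unfolding \<eta>_def by (rule A.submodule_closed(4)[OF L_sub \<epsilon>L pL])
    have \<eta>N: "\<eta> \<in> supported N" using \<eta>L LN by blast
    have \<eta>c: "\<eta> \<in> carrier A" using \<eta>N supportedD(1) by blast
    have p\<eta>: "?p \<otimes>\<^bsub>A\<^esub> \<eta> = \<zero>\<^bsub>A\<^esub>" unfolding \<eta>_def a_minus_def
      using pq pp \<epsilon>c by (simp add: A.r_distr A.r_minus A.r_neg)
    have q\<eta>: "?q \<otimes>\<^bsub>A\<^esub> \<eta> = \<eta>" unfolding \<eta>_def a_minus_def
      using qq qp \<epsilon>c by (simp add: A.r_distr A.r_minus)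
    have \<eta>\<eta>: "\<eta> \<otimes>\<^bsub>A\<^esub> \<eta> = \<eta>"
    proof -
      have "\<eta> \<otimes>\<^bsub>A\<^esub> \<eta> = ?q \<otimes>\<^bsub>A\<^esub> \<eta> \<oplus>\<^bsub>A\<^esub> \<ominus>\<^bsub>A\<^esub> (?p \<otimes>\<^bsub>A\<^esub> \<eta>)"
        using \<epsilon>c \<eta>c by (subst (1) \<eta>_def) (simp add: a_minus_def A.l_distr A.l_minus)
      then show ?thesis using p\<eta> q\<eta> \<eta>c by simp
    qed
    obtain b' where b': "b' \<in> J (Suc k)" "top b' = \<eta>" using \<eta>L by (auto simp: L_def)
    define b where "b = \<eta> \<otimes>\<^bsub>A\<^esub> b'"
    have bJ: "b \<in> J (Suc k)" unfolding b_def by (rule J_mult[OF \<eta>N b'(1)])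
    have bc: "b \<in> carrier A" by (rule Jc[OF bJ])
    have top_b: "top b = \<eta>" unfolding b_def using top_mult[OF \<eta>N JW[OF b'(1)]] b'(2) \<eta>\<eta> by simp
    have \<eta>b: "\<eta> \<otimes>\<^bsub>A\<^esub> b = b"
      unfolding b_def using \<eta>c Jc[OF b'(1)] \<eta>\<eta> by (simp add: A.m_assoc[symmetric])
    have pb: "?p \<otimes>\<^bsub>A\<^esub> b = \<zero>\<^bsub>A\<^esub>"
      unfolding b_def using \<eta>c \<epsilon>c Jc[OF b'(1)] p\<eta> by (simp add: A.m_assoc[symmetric])
    have qb: "?q \<otimes>\<^bsub>A\<^esub> b = b"
      unfolding b_def using \<eta>c \<epsilon>c Jc[OF b'(1)] q\<eta> by (simp add: A.m_assoc[symmetric])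
    have qa: "?q \<otimes>\<^bsub>A\<^esub> a = a"
    proof -
      have "?q \<otimes>\<^bsub>A\<^esub> (?p \<otimes>\<^bsub>A\<^esub> a) = ?p \<otimes>\<^bsub>A\<^esub> a" using qp \<epsilon>c ac by (simp add: A.m_assoc[symmetric])
      then show ?thesis using a(2) by simp
    qed
    let ?a = "a \<oplus>\<^bsub>A\<^esub> b"
    have ac': "?a \<in> carrier A" using ac bc by simp
    have "?p \<otimes>\<^bsub>A\<^esub> ?a = a" using a(2) pb \<epsilon>c ac bc by (simp add: A.r_distr)
    then have a_in: "a \<in> princ ?a" unfolding princ_def using \<epsilon>c by (metis (mono_tags, lifting) mem_Collect_eq)
    have "\<eta> \<otimes>\<^bsub>A\<^esub> a = \<zero>\<^bsub>A\<^esub>"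
      unfolding \<eta>_def a_minus_def using a(2) qa \<epsilon>c ac by (simp add: A.l_distr A.l_minus A.r_neg)
    then have "\<eta> \<otimes>\<^bsub>A\<^esub> ?a = b" using \<eta>b \<eta>c ac bc by (simp add: A.r_distr)
    then have b_in: "b \<in> princ ?a" unfolding princ_def using \<eta>c by (metis (mono_tags, lifting) mem_Collect_eq)
    have Jk: "J k \<subseteq> princ ?a"
    proof
      fix f assume "f \<in> J k"
      then obtain h where h: "h \<in> carrier A" "f = h \<otimes>\<^bsub>A\<^esub> a" using a(3) by (auto simp: princ_def)
      then show "f \<in> princ ?a" using princ_mult[OF ac' h(1) a_in] by simp
    qed
    have "J (Suc k) \<subseteq> princ ?a"
    proof
      fix f assume f: "f \<in> J (Suc k)"
      define r where "r = top f"
      have rL: "r \<in> L (Suc k)" using f by (auto simp: r_def L_def)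
      have rN: "r \<in> supported N" using rL LN by blast
      have rc: "r \<in> carrier A" using rN supportedD(1) by blast
      (* The top component r = r (p + \<eta>) is realized by g + r b, with g in J k and top
         component r p. *)
      have "r \<otimes>\<^bsub>A\<^esub> ?p \<in> L k" by (rule L_mult[OF rN \<epsilon>L])
      then obtain g where g: "g \<in> J k" "top g = r \<otimes>\<^bsub>A\<^esub> ?p" by (auto simp: L_def)
      have gJ: "g \<in> J (Suc k)" using g(1) Jmono[of k "Suc k"] by auto
      have rbJ: "r \<otimes>\<^bsub>A\<^esub> b \<in> J (Suc k)" by (rule J_mult[OF rN bJ])
      let ?h = "g \<oplus>\<^bsub>A\<^esub> r \<otimes>\<^bsub>A\<^esub> b"
      have hJ: "?h \<in> J (Suc k)" by (rule J_add[OF gJ rbJ])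
      have "top ?h = r \<otimes>\<^bsub>A\<^esub> ?p \<oplus>\<^bsub>A\<^esub> r \<otimes>\<^bsub>A\<^esub> \<eta>"
        using g(2) top_mult[OF rN JW[OF bJ]] top_b by (simp add: top_add)
      also have "\<dots> = r \<otimes>\<^bsub>A\<^esub> (?p \<oplus>\<^bsub>A\<^esub> \<eta>)" using rc \<epsilon>c \<eta>c by (simp add: A.r_distr)
      also have "?p \<oplus>\<^bsub>A\<^esub> \<eta> = ?q" unfolding \<eta>_def
        using A.add_diff_cancel(2)[OF \<epsilon>c[of "Suc k"] \<epsilon>c[of k]] \<epsilon>c A.a_comm[OF \<epsilon>c[of k]] by simp
      finally have th: "top ?h = r" using \<epsilon>[OF rL] by simp
      have "top (f \<ominus>\<^bsub>A\<^esub> ?h) = \<zero>\<^bsub>A\<^esub>"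
        using top_minus[OF Jc[OF f] Jc[OF hJ]] th rc by (simp add: r_def[symmetric] a_minus_def A.r_neg)
      then have d: "f \<ominus>\<^bsub>A\<^esub> ?h \<in> princ ?a" by (rule lower[OF ac' Jk J_minus[OF f hJ]])
      have "?h \<in> princ ?a" using princ_add[OF ac' _ princ_mult[OF ac' rc b_in]] g(1) Jk by blast
      from princ_add[OF ac' d this] show "f \<in> princ ?a"
        using A.add_diff_cancel(2)[OF Jc[OF f] Jc[OF hJ]] by simp
    qed
    moreover have "?q \<otimes>\<^bsub>A\<^esub> ?a = ?a" using qa qb \<epsilon>c ac bc by (simp add: A.r_distr)
    moreover have "?a \<in> I" using ID(4)[OF a(1) JI[OF bJ]] .
    ultimately show ?case by blast
  qed
  from this[of m] obtain a where a: "a \<in> I" "J m \<subseteq> princ a" by blast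
  have ac: "a \<in> carrier A" using a ID(2) by blast
  have all: "J k \<subseteq> princ a" for k
  proof (induction k)
    case 0 show ?case using a(2) Jmono[of 0 m] by auto
  next
    case (Suc k)
    show ?case
    proof
      fix f assume f: "f \<in> J (Suc k)"
      show "f \<in> princ a"
      proof (cases "Suc k \<le> m")
        case True
        then show ?thesis using a(2) f Jmono by blast
      next
        case False
        have "top f \<in> L m" using m[of "Suc k"] f by (auto simp: L_def)
        then obtain g where g: "g \<in> J m" "top g = top f" by (auto simp: L_def)
        have gJ: "g \<in> J (Suc k)" using g Jmono[of m "Suc k"] False by auto
        have "top (f \<ominus>\<^bsub>A\<^esub> g) = \<zero>\<^bsub>A\<^esub>"
          using top_minus[OF Jc[OF f] Jc[OF gJ]] g(2) supportedD(1)[OF top_supported[OF Jc[OF f]]]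
          by (simp add: a_minus_def A.r_neg)
        then have "f \<ominus>\<^bsub>A\<^esub> g \<in> princ a" by (rule lower[OF ac Suc J_minus[OF f gJ]])
        moreover have "g \<in> princ a" using g a(2) by blast
        ultimately show ?thesis
          using princ_add[OF ac] A.add_diff_cancel(2)[OF Jc[OF f] Jc[OF gJ]] by metis
      qed
    qed
  qed
  have "I = princ a"
  proof (intro equalityI subsetI)
    fix f assume f: "f \<in> I"
    have fc: "f \<in> carrier A" using f ID(2) by blast
    obtain k y where y: "y \<in> carrier M" "e y \<otimes>\<^bsub>A\<^esub> f \<in> supported (window k)"
      using shift_into_window[OF fc] by blast
    have "e y \<otimes>\<^bsub>A\<^esub> f \<in> J k" using y ID(5)[OF _ f] by (simp add: J_def)
    then have yf: "e y \<otimes>\<^bsub>A\<^esub> f \<in> princ a" using all by blast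
    have "e (inv\<^bsub>M\<^esub> y) \<in> carrier A" using y(1) by simp
    from princ_mult[OF ac this yf]
    have "e (inv\<^bsub>M\<^esub> y) \<otimes>\<^bsub>A\<^esub> (e y \<otimes>\<^bsub>A\<^esub> f) \<in> princ a" .
    then show "f \<in> princ a" using y fc by (simp add: A.m_assoc[symmetric] e_mult M.l_inv e_one)
  next
    fix f assume "f \<in> princ a"
    then show "f \<in> I" using a(1) ID(5) by (auto simp: princ_def)
  qed
  then show "\<exists>a\<in>carrier A. I = {f \<otimes>\<^bsub>A\<^esub> a |f. f \<in> carrier A}"
    using ac unfolding princ_def by blast
qed

end

subsection \<open>Right ideals\<close>

definition opposite :: "('m, 'e) monoid_scheme \<Rightarrow> ('m, 'e) monoid_scheme" where
  "opposite M = M\<lparr>monoid.mult := \<lambda>s t. t \<otimes>\<^bsub>M\<^esub> s\<rparr>"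

lemma opposite_simps [simp]:
  "carrier (opposite M) = carrier M" "s \<otimes>\<^bsub>opposite M\<^esub> t = t \<otimes>\<^bsub>M\<^esub> s" "\<one>\<^bsub>opposite M\<^esub> = \<one>\<^bsub>M\<^esub>"
  by (simp_all add: opposite_def)

lemma group_opposite: assumes "group M" shows "group (opposite M)"
proof -
  interpret M: group M by fact
  show ?thesis
    by (rule groupI) (auto simp: M.m_assoc intro!: bexI[of _ "inv\<^bsub>M\<^esub> _"] M.r_inv)
qed

context finite_by_cyclic
begin

text \<open>The opposite group satisfies the same hypotheses, and since \<open>K\<close> is commutative its algebra is
  the opposite ring.\<close>

theorem principal_right_ideal_ring_A: "principal_right_ideal_ring A"
proof -
  interpret O: group "opposite M" by (rule group_opposite) (rule M.group_axioms)
  interpret O: finite_by_cyclic K "opposite M" deg x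
    by unfold_locales
       (use deg_mult deg_x kernel_finite kernel_comm kernel_invertible in \<open>auto simp: add.commute\<close>)
  have c: "carrier O.A = carrier A" "\<zero>\<^bsub>O.A\<^esub> = \<zero>\<^bsub>A\<^esub>" "f \<oplus>\<^bsub>O.A\<^esub> g = f \<oplus>\<^bsub>A\<^esub> g" for f g
    by (simp_all add: monoid_algebra_def)
  have m: "f \<otimes>\<^bsub>O.A\<^esub> g = g \<otimes>\<^bsub>A\<^esub> f" if f: "f \<in> carrier A" and g: "g \<in> carrier A" for f g
  proof
    fix s
    note fv = value_in[OF f] and gv = value_in[OF g]
    let ?X = "{(y, z). f y \<noteq> \<zero>\<^bsub>K\<^esub> \<and> g z \<noteq> \<zero>\<^bsub>K\<^esub> \<and> y \<otimes>\<^bsub>opposite M\<^esub> z = s}"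
    have X: "{(y, z). g y \<noteq> \<zero>\<^bsub>K\<^esub> \<and> f z \<noteq> \<zero>\<^bsub>K\<^esub> \<and> y \<otimes>\<^bsub>M\<^esub> z = s} = prod.swap ` ?X" by auto
    have "(g \<otimes>\<^bsub>A\<^esub> f) s = (\<Oplus>\<^bsub>K\<^esub>p\<in>?X. g (snd p) \<otimes>\<^bsub>K\<^esub> f (fst p))"
      unfolding mult_eq X using fv gv by (subst K.finsum_reindex) (auto intro: inj_onI)
    also have "\<dots> = (f \<otimes>\<^bsub>O.A\<^esub> g) s"
      unfolding O.mult_eq using fv gv by (intro K.finsum_cong') (auto simp: K.m_comm)
    finally show "(f \<otimes>\<^bsub>O.A\<^esub> g) s = (g \<otimes>\<^bsub>A\<^esub> f) s" by simp
  qed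
  show ?thesis
    unfolding principal_right_ideal_ring_def
  proof (intro conjI allI impI ring_A)
    fix I assume I: "right_ideal I A"
    have "add_monoid O.A = add_monoid A" by (simp add: monoid_algebra_def)
    moreover have ag: "additive_subgroup I A" using I by (simp add: right_ideal_def)
    ultimately have "additive_subgroup I O.A" unfolding additive_subgroup_def by metis
    moreover have "f \<otimes>\<^bsub>O.A\<^esub> a \<in> I" if a: "a \<in> I" and f: "f \<in> carrier O.A" for a f
    proof -
      have "a \<in> carrier A" using additive_subgroup.a_subset[OF ag] a by blast
      moreover have "f \<in> carrier A" using f c(1) by simp
      ultimately show ?thesis using m[of f a] I a by (simp add: right_ideal_def)
    qed
    ultimately have "left_ideal I O.A" by (simp add: left_ideal_def)
    then obtain a where a: "a \<in> carrier O.A" "I = {f \<otimes>\<^bsub>O.A\<^esub> a |f. f \<in> carrier O.A}"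
      using O.principal_left_ideal_ring_A unfolding principal_left_ideal_ring_def by blast
    have "f \<otimes>\<^bsub>O.A\<^esub> a = a \<otimes>\<^bsub>A\<^esub> f" if "f \<in> carrier A" for f
      using m[OF that] a(1) c(1) by simp
    then have "I = {a \<otimes>\<^bsub>A\<^esub> f |f. f \<in> carrier A}" unfolding a(2) c(1) by (intro Collect_cong) metis
    then show "\<exists>a\<in>carrier A. I = {a \<otimes>\<^bsub>A\<^esub> f |f. f \<in> carrier A}" using a(1) c by blast
  qed
qed

end

section \<open>Presented monoids\<close>

locale presentation =
  fixes Y :: "'x set" and R :: "('x list \<times> 'x list) set"
  assumes R_lists: "R \<subseteq> lists Y \<times> lists Y"
begin

abbreviation cls :: "'x list \<Rightarrow> 'x list set" where "cls w \<equiv> word_cong Y R `` {w}"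

lemma word_cong_lists: "(a, b) \<in> word_cong Y R \<Longrightarrow> a \<in> lists Y \<and> b \<in> lists Y"
proof (induction rule: word_cong.induct)
  case (step a b u v)
  then have "a \<in> lists Y" "b \<in> lists Y" using R_lists by auto
  then show ?case using step by simp
qed auto

lemma word_cong_context:
  assumes "(a, b) \<in> word_cong Y R" "u \<in> lists Y" "v \<in> lists Y"
  shows "(u @ a @ v, u @ b @ v) \<in> word_cong Y R"
  using assms(1)
proof (induction rule: word_cong.induct)
  case (refl w)
  then show ?case using assms(2,3) by (intro word_cong.refl) simp
next
  case (step a b u' v')
  have "((u @ u') @ a @ (v' @ v), (u @ u') @ b @ (v' @ v)) \<in> word_cong Y R"
    using step assms(2,3) by (intro word_cong.step) auto
  then show ?case by simp
qed (auto intro: word_cong.sym word_cong.trans)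

lemma word_cong_append:
  assumes "(a, b) \<in> word_cong Y R" "(c, d) \<in> word_cong Y R"
  shows "(a @ c, b @ d) \<in> word_cong Y R"
proof -
  have "(a @ c, b @ c) \<in> word_cong Y R"
    using word_cong_context[OF assms(1), of "[]" c] word_cong_lists[OF assms(2)] by simp
  moreover have "(b @ c, b @ d) \<in> word_cong Y R"
    using word_cong_context[OF assms(2), of b "[]"] word_cong_lists[OF assms(1)] by simp
  ultimately show ?thesis by (rule word_cong.trans)
qed

lemma equiv_word_cong: "equiv (lists Y) (word_cong Y R)"
proof (rule equivI)
  show "word_cong Y R \<subseteq> lists Y \<times> lists Y" using word_cong_lists by auto
  show "refl_on (lists Y) (word_cong Y R)" by (auto simp: refl_on_def intro: word_cong.refl)
  show "sym (word_cong Y R)" by (auto simp: sym_def intro: word_cong.sym)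
  show "trans (word_cong Y R)" by (rule transI) (rule word_cong.trans)
qed

lemma cls_eqI: "(a, b) \<in> word_cong Y R \<Longrightarrow> cls a = cls b"
  by (rule equiv_class_eq[OF equiv_word_cong])

lemma cls_eqD: "a \<in> lists Y \<Longrightarrow> cls a = cls b \<Longrightarrow> (a, b) \<in> word_cong Y R"
  using equiv_class_self[OF equiv_word_cong, of a] word_cong.sym by blast

abbreviation S where "S \<equiv> presented_monoid Y R"

lemma carrier_S: "carrier S = cls ` lists Y"
  by (auto simp: presented_monoid_def quotient_def)

lemma cls_carrier [simp]: "w \<in> lists Y \<Longrightarrow> cls w \<in> carrier S"
  by (simp add: carrier_S)

lemma carrier_S_E:
  assumes "s \<in> carrier S" obtains w where "w \<in> lists Y" "s = cls w"
  using assms by (auto simp: carrier_S)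

lemma cls_mult:
  assumes "u \<in> lists Y" "v \<in> lists Y"
  shows "cls u \<otimes>\<^bsub>S\<^esub> cls v = cls (u @ v)"
proof -
  have "cls (a @ b) = cls (u @ v)" if "a \<in> cls u" "b \<in> cls v" for a b
    using that by (intro cls_eqI[symmetric] word_cong_append) auto
  moreover have "u \<in> cls u" "v \<in> cls v" using assms by (auto intro: word_cong.refl)
  ultimately have "(\<Union>a\<in>cls u. \<Union>b\<in>cls v. cls (a @ b)) = cls (u @ v)" by blast
  then show ?thesis by (simp add: presented_monoid_def)
qed

lemma one_S: "\<one>\<^bsub>S\<^esub> = cls []" by (simp add: presented_monoid_def)

lemma monoid_S: "monoid S"
proof (rule monoidI)
  fix x y z assume "x \<in> carrier S" "y \<in> carrier S" "z \<in> carrier S"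
  then obtain u v w where "u \<in> lists Y" "v \<in> lists Y" "w \<in> lists Y" "x = cls u" "y = cls v" "z = cls w"
    by (metis carrier_S_E)
  then show "x \<otimes>\<^bsub>S\<^esub> y \<in> carrier S" "x \<otimes>\<^bsub>S\<^esub> y \<otimes>\<^bsub>S\<^esub> z = x \<otimes>\<^bsub>S\<^esub> (y \<otimes>\<^bsub>S\<^esub> z)"
    "\<one>\<^bsub>S\<^esub> \<otimes>\<^bsub>S\<^esub> x = x" "x \<otimes>\<^bsub>S\<^esub> \<one>\<^bsub>S\<^esub> = x"
    by (simp_all add: cls_mult one_S)
qed (simp add: one_S)

end

section \<open>The monoid of a transitive permutation group\<close>

locale transitive_perm_monoid =
  fixes n l :: nat and H :: "(nat \<Rightarrow> nat) set"
  assumes n: "n \<ge> 1" and l: "l \<ge> 2" and H: "subgroup H (sym_group n)" and trans: "transitive_perms n H"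
begin

text \<open>A constant and not an abbreviation, so that simplification does not rewrite the interval.\<close>

definition Y :: "nat set" where "Y = {1..n}"

lemma finite_Y: "finite Y" by (simp add: Y_def)

lemma H_permutes: "\<sigma> \<in> H \<Longrightarrow> \<sigma> permutes Y"
  using subgroup.subset[OF H] by (auto simp: sym_group_def Y_def)

lemma H_image: "\<sigma> \<in> H \<Longrightarrow> i \<in> Y \<Longrightarrow> \<sigma> i \<in> Y"
  using permutes_in_image[OF H_permutes] by blast

lemma H_map: "\<sigma> \<in> H \<Longrightarrow> w \<in> lists Y \<Longrightarrow> map \<sigma> w \<in> lists Y"
  using H_image by (auto simp: in_lists_conv_set)

lemma H_inv: "\<sigma> \<in> H \<Longrightarrow> inv' \<sigma> \<in> H"
  using subgroup.m_inv_closed[OF H] subgroup.subset[OF H] sym_group_inv_equality by (metis subsetD)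

sublocale presentation Y "perm_relations n l H"
  using H_map unfolding perm_relations_def Y_def by unfold_locales blast

sublocale S: monoid S by (rule monoid_S)

lemma perm_monoid_eq: "perm_monoid n l H = S" by (simp add: perm_monoid_def Y_def)

lemma transitive: "i \<in> Y \<Longrightarrow> j \<in> Y \<Longrightarrow> \<exists>\<sigma>\<in>H. \<sigma> i = j"
  using trans by (simp add: transitive_perms_def Y_def)

lemma one_Y: "1 \<in> Y" using n by (simp add: Y_def)

lemma length_cong: "(a, b) \<in> word_cong Y (perm_relations n l H) \<Longrightarrow> length a = length b"
  by (induction rule: word_cong.induct) (auto simp: perm_relations_def)

lemma window:
  assumes "\<sigma> \<in> H" "w \<in> lists Y" "length w = l" "u \<in> lists Y" "v \<in> lists Y"
  shows "cls (u @ w @ v) = cls (u @ map \<sigma> w @ v)"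
  using assms by (intro cls_eqI word_cong.step) (auto simp: perm_relations_def Y_def)

lemma cls_context:
  assumes "cls a = cls b" "a \<in> lists Y" "u \<in> lists Y" "v \<in> lists Y"
  shows "cls (u @ a @ v) = cls (u @ b @ v)"
  using word_cong_context[OF cls_eqD[OF assms(2,1)] assms(3,4)] by (rule cls_eqI)

text \<open>Letters at distance \<open>l\<close> can be moved in opposite directions: apply \<open>\<tau>\<close> to the window starting
  at the first letter and its inverse to the window ending at the last one. On the letters in between
  the two cancel. All that follows about the group of fractions rests on this relation.\<close>

lemma distant_letters:
  assumes \<tau>: "\<tau> \<in> H" and i: "i \<in> Y" and j: "j \<in> Y" and u: "u \<in> lists Y" "length u = l - 1"
    and p: "p \<in> lists Y" and q: "q \<in> lists Y"
  shows "cls (p @ [i] @ u @ [j] @ q) = cls (p @ [\<tau> i] @ u @ [inv' \<tau> j] @ q)"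
proof -
  have len: "length (i # u) = l" "length (map \<tau> u @ [j]) = l" using u l by auto
  have ju: "[j] @ q \<in> lists Y" "p @ [\<tau> i] \<in> lists Y" "map \<tau> u @ [j] \<in> lists Y" "i # u \<in> lists Y"
    using i j u p q H_image[OF \<tau>] H_map[OF \<tau>] by auto
  have "cls (p @ (i # u) @ ([j] @ q)) = cls (p @ map \<tau> (i # u) @ ([j] @ q))"
    by (rule window[OF \<tau> ju(4) len(1) p ju(1)])
  also have "\<dots> = cls ((p @ [\<tau> i]) @ (map \<tau> u @ [j]) @ q)" by simp
  also have "\<dots> = cls ((p @ [\<tau> i]) @ map (inv' \<tau>) (map \<tau> u @ [j]) @ q)"
    by (rule window[OF H_inv[OF \<tau>] ju(3) len(2) ju(2) q])
  also have "map (inv' \<tau>) (map \<tau> u @ [j]) = u @ [inv' \<tau> j]"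
    using permutes_inverses(2)[OF H_permutes[OF \<tau>]] by (simp add: map_idI)
  finally show ?thesis by simp
qed

text \<open>Choose \<open>\<tau>\<close> with \<open>\<tau> i = j\<close>; then its inverse maps \<open>j\<close> to \<open>i\<close>.\<close>

lemma swap_letters:
  assumes "i \<in> Y" "j \<in> Y" "u \<in> lists Y" "length u = l - 1" "p \<in> lists Y" "q \<in> lists Y"
  shows "cls (p @ [i] @ u @ [j] @ q) = cls (p @ [j] @ u @ [i] @ q)"
proof -
  obtain \<tau> where \<tau>: "\<tau> \<in> H" "\<tau> i = j" using transitive assms by blast
  have "inv' \<tau> j = i" using permutes_inverses(2)[OF H_permutes[OF \<tau>(1)], of i] \<tau>(2) by simp
  then show ?thesis using distant_letters[OF \<tau>(1) assms] \<tau>(2) by simp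
qed

definition z where "z = cls (replicate l 1)"

lemma replicate_Y [simp]: "i \<in> Y \<Longrightarrow> replicate k i \<in> lists Y" by auto

lemma z_carrier [simp]: "z \<in> carrier S" using one_Y unfolding z_def by (intro cls_carrier replicate_Y)

text \<open>By transitivity \<open>x\<^sub>i\<^sup>l\<close> is the same element for every \<open>i\<close>; hence it commutes with every letter.\<close>

lemma z_eq: assumes "i \<in> Y" shows "z = cls (replicate l i)"
proof -
  obtain \<sigma> where \<sigma>: "\<sigma> \<in> H" "\<sigma> 1 = i" using transitive[OF one_Y assms] by blast
  show ?thesis
    using window[OF \<sigma>(1) replicate_Y[OF one_Y, of l], of "[]" "[]"] \<sigma>(2) by (simp add: z_def)
qed

lemma z_letter:
  assumes i: "i \<in> Y" shows "z \<otimes>\<^bsub>S\<^esub> cls [i] = cls [i] \<otimes>\<^bsub>S\<^esub> z"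
proof -
  have i': "[i] \<in> lists Y" using i by simp
  have "z \<otimes>\<^bsub>S\<^esub> cls [i] = cls (replicate l i @ [i])"
    unfolding z_eq[OF i] by (rule cls_mult[OF replicate_Y[OF i] i'])
  also have "replicate l i @ [i] = [i] @ replicate l i" by (simp add: replicate_append_same)
  also have "cls \<dots> = cls [i] \<otimes>\<^bsub>S\<^esub> z"
    unfolding z_eq[OF i] by (rule cls_mult[OF i' replicate_Y[OF i], symmetric])
  finally show ?thesis .
qed

lemma z_central_cls: "w \<in> lists Y \<Longrightarrow> z \<otimes>\<^bsub>S\<^esub> cls w = cls w \<otimes>\<^bsub>S\<^esub> z"
proof (induction w)
  case Nil
  show ?case unfolding one_S[symmetric] by simp
next
  case (Cons i w)
  then have i: "i \<in> Y" "[i] \<in> lists Y" and w: "w \<in> lists Y" by auto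
  have e: "cls (i # w) = cls [i] \<otimes>\<^bsub>S\<^esub> cls w" using cls_mult[OF i(2) w] by simp
  have c: "cls [i] \<in> carrier S" "cls w \<in> carrier S" using i w by (auto intro: cls_carrier)
  have "z \<otimes>\<^bsub>S\<^esub> cls (i # w) = (z \<otimes>\<^bsub>S\<^esub> cls [i]) \<otimes>\<^bsub>S\<^esub> cls w" unfolding e using c by (simp add: S.m_assoc)
  also have "\<dots> = cls [i] \<otimes>\<^bsub>S\<^esub> (z \<otimes>\<^bsub>S\<^esub> cls w)" unfolding z_letter[OF i(1)] using c by (simp add: S.m_assoc)
  also have "\<dots> = cls (i # w) \<otimes>\<^bsub>S\<^esub> z" unfolding Cons.IH[OF w] e using c by (simp add: S.m_assoc)
  finally show ?case .
qed

lemma z_central: "s \<in> carrier S \<Longrightarrow> z \<otimes>\<^bsub>S\<^esub> s = s \<otimes>\<^bsub>S\<^esub> z"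
  using z_central_cls by (auto simp: carrier_S)

text \<open>Going from left to right, the window that starts at a letter is used to turn this letter into
  \<open>1\<close>; only the last \<open>l - 1\<close> letters start no window.\<close>

lemma normal_form:
  assumes "w \<in> lists Y" "length w = k + (l - 1)"
  shows "\<exists>v\<in>lists Y. length v = l - 1 \<and> cls w = cls (replicate k 1 @ v)"
  using assms
proof (induction k arbitrary: w)
  case 0
  then show ?case by (intro bexI[of _ w]) auto
next
  case (Suc k)
  then obtain i w' where w: "w = i # w'" by (cases w) auto
  then have i: "i \<in> Y" and w': "w' \<in> lists Y" "length w' = k + (l - 1)" using Suc.prems by auto
  obtain \<sigma> where \<sigma>: "\<sigma> \<in> H" "\<sigma> i = 1" using transitive[OF i one_Y] by blast
  define a where "a = take (l - 1) w'"
  define b where "b = drop (l - 1) w'"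
  have ab: "w' = a @ b" "length a = l - 1" "a \<in> lists Y" "b \<in> lists Y"
    using w' by (auto simp: a_def b_def in_lists_conv_set dest: in_set_takeD in_set_dropD)
  have len: "length (i # a) = l" "i # a \<in> lists Y" using ab l i by auto
  have "cls w = cls ([] @ map \<sigma> (i # a) @ b)"
    using window[OF \<sigma>(1) len(2,1), of "[]" b] ab w by simp
  also have "\<dots> = cls ([1] @ (map \<sigma> a @ b) @ [])" using \<sigma> by simp
  finally have 1: "cls w = cls ([1] @ (map \<sigma> a @ b) @ [])" .
  have ab': "map \<sigma> a @ b \<in> lists Y" "length (map \<sigma> a @ b) = k + (l - 1)"
    using H_map[OF \<sigma>(1)] ab w' by auto
  from Suc.IH[OF this] obtain v where v: "v \<in> lists Y" "length v = l - 1"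
    "cls (map \<sigma> a @ b) = cls (replicate k 1 @ v)" by blast
  have "cls ([1] @ (map \<sigma> a @ b) @ []) = cls ([1] @ (replicate k 1 @ v) @ [])"
    using one_Y by (intro cls_context v(3) ab'(1)) auto
  then show ?case using 1 v by auto
qed

text \<open>The length \<open>2 l - 1\<close> leaves room for \<open>l\<close> leading letters \<open>1\<close> in the normal form.\<close>

lemma long_word:
  assumes w: "w \<in> lists Y" "length w \<ge> 2 * l - 1"
  shows "\<exists>v\<in>lists Y. length v = length w - l \<and> cls w = z \<otimes>\<^bsub>S\<^esub> cls v"
proof -
  define k where "k = length w - (2 * l - 1)"
  have "length w = (l + k) + (l - 1)" using w l by (simp add: k_def)
  from normal_form[OF w(1) this] obtain v where v: "v \<in> lists Y" "length v = l - 1"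
    "cls w = cls (replicate (l + k) 1 @ v)" by blast
  have v': "replicate k 1 @ v \<in> lists Y" using v one_Y by simp
  have "cls w = z \<otimes>\<^bsub>S\<^esub> cls (replicate k 1 @ v)"
    unfolding z_def cls_mult[OF replicate_Y[OF one_Y] v'] using v(3) by (simp add: replicate_add)
  moreover have "length (replicate k 1 @ v) = length w - l" using w l v by (simp add: k_def)
  ultimately show ?thesis using v' by blast
qed

definition B where "B = cls ` {w \<in> lists Y. length w < 2 * l}"

lemma B_finite: "finite B" and B_carrier: "B \<subseteq> carrier S"
proof -
  have "finite {w \<in> lists Y. length w < 2 * l}"
    by (rule finite_subset[OF _ finite_lists_length_le[OF finite_Y, of "2 * l"]]) auto
  then show "finite B" by (simp add: B_def)
  show "B \<subseteq> carrier S" by (auto simp: B_def carrier_S)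
qed

lemma B_gen: 
  assumes "s \<in> carrier S" shows "\<exists>k::nat. \<exists>b\<in>B. s = z [^]\<^bsub>S\<^esub> k \<otimes>\<^bsub>S\<^esub> b"
proof -
  have "\<exists>k::nat. \<exists>b\<in>B. cls w = z [^]\<^bsub>S\<^esub> k \<otimes>\<^bsub>S\<^esub> b" if "w \<in> lists Y" for w
    using that
  proof (induction "length w" arbitrary: w rule: less_induct)
    case less
    show ?case
    proof (cases "length w < 2 * l")
      case True
      then have "cls w \<in> B" "cls w = z [^]\<^bsub>S\<^esub> (0::nat) \<otimes>\<^bsub>S\<^esub> cls w"
        using less.prems by (auto simp: B_def)
      then show ?thesis by blast
    next
      case False
      then have "length w \<ge> 2 * l - 1" by simp
      from long_word[OF less.prems this] obtain v where
        v: "v \<in> lists Y" "length v = length w - l" "cls w = z \<otimes>\<^bsub>S\<^esub> cls v" by blast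
      have "length v < length w" using v False l by simp
      from less.hyps[OF this v(1)] obtain k b where kb: "b \<in> B" "cls v = z [^]\<^bsub>S\<^esub> (k::nat) \<otimes>\<^bsub>S\<^esub> b" by blast
      have "cls w = z [^]\<^bsub>S\<^esub> Suc k \<otimes>\<^bsub>S\<^esub> b"
        unfolding v(3) kb(2) S.nat_pow_Suc2[OF z_carrier] using kb(1) B_carrier
        by (simp add: S.m_assoc subset_iff)
      then show ?thesis using kb by blast
    qed
  qed
  then show ?thesis using assms by (auto simp: carrier_S)
qed

definition deg :: "nat list set \<Rightarrow> nat" where "deg s = length (SOME w. w \<in> s)"

lemma deg_cls: "w \<in> lists Y \<Longrightarrow> deg (cls w) = length w"
proof -
  assume w: "w \<in> lists Y"
  then have "w \<in> cls w" by (auto intro: word_cong.refl)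
  then have "(SOME v. v \<in> cls w) \<in> cls w" by (rule someI)
  then show ?thesis using length_cong unfolding deg_def by fastforce
qed

lemma deg_mult:
  assumes "s \<in> carrier S" "t \<in> carrier S" shows "deg (s \<otimes>\<^bsub>S\<^esub> t) = deg s + deg t"
proof -
  obtain u v where "u \<in> lists Y" "v \<in> lists Y" "s = cls u" "t = cls v"
    using assms by (metis carrier_S_E)
  then show ?thesis by (simp only: cls_mult deg_cls append_in_lists_conv length_append simp_thms)
qed

lemma deg_eq_0: assumes "s \<in> carrier S" shows "deg s = 0 \<longleftrightarrow> s = \<one>\<^bsub>S\<^esub>"
proof -
  obtain w where w: "w \<in> lists Y" "s = cls w" using assms by (rule carrier_S_E)
  have "deg (cls []) = 0" using deg_cls[of "[]"] by simp
  then show ?thesis using w deg_cls[of w] by (auto simp: one_S)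
qed

lemma deg_z: "deg z = l" unfolding z_def using deg_cls[OF replicate_Y[OF one_Y]] by simp

lemma graded_central_power:
  assumes "field K"
  shows "graded_central_power K (perm_monoid n l H) z B deg (cls [1])"
proof -
  interpret K: field K by fact
  have 1: "[1] \<in> lists Y" using one_Y by simp
  show ?thesis unfolding perm_monoid_eq
    by unfold_locales
       (use z_central B_finite B_carrier B_gen deg_mult deg_eq_0 deg_z l deg_cls[OF 1] cls_carrier[OF 1] in auto)
qed

end

section \<open>Localization at central elements\<close>

locale central_submonoid = monoid M for M (structure) +
  fixes Z :: "'a set"
  assumes Z_carrier [simp]: "z \<in> Z \<Longrightarrow> z \<in> carrier M" and Z_one [simp]: "\<one> \<in> Z"
    and Z_mult [simp]: "z \<in> Z \<Longrightarrow> w \<in> Z \<Longrightarrow> z \<otimes> w \<in> Z"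
    and Z_central: "z \<in> Z \<Longrightarrow> s \<in> carrier M \<Longrightarrow> s \<otimes> z = z \<otimes> s"
begin

lemma Z_left_commute: "z \<in> Z \<Longrightarrow> s \<in> carrier M \<Longrightarrow> t \<in> carrier M \<Longrightarrow> s \<otimes> (z \<otimes> t) = z \<otimes> (s \<otimes> t)"
  using Z_central[of z s] by (simp add: m_assoc[symmetric])

lemma Z_exchange: 
  assumes "c \<in> Z" "d \<in> Z" "s \<in> carrier M" shows "c \<otimes> (s \<otimes> d) = d \<otimes> (s \<otimes> c)"
proof -
  have "c \<otimes> (s \<otimes> d) = c \<otimes> (d \<otimes> s)" using Z_central[OF assms(2,3)] by simp
  also have "\<dots> = d \<otimes> (c \<otimes> s)" by (rule Z_left_commute) (use assms in auto)
  also have "c \<otimes> s = s \<otimes> c" using Z_central[OF assms(1,3)] by simp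
  finally show ?thesis .
qed

lemma Z_rotate:
  assumes "u \<in> Z" "v \<in> Z" "y \<in> Z" "s \<in> carrier M"
  shows "u \<otimes> (v \<otimes> (y \<otimes> s)) = v \<otimes> (y \<otimes> (u \<otimes> s))"
proof -
  have "u \<otimes> (v \<otimes> (y \<otimes> s)) = v \<otimes> (u \<otimes> (y \<otimes> s))" by (rule Z_left_commute) (use assms in auto)
  also have "u \<otimes> (y \<otimes> s) = y \<otimes> (u \<otimes> s)" by (rule Z_left_commute) (use assms in auto)
  finally show ?thesis .
qed

lemma Z_interchange:
  assumes "u \<in> Z" "v \<in> Z" "z \<in> Z" "w \<in> Z" "s \<in> carrier M" "t \<in> carrier M"
  shows "(u \<otimes> v) \<otimes> ((s \<otimes> t) \<otimes> (z \<otimes> w)) = (u \<otimes> (s \<otimes> z)) \<otimes> (v \<otimes> (t \<otimes> w))"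
proof -
  have "(u \<otimes> (s \<otimes> z)) \<otimes> (v \<otimes> (t \<otimes> w)) = u \<otimes> (s \<otimes> (z \<otimes> (v \<otimes> (t \<otimes> w))))"
    using assms by (simp add: m_assoc)
  also have "z \<otimes> (v \<otimes> (t \<otimes> w)) = v \<otimes> (z \<otimes> (t \<otimes> w))" by (rule Z_left_commute) (use assms in auto)
  also have "z \<otimes> (t \<otimes> w) = t \<otimes> (z \<otimes> w)" by (rule Z_left_commute[symmetric]) (use assms in auto)
  also have "s \<otimes> (v \<otimes> (t \<otimes> (z \<otimes> w))) = v \<otimes> (s \<otimes> (t \<otimes> (z \<otimes> w)))"
    by (rule Z_left_commute) (use assms in auto)
  finally show ?thesis using assms by (simp add: m_assoc)
qed

lemma frac_rel_iff:
  "((s, z), (t, w)) \<in> frac_rel M Z \<longleftrightarrow> s \<in> carrier M \<and> t \<in> carrier M \<and> z \<in> Z \<and> w \<in> Z \<and>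
     (\<exists>u\<in>Z. u \<otimes> (s \<otimes> w) = u \<otimes> (t \<otimes> z))"
  by (simp add: frac_rel_def)

lemma frac_rel_trans:
  assumes "((s, z), (t, w)) \<in> frac_rel M Z" "((t, w), (r, y)) \<in> frac_rel M Z"
  shows "((s, z), (r, y)) \<in> frac_rel M Z"
proof -
  obtain u v where c: "s \<in> carrier M" "t \<in> carrier M" "r \<in> carrier M" "z \<in> Z" "w \<in> Z" "y \<in> Z" "u \<in> Z" "v \<in> Z"
    and u: "u \<otimes> (s \<otimes> w) = u \<otimes> (t \<otimes> z)" and v: "v \<otimes> (t \<otimes> y) = v \<otimes> (r \<otimes> w)"
    using assms unfolding frac_rel_iff by blast
  have "(u \<otimes> (v \<otimes> w)) \<otimes> (s \<otimes> y) = u \<otimes> (v \<otimes> (w \<otimes> (s \<otimes> y)))" using c by (simp add: m_assoc)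
  also have "w \<otimes> (s \<otimes> y) = y \<otimes> (s \<otimes> w)" using c by (intro Z_exchange)
  also have "u \<otimes> (v \<otimes> (y \<otimes> (s \<otimes> w))) = v \<otimes> (y \<otimes> (u \<otimes> (s \<otimes> w)))" using c by (intro Z_rotate) auto
  also have "u \<otimes> (s \<otimes> w) = u \<otimes> (t \<otimes> z)" by (rule u)
  also have "y \<otimes> (u \<otimes> (t \<otimes> z)) = u \<otimes> (y \<otimes> (t \<otimes> z))" using c by (intro Z_left_commute) auto
  also have "y \<otimes> (t \<otimes> z) = z \<otimes> (t \<otimes> y)" using c by (intro Z_exchange)
  also have "v \<otimes> (u \<otimes> (z \<otimes> (t \<otimes> y))) = u \<otimes> (z \<otimes> (v \<otimes> (t \<otimes> y)))" using c by (intro Z_rotate) auto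
  also have "v \<otimes> (t \<otimes> y) = v \<otimes> (r \<otimes> w)" by (rule v)
  also have "z \<otimes> (v \<otimes> (r \<otimes> w)) = v \<otimes> (z \<otimes> (r \<otimes> w))" using c by (intro Z_left_commute) auto
  also have "z \<otimes> (r \<otimes> w) = w \<otimes> (r \<otimes> z)" using c by (intro Z_exchange)
  also have "u \<otimes> (v \<otimes> (w \<otimes> (r \<otimes> z))) = (u \<otimes> (v \<otimes> w)) \<otimes> (r \<otimes> z)" using c by (simp add: m_assoc)
  finally show ?thesis unfolding frac_rel_iff using c by (intro conjI bexI[of _ "u \<otimes> (v \<otimes> w)"]) auto
qed

lemma equiv_frac_rel: "equiv (carrier M \<times> Z) (frac_rel M Z)"
proof (rule equivI)
  show "frac_rel M Z \<subseteq> (carrier M \<times> Z) \<times> (carrier M \<times> Z)" by (auto simp: frac_rel_def)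
  show "refl_on (carrier M \<times> Z) (frac_rel M Z)"
    by (rule refl_onI) (auto simp: frac_rel_iff intro!: bexI[of _ \<one>])
  have "((t, w), (s, z)) \<in> frac_rel M Z" if "((s, z), (t, w)) \<in> frac_rel M Z" for s z t w
    using that unfolding frac_rel_iff by metis
  then show "sym (frac_rel M Z)" by (intro symI) auto
  show "trans (frac_rel M Z)"
  proof (rule transI)
    fix p q r assume "(p, q) \<in> frac_rel M Z" "(q, r) \<in> frac_rel M Z"
    then show "(p, r) \<in> frac_rel M Z"
      using frac_rel_trans[of "fst p" "snd p" "fst q" "snd q" "fst r" "snd r"] by simp
  qed
qed

definition frac :: "'a \<Rightarrow> 'a \<Rightarrow> ('a \<times> 'a) set" where "frac s z = frac_rel M Z `` {(s, z)}"

abbreviation L where "L \<equiv> central_localization M Z"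

lemma frac_eq_iff:
  assumes "s \<in> carrier M" "z \<in> Z" "t \<in> carrier M" "w \<in> Z"
  shows "frac s z = frac t w \<longleftrightarrow> (\<exists>u\<in>Z. u \<otimes> (s \<otimes> w) = u \<otimes> (t \<otimes> z))"
  unfolding frac_def using eq_equiv_class_iff[OF equiv_frac_rel, of "(s, z)" "(t, w)"] assms
  by (simp add: frac_rel_iff)

lemma frac_eqI:
  assumes "s \<in> carrier M" "z \<in> Z" "t \<in> carrier M" "w \<in> Z" "s \<otimes> w = t \<otimes> z"
  shows "frac s z = frac t w"
  unfolding frac_eq_iff[OF assms(1-4)] using assms(5) by (intro bexI[of _ \<one>]) auto

lemma frac_carrier [simp]: "s \<in> carrier M \<Longrightarrow> z \<in> Z \<Longrightarrow> frac s z \<in> carrier L"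
  by (auto simp: central_localization_def frac_def quotient_def)

lemma carrier_L_E:
  assumes "g \<in> carrier L" obtains s z where "s \<in> carrier M" "z \<in> Z" "g = frac s z"
  using assms by (auto simp: central_localization_def frac_def quotient_def)

lemma frac_self: "s \<in> carrier M \<Longrightarrow> z \<in> Z \<Longrightarrow> (s, z) \<in> frac s z"
  unfolding frac_def using equiv_class_self[OF equiv_frac_rel] by blast

lemma frac_mult:
  assumes s: "s \<in> carrier M" "z \<in> Z" and t: "t \<in> carrier M" "w \<in> Z"
  shows "frac s z \<otimes>\<^bsub>L\<^esub> frac t w = frac (s \<otimes> t) (z \<otimes> w)"
proof -
  have eq: "frac (s' \<otimes> t') (z' \<otimes> w') = frac (s \<otimes> t) (z \<otimes> w)"
    if "(s', z') \<in> frac s z" "(t', w') \<in> frac t w" for s' z' t' w'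
  proof -
    obtain u v where c: "s' \<in> carrier M" "t' \<in> carrier M" "z' \<in> Z" "w' \<in> Z" "u \<in> Z" "v \<in> Z"
      and u: "u \<otimes> (s \<otimes> z') = u \<otimes> (s' \<otimes> z)" and v: "v \<otimes> (t \<otimes> w') = v \<otimes> (t' \<otimes> w)"
      using \<open>(s', z') \<in> frac s z\<close> \<open>(t', w') \<in> frac t w\<close> unfolding frac_def by (auto simp: frac_rel_iff)
    have "(u \<otimes> v) \<otimes> ((s \<otimes> t) \<otimes> (z' \<otimes> w')) = (u \<otimes> (s \<otimes> z')) \<otimes> (v \<otimes> (t \<otimes> w'))"
      using s t c by (intro Z_interchange)
    also have "\<dots> = (u \<otimes> (s' \<otimes> z)) \<otimes> (v \<otimes> (t' \<otimes> w))" by (simp only: u v)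
    also have "\<dots> = (u \<otimes> v) \<otimes> ((s' \<otimes> t') \<otimes> (z \<otimes> w))"
      using s t c by (intro Z_interchange[symmetric])
    finally have "frac (s \<otimes> t) (z \<otimes> w) = frac (s' \<otimes> t') (z' \<otimes> w')"
      using s t c by (subst frac_eq_iff) (auto intro!: bexI[of _ "u \<otimes> v"])
    then show ?thesis by simp
  qed
  have "(\<Union>(s', z')\<in>frac s z. \<Union>(t', w')\<in>frac t w. frac (s' \<otimes> t') (z' \<otimes> w')) = frac (s \<otimes> t) (z \<otimes> w)"
    using eq frac_self[OF s] frac_self[OF t] by fast
  then show ?thesis by (simp add: central_localization_def frac_def)
qed

lemma one_L: "\<one>\<^bsub>L\<^esub> = frac \<one> \<one>" by (simp add: central_localization_def frac_def)

text \<open>The inverse of \<open>s / c\<close> is \<open>t c / t s\<close>, where \<open>t s\<close> is a denominator.\<close>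

lemma group_L:
  assumes inv: "\<And>s. s \<in> carrier M \<Longrightarrow> \<exists>t\<in>carrier M. t \<otimes> s \<in> Z"
  shows "group L"
proof (rule groupI)
  fix g h k assume "g \<in> carrier L" "h \<in> carrier L" "k \<in> carrier L"
  then obtain s z t w r y where c: "s \<in> carrier M" "z \<in> Z" "t \<in> carrier M" "w \<in> Z" "r \<in> carrier M" "y \<in> Z"
    and e: "g = frac s z" "h = frac t w" "k = frac r y" by (metis carrier_L_E)
  show "g \<otimes>\<^bsub>L\<^esub> h \<in> carrier L" "g \<otimes>\<^bsub>L\<^esub> h \<otimes>\<^bsub>L\<^esub> k = g \<otimes>\<^bsub>L\<^esub> (h \<otimes>\<^bsub>L\<^esub> k)"
    "\<one>\<^bsub>L\<^esub> \<otimes>\<^bsub>L\<^esub> g = g"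
    using c by (simp_all add: e frac_mult one_L m_assoc)
  obtain v where v: "v \<in> carrier M" "v \<otimes> s \<in> Z" using inv c by blast
  have "frac (v \<otimes> z) (v \<otimes> s) \<otimes>\<^bsub>L\<^esub> g = frac (v \<otimes> z \<otimes> s) (v \<otimes> s \<otimes> z)"
    using c v by (simp add: e frac_mult)
  also have "\<dots> = \<one>\<^bsub>L\<^esub>"
    unfolding one_L
  proof (rule frac_eqI)
    have "v \<otimes> z \<otimes> s = v \<otimes> s \<otimes> z" using c v(1) Z_central[of z s] by (simp add: m_assoc)
    then show "v \<otimes> z \<otimes> s \<otimes> \<one> = \<one> \<otimes> (v \<otimes> s \<otimes> z)" using c v(1) by simp
    show "v \<otimes> s \<otimes> z \<in> Z" using c v(2) by simp
  qed (use c v in auto)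
  finally show "\<exists>h\<in>carrier L. h \<otimes>\<^bsub>L\<^esub> g = \<one>\<^bsub>L\<^esub>" using c v by (intro bexI[of _ "frac (v \<otimes> z) (v \<otimes> s)"]) auto
qed (simp add: one_L)

end

section \<open>Elements of prime order\<close>

lemma (in group) Cauchy:
  assumes "prime p" and fin: "finite (carrier G)" and dvd: "p dvd order G"
  shows "\<exists>g\<in>carrier G. ord g = p"
proof -
  obtain m where "order G = p ^ 1 * m" using dvd by (auto simp: dvd_def)
  then obtain U where U: "subgroup U G" "card U = p ^ 1"
    using sylow_thm[OF \<open>prime p\<close> group_axioms _ fin] by blast
  interpret U: group "G\<lparr>carrier := U\<rparr>" by (rule subgroup_imp_group[OF U(1)])
  have "card U > 1" using U(2) prime_gt_1_nat[OF \<open>prime p\<close>] by simp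
  then have "\<not> U \<subseteq> {\<one>}" by (metis card_mono card.empty card_insert_disjoint empty_iff finite.emptyI finite.insertI leD One_nat_def)
  then obtain g where g: "g \<in> U" "g \<noteq> \<one>" by blast
  have gc: "g \<in> carrier G" using g subgroup.subset[OF U(1)] by blast
  have "g [^]\<^bsub>G\<lparr>carrier := U\<rparr>\<^esub> p = \<one>"
    using U.pow_order_eq_1[of g] g U(2) by (simp add: order_def)
  then have "g [^] p = \<one>" using nat_pow_consistent[of g p U] by simp
  then have "ord g dvd p" using pow_eq_id[OF gc] by simp
  moreover have "ord g \<noteq> 1" using ord_eq_1[OF gc] g by simp
  ultimately have "ord g = p" using \<open>prime p\<close> by (auto simp: prime_nat_iff)
  then show ?thesis using gc by blast
qed

lemma (in group) Cauchy_subgroup: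
  assumes "prime p" and U: "subgroup U G" and fin: "finite U" and dvd: "p dvd card U"
  shows "\<exists>g\<in>U. ord g = p"
proof -
  interpret U: group "G\<lparr>carrier := U\<rparr>" by (rule subgroup_imp_group[OF U])
  obtain g where g: "g \<in> U" "U.ord g = p"
    using U.Cauchy[OF \<open>prime p\<close>] fin dvd by (auto simp: order_def)
  have gc: "g \<in> carrier G" using g subgroup.subset[OF U] by blast
  have "ord g dvd k \<longleftrightarrow> U.ord g dvd k" for k
    using pow_eq_id[OF gc, of k] U.pow_eq_id[of g k] g nat_pow_consistent[of g k U] by simp
  then have "ord g = U.ord g" by (metis dvd_antisym dvd_refl)
  then show ?thesis using g by auto
qed

text \<open>A factorization of the characteristic gives a product of two multiples of \<open>\<one>\<close> that vanishes.\<close>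

lemma (in field) prime_char:
  assumes "ring_char R \<noteq> 0" shows "prime (ring_char R)"
proof -
  let ?c = "ring_char R"
  have id: "add_pow R k \<one> = \<zero> \<longleftrightarrow> ?c dvd k" for k :: nat
    using add.pow_eq_id[of \<one> k] by (simp add: ring_char_def add_pow_def)
  have "?c \<noteq> 1" using id[of 1] by simp
  moreover have "a = 1 \<or> a = ?c" if a: "a dvd ?c" for a
  proof -
    obtain b where b: "?c = a * b" using a by (auto simp: dvd_def)
    have "(add_pow R a \<one>) \<otimes> (add_pow R b \<one>) = add_pow R (a * b) \<one>"
      by (simp add: add_pow_ldistr add.nat_pow_pow mult.commute)
    also have "\<dots> = \<zero>" using id[of ?c] b by simp
    finally have "?c dvd a \<or> ?c dvd b" using integral[of "add_pow R a \<one>" "add_pow R b \<one>"] id by auto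
    then show ?thesis
    proof
      assume "?c dvd a" then show ?thesis using a dvd_antisym by blast
    next
      assume "?c dvd b"
      then have "b = ?c" using b dvd_antisym by (metis dvd_triv_right)
      then show ?thesis using b assms by simp
    qed
  qed
  ultimately show ?thesis using assms by (auto simp: prime_nat_iff)
qed

section \<open>The group of fractions\<close>

context transitive_perm_monoid
begin

definition z_powers where "z_powers = range (\<lambda>k::nat. z [^]\<^bsub>S\<^esub> k)"

lemma z_pow_in [simp]: "z [^]\<^bsub>S\<^esub> (k::nat) \<in> z_powers" by (simp add: z_powers_def)

lemma z_in [simp]: "z \<in> z_powers" using z_pow_in[of 1] by simp

lemma pow_central: "s \<in> carrier S \<Longrightarrow> s \<otimes>\<^bsub>S\<^esub> z [^]\<^bsub>S\<^esub> (k::nat) = z [^]\<^bsub>S\<^esub> k \<otimes>\<^bsub>S\<^esub> s"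
proof (induction k)
  case (Suc k)
  have "s \<otimes>\<^bsub>S\<^esub> z [^]\<^bsub>S\<^esub> Suc k = (s \<otimes>\<^bsub>S\<^esub> z [^]\<^bsub>S\<^esub> k) \<otimes>\<^bsub>S\<^esub> z" using Suc.prems by (simp add: S.m_assoc)
  also have "\<dots> = z [^]\<^bsub>S\<^esub> k \<otimes>\<^bsub>S\<^esub> (s \<otimes>\<^bsub>S\<^esub> z)" unfolding Suc.IH[OF Suc.prems] using Suc.prems by (simp add: S.m_assoc)
  also have "\<dots> = z [^]\<^bsub>S\<^esub> Suc k \<otimes>\<^bsub>S\<^esub> s" unfolding z_central[OF Suc.prems, symmetric] using Suc.prems by (simp add: S.m_assoc)
  finally show ?case .
qed simp

sublocale Q: central_submonoid S z_powers
proof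
  show "\<one>\<^bsub>S\<^esub> \<in> z_powers" using z_pow_in[of 0] by simp
  fix c assume "c \<in> z_powers"
  then obtain k where k: "c = z [^]\<^bsub>S\<^esub> (k::nat)" unfolding z_powers_def by blast
  show "c \<in> carrier S" unfolding k by simp
  show "s \<otimes>\<^bsub>S\<^esub> c = c \<otimes>\<^bsub>S\<^esub> s" if "s \<in> carrier S" for s unfolding k by (rule pow_central[OF that])
  fix d assume "d \<in> z_powers"
  then obtain j where j: "d = z [^]\<^bsub>S\<^esub> (j::nat)" unfolding z_powers_def by blast
  show "c \<otimes>\<^bsub>S\<^esub> d \<in> z_powers" unfolding k j by (simp add: S.nat_pow_mult)
qed

abbreviation G where "G \<equiv> central_localization S z_powers"

lemma perm_fractions_eq: "perm_fractions n l H = G"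
proof -
  have "cls [1] [^]\<^bsub>S\<^esub> k = cls (replicate k 1)" for k :: nat
  proof (induction k)
    case (Suc k)
    have "cls (replicate k 1) \<otimes>\<^bsub>S\<^esub> cls [1] = cls (replicate k 1 @ [1])"
      using one_Y by (intro cls_mult) auto
    then show ?case using Suc by (simp add: replicate_append_same)
  qed (simp add: one_S)
  then have "perm_gen n l H 1 [^]\<^bsub>S\<^esub> l = z"
    by (simp add: perm_gen_def presented_gen_def z_def Y_def)
  then show ?thesis unfolding perm_fractions_def perm_monoid_eq Let_def z_powers_def by simp
qed

lemma letter_power:
  assumes i: "i \<in> Y"
  shows "cls [i] \<otimes>\<^bsub>S\<^esub> cls (replicate (l - 1) i) = z" "cls (replicate (l - 1) i) \<otimes>\<^bsub>S\<^esub> cls [i] = z"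
proof -
  have l1: "Suc (l - 1) = l" using l by simp
  have i1: "[i] \<in> lists Y" using i by simp
  show "cls [i] \<otimes>\<^bsub>S\<^esub> cls (replicate (l - 1) i) = z"
    unfolding cls_mult[OF i1 replicate_Y[OF i]] z_eq[OF i] using l1
    by (metis append_Cons append_Nil replicate_Suc)
  show "cls (replicate (l - 1) i) \<otimes>\<^bsub>S\<^esub> cls [i] = z"
    unfolding cls_mult[OF replicate_Y[OF i] i1] z_eq[OF i] using l1
    by (metis replicate_append_same replicate_Suc)
qed

text \<open>A word is inverted letter by letter, using \<open>x\<^sub>i x\<^sub>i\<^bsup>l-1\<^esup> = z\<close>.\<close>

lemma inverse_up_to_power: "s \<in> carrier S \<Longrightarrow> \<exists>t\<in>carrier S. t \<otimes>\<^bsub>S\<^esub> s \<in> z_powers"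
proof -
  have "\<exists>t\<in>carrier S. t \<otimes>\<^bsub>S\<^esub> cls w \<in> z_powers" if "w \<in> lists Y" for w
    using that
  proof (induction w)
    case Nil
    show ?case unfolding one_S[symmetric] by (intro bexI[of _ "\<one>\<^bsub>S\<^esub>"]) auto
  next
    case (Cons i w)
    then have i: "i \<in> Y" "[i] \<in> lists Y" and w: "w \<in> lists Y" by auto
    obtain t where t: "t \<in> carrier S" "t \<otimes>\<^bsub>S\<^esub> cls w \<in> z_powers" using Cons.IH by blast
    let ?r = "cls (replicate (l - 1) i)"
    have c: "cls [i] \<in> carrier S" "cls w \<in> carrier S" "?r \<in> carrier S"
      using i w by (auto intro!: cls_carrier)
    have e: "cls (i # w) = cls [i] \<otimes>\<^bsub>S\<^esub> cls w" using cls_mult[OF i(2) w] by simp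
    have "(t \<otimes>\<^bsub>S\<^esub> ?r) \<otimes>\<^bsub>S\<^esub> cls (i # w) = t \<otimes>\<^bsub>S\<^esub> ((?r \<otimes>\<^bsub>S\<^esub> cls [i]) \<otimes>\<^bsub>S\<^esub> cls w)"
      unfolding e using c t by (simp add: S.m_assoc)
    also have "\<dots> = z \<otimes>\<^bsub>S\<^esub> (t \<otimes>\<^bsub>S\<^esub> cls w)"
      unfolding letter_power(2)[OF i(1)] using c t by (intro Q.Z_left_commute) auto
    also have "\<dots> \<in> z_powers" using t by simp
    finally show ?case using c t by (intro bexI[of _ "t \<otimes>\<^bsub>S\<^esub> ?r"]) auto
  qed
  then show "s \<in> carrier S \<Longrightarrow> \<exists>t\<in>carrier S. t \<otimes>\<^bsub>S\<^esub> s \<in> z_powers" by (auto simp: carrier_S)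
qed

sublocale G: group G by (rule Q.group_L) (rule inverse_up_to_power)

subsection \<open>The degree\<close>

definition degG :: "(nat list set \<times> nat list set) set \<Rightarrow> int" where
  "degG g = (let p = (SOME p. p \<in> g) in int (deg (fst p)) - int (deg (snd p)))"

lemma degG_frac:
  assumes s: "s \<in> carrier S" "c \<in> z_powers"
  shows "degG (Q.frac s c) = int (deg s) - int (deg c)"
proof -
  define p where "p = (SOME p. p \<in> Q.frac s c)"
  have "p \<in> Q.frac s c" unfolding p_def by (rule someI) (rule Q.frac_self[OF s])
  then obtain u where u: "fst p \<in> carrier S" "snd p \<in> z_powers" "u \<in> z_powers"
    "u \<otimes>\<^bsub>S\<^esub> (s \<otimes>\<^bsub>S\<^esub> snd p) = u \<otimes>\<^bsub>S\<^esub> (fst p \<otimes>\<^bsub>S\<^esub> c)"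
    unfolding Q.frac_def by (cases p) (auto simp: Q.frac_rel_iff)
  have "deg (u \<otimes>\<^bsub>S\<^esub> (s \<otimes>\<^bsub>S\<^esub> snd p)) = deg (u \<otimes>\<^bsub>S\<^esub> (fst p \<otimes>\<^bsub>S\<^esub> c))" using u(4) by simp
  then have "deg s + deg (snd p) = deg (fst p) + deg c" using u(1-3) s by (simp add: deg_mult)
  then show ?thesis unfolding degG_def p_def[symmetric] Let_def by linarith
qed

lemma degG_mult: "g \<in> carrier G \<Longrightarrow> h \<in> carrier G \<Longrightarrow> degG (g \<otimes>\<^bsub>G\<^esub> h) = degG g + degG h"
proof -
  assume "g \<in> carrier G" "h \<in> carrier G"
  then obtain s c t d where "s \<in> carrier S" "c \<in> z_powers" "g = Q.frac s c" "t \<in> carrier S" "d \<in> z_powers" "h = Q.frac t d"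
    by (metis Q.carrier_L_E)
  then show ?thesis by (simp add: Q.frac_mult degG_frac deg_mult)
qed

definition xG where "xG = Q.frac (cls [1]) \<one>\<^bsub>S\<^esub>"

lemma cls_1: "cls [1] \<in> carrier S" using one_Y by (intro cls_carrier) simp

lemma xG: "xG \<in> carrier G" "degG xG = 1"
proof -
  have "[1] \<in> lists Y" using one_Y by simp
  then show "xG \<in> carrier G" "degG xG = 1"
    unfolding xG_def using cls_1 deg_eq_0[of "\<one>\<^bsub>S\<^esub>"] degG_frac[OF cls_1 Q.Z_one] deg_cls[of "[1]"]
    by (auto intro: Q.frac_carrier)
qed

definition over_z where "over_z w = Q.frac (cls w) z"

definition l_words where "l_words = {w \<in> lists Y. length w = l}"

lemma deg_pow: "deg (z [^]\<^bsub>S\<^esub> (k::nat)) = k * l"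
  by (induction k) (auto simp: deg_mult deg_z deg_eq_0)

text \<open>Numerator and denominator of an element of degree zero have the same degree \<open>k l\<close>, and for \<open>k > 1\<close>
  the numerator is divisible by \<open>z\<close>. In particular the kernel of the degree is finite.\<close>

lemma kernel_eq: "{g \<in> carrier G. degG g = 0} = over_z ` l_words"
proof (intro equalityI subsetI)
  fix g assume "g \<in> {g \<in> carrier G. degG g = 0}"
  then obtain s c where s: "s \<in> carrier S" "c \<in> z_powers" "g = Q.frac s c" and 0: "degG g = 0"
    by (auto elim: Q.carrier_L_E)
  obtain k where k: "c = z [^]\<^bsub>S\<^esub> (k::nat)" using s(2) by (auto simp: z_powers_def)
  have *: "\<exists>v\<in>l_words. Q.frac (cls w) (z [^]\<^bsub>S\<^esub> k) = over_z v" if "w \<in> lists Y" "length w = k * l" for w k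
    using that
  proof (induction k arbitrary: w)
    case 0
    then have "w = []" by simp
    then have "Q.frac (cls w) (z [^]\<^bsub>S\<^esub> (0::nat)) = over_z (replicate l 1)"
      unfolding over_z_def z_def[symmetric] by (intro Q.frac_eqI) (auto simp: one_S[symmetric])
    moreover have "replicate l 1 \<in> l_words" using replicate_Y[OF one_Y] by (simp add: l_words_def)
    ultimately show ?case by blast
  next
    case (Suc k)
    show ?case
    proof (cases "k = 0")
      case True
      then have "w \<in> l_words" using Suc.prems by (simp add: l_words_def)
      then show ?thesis using True by (intro bexI[of _ w]) (simp_all add: over_z_def)
    next
      case False
      then have "2 * l \<le> Suc k * l" by (intro mult_le_mono1) simp
      then have "length w \<ge> 2 * l - 1" using Suc.prems(2) by linarith
      from long_word[OF Suc.prems(1) this] obtain v where v: "v \<in> lists Y" "length v = length w - l"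
        "cls w = z \<otimes>\<^bsub>S\<^esub> cls v" by blast
      have vc: "cls v \<in> carrier S" using v by (intro cls_carrier)
      have "Q.frac (cls w) (z [^]\<^bsub>S\<^esub> Suc k) = Q.frac (cls v) (z [^]\<^bsub>S\<^esub> k)"
        unfolding v(3)
      proof (rule Q.frac_eqI)
        show "z \<otimes>\<^bsub>S\<^esub> cls v \<otimes>\<^bsub>S\<^esub> z [^]\<^bsub>S\<^esub> k = cls v \<otimes>\<^bsub>S\<^esub> z [^]\<^bsub>S\<^esub> Suc k"
          unfolding z_central[OF vc] S.nat_pow_Suc2[OF z_carrier] using vc by (simp add: S.m_assoc)
      qed (use vc z_pow_in[of "Suc k"] in auto)
      moreover have "length v = k * l" using v Suc.prems by simp
      ultimately show ?thesis using Suc.IH[OF v(1)] by simp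
    qed
  qed
  obtain w where w: "w \<in> lists Y" "s = cls w" using s(1) by (rule carrier_S_E)
  have "int (length w) = int (k * l)" using 0 degG_frac[OF s(1,2)] deg_cls[OF w(1)] deg_pow[of k] s(3) k w(2) by simp
  then have "length w = k * l" by (simp only: of_nat_eq_iff)
  from *[OF w(1) this] show "g \<in> over_z ` l_words" using s(3) w(2) k by auto
next
  fix g assume "g \<in> over_z ` l_words"
  then obtain w where w: "w \<in> lists Y" "length w = l" "g = over_z w" by (auto simp: l_words_def)
  have "cls w \<in> carrier S" using w by (intro cls_carrier)
  then show "g \<in> {g \<in> carrier G. degG g = 0}"
    using degG_frac[of "cls w" z] deg_cls[OF w(1)] w deg_z by (simp add: over_z_def)
qed

lemma finite_l_words: "finite l_words"
proof -
  have "l_words = {w. set w \<subseteq> Y \<and> length w = l}" by (auto simp: l_words_def)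
  then show ?thesis using finite_lists_length_eq[OF finite_Y, of l] by simp
qed

lemma over_z_carrier: "w \<in> l_words \<Longrightarrow> over_z w \<in> carrier G"
  unfolding over_z_def by (intro Q.frac_carrier cls_carrier) (auto simp: l_words_def)

lemma over_z_mult: "u \<in> l_words \<Longrightarrow> v \<in> l_words \<Longrightarrow> over_z u \<otimes>\<^bsub>G\<^esub> over_z v = Q.frac (cls (u @ v)) (z \<otimes>\<^bsub>S\<^esub> z)"
  unfolding over_z_def l_words_def using Q.frac_mult[of "cls u" z "cls v" z] cls_mult[of u v] cls_carrier by simp

text \<open>The \<open>k\<close>-th letters of the two words are at distance \<open>l\<close> in their product, so they can be swapped
  for each \<open>k\<close> in turn.\<close>

lemma l_words_commute: assumes u: "u \<in> l_words" and v: "v \<in> l_words" shows "cls (u @ v) = cls (v @ u)"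
proof -
  have uv: "u \<in> lists Y" "v \<in> lists Y" "length u = l" "length v = l" using u v by (auto simp: l_words_def)
  have t: "take k w \<in> lists Y" "drop k w \<in> lists Y" if "w \<in> lists Y" for k and w :: "nat list"
    using that by (auto simp: in_lists_conv_set dest: in_set_takeD in_set_dropD)
  have "cls (u @ v) = cls (take k v @ drop k u @ take k u @ drop k v)" if "k \<le> l" for k
    using that
  proof (induction k)
    case (Suc k)
    then have k: "k < l" by simp
    have nth: "u ! k \<in> Y" "v ! k \<in> Y" using uv k by (auto simp: in_lists_conv_set)
    have 1: "take k v @ drop k u @ take k u @ drop k v =
        take k v @ [u ! k] @ (drop (Suc k) u @ take k u) @ [v ! k] @ drop (Suc k) v"
      using uv k by (simp add: Cons_nth_drop_Suc)
    have 2: "cls (take k v @ [u ! k] @ (drop (Suc k) u @ take k u) @ [v ! k] @ drop (Suc k) v) =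
        cls (take k v @ [v ! k] @ (drop (Suc k) u @ take k u) @ [u ! k] @ drop (Suc k) v)"
      using uv k t nth by (intro swap_letters) auto
    have 3: "take k v @ [v ! k] @ (drop (Suc k) u @ take k u) @ [u ! k] @ drop (Suc k) v =
        take (Suc k) v @ drop (Suc k) u @ take (Suc k) u @ drop (Suc k) v"
      using uv k by (simp add: take_Suc_conv_app_nth)
    from Suc.IH[OF less_imp_le_nat[OF k]] show ?case unfolding 1 2 3 .
  qed simp
  from this[of l] show ?thesis using uv by simp
qed

lemma over_z_commute: "u \<in> l_words \<Longrightarrow> v \<in> l_words \<Longrightarrow> over_z u \<otimes>\<^bsub>G\<^esub> over_z v = over_z v \<otimes>\<^bsub>G\<^esub> over_z u"
  by (simp only: over_z_mult l_words_commute)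

subsection \<open>The exponent of the kernel\<close>

definition one_letter where "one_letter k i = replicate k 1 @ [i] @ replicate (l - 1 - k) (1::nat)"

lemma one_letter_l_words: "i \<in> Y \<Longrightarrow> k < l \<Longrightarrow> one_letter k i \<in> l_words"
  using one_Y by (auto simp: one_letter_def l_words_def)

lemma over_z_ones: "over_z (replicate l 1) = \<one>\<^bsub>G\<^esub>"
  unfolding over_z_def z_def[symmetric] Q.one_L by (intro Q.frac_eqI) auto

lemma one_letter_mult:
  assumes \<tau>: "\<tau> \<in> H" and i: "i \<in> Y" and j: "j \<in> Y" and k: "k < l"
  shows "over_z (one_letter k i) \<otimes>\<^bsub>G\<^esub> over_z (one_letter k j) = over_z (one_letter k (\<tau> i)) \<otimes>\<^bsub>G\<^esub> over_z (one_letter k (inv' \<tau> j))"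
proof -
  let ?m = "l - 1 - k"
  have e: "one_letter k i @ one_letter k j =
      replicate k 1 @ [i] @ (replicate ?m 1 @ replicate k 1) @ [j] @ replicate ?m 1" for i j
    by (simp add: one_letter_def)
  have "cls (one_letter k i @ one_letter k j) = cls (one_letter k (\<tau> i) @ one_letter k (inv' \<tau> j))"
    unfolding e using one_Y k by (intro distant_letters \<tau> i j) auto
  then show ?thesis
    using over_z_mult one_letter_l_words i j k H_image[OF \<tau>] H_image[OF H_inv[OF \<tau>]] by simp
qed

lemma H_power: "\<tau> \<in> H \<Longrightarrow> \<tau> ^^ card H = id" "\<tau> \<in> H \<Longrightarrow> \<tau> ^^ k \<in> H"
proof -
  assume \<tau>: "\<tau> \<in> H"
  interpret P: group "sym_group n" by (rule sym_group_is_group)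
  interpret HH: group "(sym_group n)\<lparr>carrier := H\<rparr>" by (rule P.subgroup_imp_group[OF H])
  have pow: "\<tau> [^]\<^bsub>(sym_group n)\<lparr>carrier := H\<rparr>\<^esub> k = \<tau> ^^ k" for k :: nat
  proof (induction k)
    case (Suc k)
    then show ?case by (simp add: sym_group_mult funpow_Suc_right del: funpow.simps)
  qed (simp add: sym_group_one)
  show "\<tau> ^^ k \<in> H" using HH.nat_pow_closed[of \<tau> k] \<tau> unfolding pow by simp
  show "\<tau> ^^ card H = id"
    using HH.pow_order_eq_1[of \<tau>] \<tau> unfolding pow by (simp add: order_def sym_group_one)
qed

text \<open>Let \<open>i = \<tau> 1\<close>. In a product of two such words, \<open>\<tau>\<close> moves a letter \<open>j\<close> to \<open>\<tau> j\<close> at the price of moving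
  the letter \<open>i\<close> at distance \<open>l\<close> back to \<open>1\<close>. So the \<open>a\<close>-th power of the fraction for \<open>i\<close> is the fraction
  for \<open>\<tau>\<^sup>a 1\<close>, which is trivial when \<open>a\<close> is the order of \<open>H\<close>.\<close>

lemma one_letter_exponent:
  assumes i: "i \<in> Y" and k: "k < l"
  shows "over_z (one_letter k i) [^]\<^bsub>G\<^esub> card H = \<one>\<^bsub>G\<^esub>"
proof -
  obtain \<tau> where \<tau>: "\<tau> \<in> H" "\<tau> 1 = i" using transitive[OF one_Y i] by blast
  have ones: "over_z (one_letter k 1) = \<one>\<^bsub>G\<^esub>"
  proof -
    have "one_letter k 1 = replicate l 1"
      unfolding one_letter_def using k by (simp add: replicate_Suc[symmetric] replicate_add[symmetric] del: replicate_Suc)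
    then show ?thesis using over_z_ones by simp
  qed
  have pY: "(\<tau> ^^ a) 1 \<in> Y" for a using H_image[OF H_power(2)[OF \<tau>(1)] one_Y] .
  have pow: "over_z (one_letter k i) [^]\<^bsub>G\<^esub> a = over_z (one_letter k ((\<tau> ^^ a) 1))" for a :: nat
  proof (induction a)
    case 0
    then show ?case using ones by simp
  next
    case (Suc a)
    have "inv' \<tau> i = 1" using permutes_inverses(2)[OF H_permutes[OF \<tau>(1)], of 1] \<tau>(2) by simp
    then have "over_z (one_letter k ((\<tau> ^^ a) 1)) \<otimes>\<^bsub>G\<^esub> over_z (one_letter k i) = over_z (one_letter k (\<tau> ((\<tau> ^^ a) 1))) \<otimes>\<^bsub>G\<^esub> \<one>\<^bsub>G\<^esub>"
      using one_letter_mult[OF \<tau>(1) pY[of a] i k] ones by simp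
    also have "\<dots> = over_z (one_letter k ((\<tau> ^^ Suc a) 1))"
      using over_z_carrier[OF one_letter_l_words[OF pY[of "Suc a"] k]] by simp
    finally show ?case using Suc by simp
  qed
  show ?thesis unfolding pow H_power(1)[OF \<tau>(1)] using ones by simp
qed

text \<open>A fraction \<open>w / z\<close> is the product of the fractions for the single letters of \<open>w\<close>: multiplying the
  word that agrees with \<open>w\<close> in its first \<open>k\<close> letters and is \<open>1\<close> from there on by the one-letter word for
  the next letter, and swapping letters at distance \<open>l\<close>, extends the agreement by one letter.\<close>

lemma kernel_exponent:
  assumes w: "w \<in> l_words" shows "over_z w [^]\<^bsub>G\<^esub> card H = \<one>\<^bsub>G\<^esub>"
proof -
  have wY: "w \<in> lists Y" "length w = l" using w by (auto simp: l_words_def)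
  define pre where "pre k = take k w @ replicate (l - k) (1::nat)" for k
  have pre: "pre k \<in> l_words" if "k \<le> l" for k
    using that wY one_Y by (auto simp: pre_def l_words_def in_lists_conv_set dest: in_set_takeD)
  have "over_z (pre k) [^]\<^bsub>G\<^esub> card H = \<one>\<^bsub>G\<^esub>" if "k \<le> l" for k
    using that
  proof (induction k)
    case 0
    then show ?case using over_z_ones by (simp add: pre_def)
  next
    case (Suc k)
    then have k: "k < l" "k \<le> l" "Suc k \<le> l" by auto
    have wk: "w ! k \<in> Y" using wY k by (auto simp: in_lists_conv_set)
    let ?m = "l - 1 - k"
    have tk: "take k w \<in> lists Y" using wY by (auto simp: in_lists_conv_set dest: in_set_takeD)
    have r: "replicate (l - k) 1 = [1] @ replicate ?m (1::nat)"
      using k by (simp add: replicate_Suc[symmetric] del: replicate_Suc)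
    have a: "pre k @ one_letter k (w ! k) =
        take k w @ [1] @ (replicate ?m 1 @ replicate k 1) @ [w ! k] @ replicate ?m 1"
      unfolding pre_def one_letter_def r by simp
    have b: "take k w @ [w ! k] @ (replicate ?m 1 @ replicate k 1) @ [1] @ replicate ?m 1 =
        pre (Suc k) @ replicate l 1"
    proof -
      have "take (Suc k) w = take k w @ [w ! k]" using k wY by (simp add: take_Suc_conv_app_nth)
      moreover have "replicate k 1 @ [1] @ replicate ?m 1 = replicate l (1::nat)"
        using k by (simp add: replicate_Suc[symmetric] replicate_add[symmetric] del: replicate_Suc)
      ultimately show ?thesis by (simp add: pre_def)
    qed
    have "cls (pre k @ one_letter k (w ! k)) = cls (pre (Suc k) @ replicate l 1)"
      unfolding a b[symmetric] using one_Y wk k tk by (intro swap_letters) auto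
    then have "over_z (pre k) \<otimes>\<^bsub>G\<^esub> over_z (one_letter k (w ! k)) = over_z (pre (Suc k)) \<otimes>\<^bsub>G\<^esub> over_z (replicate l 1)"
      using over_z_mult pre k one_letter_l_words[OF wk k(1)] one_Y by (simp add: l_words_def)
    then have e: "over_z (pre (Suc k)) = over_z (pre k) \<otimes>\<^bsub>G\<^esub> over_z (one_letter k (w ! k))"
      using over_z_ones over_z_carrier[OF pre[OF k(3)]] by simp
    have "over_z (pre (Suc k)) [^]\<^bsub>G\<^esub> card H =
        over_z (pre k) [^]\<^bsub>G\<^esub> card H \<otimes>\<^bsub>G\<^esub> over_z (one_letter k (w ! k)) [^]\<^bsub>G\<^esub> card H"
      unfolding e
      using over_z_carrier pre[OF k(2)] one_letter_l_words[OF wk k(1)]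
      by (intro G.pow_mult_distrib over_z_commute) auto
    then show ?case using Suc.IH[OF k(2)] one_letter_exponent[OF wk k(1)] by simp
  qed
  from this[of l] show ?thesis using wY by (simp add: pre_def)
qed

lemma kernel_subgroup: "subgroup {g \<in> carrier G. degG g = 0} G"
proof (rule G.subgroupI)
  have one: "degG \<one>\<^bsub>G\<^esub> = 0" using degG_mult[of "\<one>\<^bsub>G\<^esub>" "\<one>\<^bsub>G\<^esub>"] by simp
  then show "{g \<in> carrier G. degG g = 0} \<noteq> {}" by auto
  show "inv\<^bsub>G\<^esub> g \<in> {g \<in> carrier G. degG g = 0}" if "g \<in> {g \<in> carrier G. degG g = 0}" for g
    using that one degG_mult[of "inv\<^bsub>G\<^esub> g" g] by simp
qed (auto simp: degG_mult)

text \<open>If the order of the kernel vanished in \<open>K\<close>, the characteristic would be a prime dividing it. By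
  Cauchy's theorem the kernel has an element of that order, which by the bound on the exponent divides
  the order of \<open>H\<close>; so \<open>H\<close> has an element of that order, too.\<close>

lemma finite_by_cyclic_G:
  assumes K: "field K" and char: "\<forall>\<sigma>\<in>H. group.ord (sym_group n) \<sigma> \<noteq> ring_char K"
  shows "finite_by_cyclic K G degG xG"
proof -
  interpret K: field K by fact
  interpret P: group "sym_group n" by (rule sym_group_is_group)
  let ?N = "{g \<in> carrier G. degG g = 0}"
  have fin: "finite ?N" unfolding kernel_eq using finite_l_words by simp
  have "[card ?N] \<cdot>\<^bsub>K\<^esub> \<one>\<^bsub>K\<^esub> \<noteq> \<zero>\<^bsub>K\<^esub>"
  proof
    let ?c = "ring_char K"
    assume "[card ?N] \<cdot>\<^bsub>K\<^esub> \<one>\<^bsub>K\<^esub> = \<zero>\<^bsub>K\<^esub>"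
    then have dvd: "?c dvd card ?N"
      using K.add.pow_eq_id[of "\<one>\<^bsub>K\<^esub>" "card ?N"] by (simp add: ring_char_def add_pow_def)
    have "\<one>\<^bsub>G\<^esub> \<in> ?N" using subgroup.one_closed[OF kernel_subgroup] .
    then have pos: "card ?N \<noteq> 0" using card_0_eq[OF fin] by blast
    have c0: "?c \<noteq> 0"
    proof
      assume "?c = 0"
      then have "0 dvd card ?N" using dvd by (simp only:)
      then show False using pos by (simp only: dvd_0_left_iff)
    qed
    have pr: "prime ?c" by (rule K.prime_char[OF c0])
    obtain g where g: "g \<in> ?N" "G.ord g = ?c" using G.Cauchy_subgroup[OF pr kernel_subgroup fin dvd] by blast
    obtain w where "w \<in> l_words" "g = over_z w" using g(1) unfolding kernel_eq by blast
    then have "g [^]\<^bsub>G\<^esub> card H = \<one>\<^bsub>G\<^esub>" using kernel_exponent by simp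
    then have "?c dvd card H" using G.pow_eq_id[of g "card H"] g by simp
    moreover have "finite H"
      using subgroup.subset[OF H] finite_permutations[of "{1..n}"]
      by (auto simp: sym_group_def intro: finite_subset)
    ultimately obtain \<sigma> where "\<sigma> \<in> H" "P.ord \<sigma> = ?c" using P.Cauchy_subgroup[OF pr H] by blast
    then show False using char by simp
  qed
  moreover have "g \<otimes>\<^bsub>G\<^esub> h = h \<otimes>\<^bsub>G\<^esub> g"
    if "g \<in> carrier G" "h \<in> carrier G" "degG g = 0" "degG h = 0" for g h
  proof -
    have "g \<in> over_z ` l_words" "h \<in> over_z ` l_words" using that unfolding kernel_eq[symmetric] by auto
    then show ?thesis using over_z_commute by blast
  qed
  ultimately show ?thesis
    using degG_mult xG fin
    by (intro finite_by_cyclic.intro finite_by_cyclic_axioms.intro monoid_alg.intro K K.is_cring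
        G.monoid_axioms G.group_axioms) auto
qed

text \<open>The group is generated from the finite set \<open>B\<close> by multiplication with the central elements \<open>z\<close>
  and \<open>z\<^sup>-\<^sup>1\<close>.\<close>

lemma PI_algebra_G:
  assumes K: "field K" shows "PI_algebra K (monoid_algebra K G)"
proof -
  interpret K: field K by fact
  interpret monoid_alg K G by (intro monoid_alg.intro K.is_cring G.monoid_axioms)
  let ?i = "\<lambda>s. Q.frac s \<one>\<^bsub>S\<^esub>" and ?z = "Q.frac \<one>\<^bsub>S\<^esub> z"
  show ?thesis
  proof (rule PI_algebra_if_generated_over_central[OF K, of "?i ` B" "{?i z, ?z}"])
    show "finite (?i ` B)" "?i ` B \<subseteq> carrier G" using B_finite B_carrier by auto
    show "y \<in> carrier G" if "y \<in> {?i z, ?z}" for y using that by auto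
    show "y \<otimes>\<^bsub>G\<^esub> g = g \<otimes>\<^bsub>G\<^esub> y" if y: "y \<in> {?i z, ?z}" and g: "g \<in> carrier G" for y g
    proof -
      obtain s c where s: "s \<in> carrier S" "c \<in> z_powers" "g = Q.frac s c" using g by (rule Q.carrier_L_E)
      have "z \<otimes>\<^bsub>S\<^esub> c = c \<otimes>\<^bsub>S\<^esub> z" using s by (intro z_central) auto
      then show ?thesis using y s z_central[OF s(1)] by (auto simp: Q.frac_mult)
    qed
    fix X assume X: "?i ` B \<subseteq> X" "\<And>y g. y \<in> {?i z, ?z} \<Longrightarrow> g \<in> X \<Longrightarrow> g \<in> carrier G \<Longrightarrow> y \<otimes>\<^bsub>G\<^esub> g \<in> X"
    have 1: "?i (z [^]\<^bsub>S\<^esub> (k::nat) \<otimes>\<^bsub>S\<^esub> b) \<in> X" if b: "b \<in> B" for b k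
    proof (induction k)
      case 0
      have "b \<in> carrier S" using b B_carrier by auto
      then show ?case using b X(1) by auto
    next
      case (Suc k)
      have bc: "b \<in> carrier S" using b B_carrier by auto
      have "?i z \<otimes>\<^bsub>G\<^esub> ?i (z [^]\<^bsub>S\<^esub> k \<otimes>\<^bsub>S\<^esub> b) \<in> X" using bc Suc by (intro X(2)) auto
      moreover have "?i z \<otimes>\<^bsub>G\<^esub> ?i (z [^]\<^bsub>S\<^esub> k \<otimes>\<^bsub>S\<^esub> b) = ?i (z [^]\<^bsub>S\<^esub> Suc k \<otimes>\<^bsub>S\<^esub> b)"
        unfolding S.nat_pow_Suc2[OF z_carrier] using bc by (simp add: Q.frac_mult S.m_assoc)
      ultimately show ?case by simp
    qed
    have 2: "?i s \<in> X" if "s \<in> carrier S" for s using B_gen[OF that] 1 by blast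
    have 3: "Q.frac s (z [^]\<^bsub>S\<^esub> (k::nat)) \<in> X" if s: "s \<in> carrier S" for s k
    proof (induction k)
      case 0
      then show ?case using 2[OF s] by simp
    next
      case (Suc k)
      have "?z \<otimes>\<^bsub>G\<^esub> Q.frac s (z [^]\<^bsub>S\<^esub> k) \<in> X" using s Suc by (intro X(2)) auto
      moreover have "?z \<otimes>\<^bsub>G\<^esub> Q.frac s (z [^]\<^bsub>S\<^esub> k) = Q.frac s (z [^]\<^bsub>S\<^esub> Suc k)"
        unfolding S.nat_pow_Suc2[OF z_carrier] using s by (simp add: Q.frac_mult)
      ultimately show ?case by simp
    qed
    show "carrier G \<subseteq> X"
    proof
      fix g assume "g \<in> carrier G"
      then obtain s c where "s \<in> carrier S" "c \<in> z_powers" "g = Q.frac s c" by (rule Q.carrier_L_E)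
      then show "g \<in> X" using 3 by (auto simp: z_powers_def)
    qed
  qed
qed

end

section \<open>The algebras of a transitive permutation group\<close>

theorem theorem3p2:
  fixes n l :: nat
    and H :: "(nat \<Rightarrow> nat) set"
    and K :: "('k, 'c) ring_scheme"
  assumes "n \<ge> 1" and "l \<ge> 2"
    and "subgroup H (sym_group n)"
    and "transitive_perms n H"
    and "field K"
  shows "left_noetherian (monoid_algebra K (perm_monoid n l H))
    \<and> right_noetherian (monoid_algebra K (perm_monoid n l H))
    \<and> PI_algebra K (monoid_algebra K (perm_monoid n l H))
    \<and> GKdim K (monoid_algebra K (perm_monoid n l H)) = 1
    \<and> clKdim (monoid_algebra K (perm_monoid n l H)) = 1
    \<and> (comm_group ((sym_group n)\<lparr>carrier := H\<rparr>)
        \<and> (\<forall>\<sigma>\<in>H. group.ord (sym_group n) \<sigma> \<noteq> ring_char K) \<longrightarrow>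
          PI_algebra K (monoid_algebra K (perm_fractions n l H))
        \<and> principal_right_ideal_ring (monoid_algebra K (perm_fractions n l H))
        \<and> principal_left_ideal_ring (monoid_algebra K (perm_fractions n l H)))"
proof -
  interpret P: transitive_perm_monoid n l H using assms(1-4) by (rule transitive_perm_monoid.intro)
  interpret D: graded_central_power K "perm_monoid n l H" P.z P.B P.deg "P.cls [1]"
    by (rule P.graded_central_power[OF assms(5)])
  have "principal_right_ideal_ring (monoid_algebra K (perm_fractions n l H))
      \<and> principal_left_ideal_ring (monoid_algebra K (perm_fractions n l H))"
    if "\<forall>\<sigma>\<in>H. group.ord (sym_group n) \<sigma> \<noteq> ring_char K"
  proof -
    interpret F: finite_by_cyclic K P.G P.degG P.xG by (rule P.finite_by_cyclic_G[OF assms(5) that])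
    show ?thesis
      unfolding P.perm_fractions_eq
      using F.principal_right_ideal_ring_A F.principal_left_ideal_ring_A by blast
  qed
  then show ?thesis
    using D.left_noetherian_A D.right_noetherian_A D.PI_algebra_A D.GKdim_A D.clKdim_A
      P.PI_algebra_G[OF assms(5)] P.perm_fractions_eq by simp
qed

end
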